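(* Let $e\ge3$ be an integer, $\zeta=\exp(2\pi i/e)$, $k=\mathbb{Q}(\zeta+\zeta^{-1})$, so that $\mathbb{Z}_k=\mathbb{Z}[\zeta+\zeta^{-1}]$. Let $V=k^2$ with standard basis $e_1,e_2$ and let $G\subset\mathrm{GL}_2(k)$ be the dihedral group of order $2e$ generated by $$s=\begin{pmatrix}-1&2+\zeta+\zeta^{-1}\\0&1\end{pmatrix},\qquad t=\begin{pmatrix}1&0\\1&-1\end{pmatrix}.$$ Let $\mathfrak r_s=(\mathbb{Z}_ke_1,\ \mathbb{Z}_k(2e'_1-(2+\zeta+\zeta^{-1})e'_2),\ -1)$ and $\mathfrak r_t=(\mathbb{Z}_ke_2,\ \mathbb{Z}_k(-e'_1+2e'_2),\ -1)$. If $e$ is odd let $\mathfrak R:=\{(st)^n\cdot\mathfrak r_s\mid0\le n<e\}$. If $e$ is even let $\mathfrak R_s:=\{(st)^n\cdot\mathfrak r_s\mid0\le n<e/2\}$, $\mathfrak R_t:=\{(st)^n\cdot\mathfrak r_t\mid0\le n<e/2\}$ and $\mathfrak R:=\mathfrak R_s\cup\mathfrak R_t$. (1) In both cases $\mathfrak R$ is a complete, reduced, distinguished and principal $\mathbb{Z}_k$-root system for $G$ with root basis $\{\mathfrak r_s,\mathfrak r_t\}$. (2) There is a single genus of reduced $\mathbb{Z}_k$-root systems for $G$ unless $e=2p^l$ with $p$ prime and $l\ge1$. In this last case there is (exactly) one other genus, represented by the principal root system $(2+\zeta+\zeta^{-1})\cdot\mathfrak R_s\cup\mathfrak R_t$.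
   Context: $W$ is a $k$-vector space paired with $V$ by a Hermitian (here $k$ is real, hence bilinear) non-degenerate pairing $\langle\cdot,\cdot\rangle:V\times W\to k$, and $e'_1,e'_2$ is the basis of $W$ dual to $e_1,e_2$. For $g\in\mathrm{GL}(V)$, $g^\vee\in\mathrm{GL}(W)$ is the unique element with $\langle gv,g^\vee w\rangle=\langle v,w\rangle$. A reflection is a finite order $s\in\mathrm{GL}(V)$ with $\ker(s-1)$ a hyperplane. A $\mathbb{Z}_k$-root is a triple $\mathfrak r=(I,J,\xi)$ with $I\subset V$, $J\subset W$ rank one finitely generated $\mathbb{Z}_k$-submodules, $\xi\ne1$ a root of unity in $k$, and $\langle I,J\rangle=(1-\xi)\mathbb{Z}_k$ (the fractional ideal generated by all $\langle\alpha,\beta\rangle$). Its reflection is $s_{\mathfrak r}(x)=x-\langle x,w\rangle v$ for $v\in kI,w\in kJ$ with $\langle v,w\rangle=1-\xi$. Put $g\cdot(I,J,\xi)=(g(I),g^\vee(J),\xi)$ for $g\in\mathrm{GL}(V)$; for a nonzero fractional ideal $\mathfrak a$ put $\mathfrak a\cdot(I,J,\xi)=(\mathfrak aI,\mathfrak a^{-1}J,\xi)$ (conjugation being trivial on $k$), and for $\lambda\in k^\times$ put $\lambda\cdot\mathfrak r=(\lambda\mathbb{Z}_k)\cdot\mathfrak r$. A root is principal if $I$ (equivalently $J$) is a free $\mathbb{Z}_k$-module. A $\mathbb{Z}_k$-root system is a finite set $\mathfrak R$ of $\mathbb{Z}_k$-roots whose $I_{\mathfrak r}$ generate $V$, with $s_{\mathfrak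 r}\cdot\mathfrak R=\mathfrak R$ for $\mathfrak r\in\mathfrak R$ and $\langle I_{\mathfrak r_1},J_{\mathfrak r_2}\rangle\subseteq\mathbb{Z}_k$ for $\mathfrak r_1,\mathfrak r_2\in\mathfrak R$. It is a root system for $G$ if the $s_{\mathfrak r}$ generate $G$; principal if all its roots are; reduced if $\mathfrak r\mapsto s_{\mathfrak r}$ is injective; complete if every reflection of $G$ is some $s_{\mathfrak r}$; distinguished if it is reduced and every $s_{\mathfrak r}$ is a distinguished reflection of $G$ (i.e. $\det s_{\mathfrak r}=\exp(2\pi i/c)$ with $c$ the order of the pointwise stabilizer in $G$ of its hyperplane). Two root systems are of the same genus if $\mathfrak R_2=\mathfrak a\cdot\mathfrak R_1$ for some fractional ideal $\mathfrak a$. A root basis of $\mathfrak R$ is a subset $\Pi\subset\mathfrak R$ such that $\sum_{\mathfrak r\in\mathfrak R}I_{\mathfrak r}=\bigoplus_{\mathfrak r\in\Pi}I_{\mathfrak r}$ and $(s_{\mathfrak r})_{\mathfrak r\in\Pi}$ generates the group. *)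

theory Defs
  imports
    "HOL-Analysis.Analysis"
    "HOL-Algebra.Generated_Groups"
    "HOL-Computational_Algebra.Computational_Algebra"
begin

section \<open>Subfields of the complex numbers, modules and fractional ideals\<close>

definition complex_subfield :: "complex set \<Rightarrow> bool" where
  "complex_subfield K \<longleftrightarrow> 0 \<in> K \<and> 1 \<in> K \<and>
     (\<forall>x\<in>K. \<forall>y\<in>K. x + y \<in> K \<and> x * y \<in> K) \<and> (\<forall>x\<in>K. - x \<in> K \<and> inverse x \<in> K)"

definition ring_of_integers :: "complex set \<Rightarrow> complex set" where
  "ring_of_integers K = {x \<in> K. algebraic_int x}"

text \<open>
  A subring R of the complex numbers acts on scalars by multiplication and on vectors
  by the componentwise product \<^term>\<open>(*s)\<close>; the action is passed as the parameter
  \<open>act\<close> so that ideals and modules of vectors are treated alike.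
\<close>

definition is_submodule ::
    "complex set \<Rightarrow> (complex \<Rightarrow> 'v \<Rightarrow> 'v) \<Rightarrow> 'v::ab_group_add set \<Rightarrow> bool" where
  "is_submodule R act M \<longleftrightarrow> 0 \<in> M \<and> (\<forall>x\<in>M. \<forall>y\<in>M. x + y \<in> M) \<and> (\<forall>c\<in>R. \<forall>x\<in>M. act c x \<in> M)"

definition module_span ::
    "complex set \<Rightarrow> (complex \<Rightarrow> 'v \<Rightarrow> 'v) \<Rightarrow> 'v::ab_group_add set \<Rightarrow> 'v set" where
  "module_span R act S = is_submodule R act hull S"

definition finitely_generated ::
    "complex set \<Rightarrow> (complex \<Rightarrow> 'v \<Rightarrow> 'v) \<Rightarrow> 'v::ab_group_add set \<Rightarrow> bool" where
  "finitely_generated R act M \<longleftrightarrow> (\<exists>S. finite S \<and> M = module_span R act S)"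

definition free_module ::
    "complex set \<Rightarrow> (complex \<Rightarrow> 'v \<Rightarrow> 'v) \<Rightarrow> 'v::ab_group_add set \<Rightarrow> bool" where
  "free_module R act M \<longleftrightarrow>
     (\<exists>B. M = module_span R act B \<and>
          (\<forall>F c. finite F \<and> F \<subseteq> B \<and> (\<forall>b\<in>F. c b \<in> R) \<and> (\<Sum>b\<in>F. act (c b) b) = 0
                 \<longrightarrow> (\<forall>b\<in>F. c b = 0)))"

definition nonzero_fractional_ideal :: "complex set \<Rightarrow> complex set \<Rightarrow> bool" where
  "nonzero_fractional_ideal K \<aa> \<longleftrightarrow>
     \<aa> \<subseteq> K \<and> \<aa> \<noteq> {0} \<and> finitely_generated (ring_of_integers K) (*) \<aa>"

definition inverse_ideal :: "complex set \<Rightarrow> complex set \<Rightarrow> complex set" where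
  "inverse_ideal K \<aa> = {x \<in> K. \<forall>a\<in>\<aa>. x * a \<in> ring_of_integers K}"

definition principal_ideal :: "complex set \<Rightarrow> complex \<Rightarrow> complex set" where
  "principal_ideal K c = {c * x |x. x \<in> ring_of_integers K}"

section \<open>The space, its dual and linear maps\<close>

text \<open>
  \<open>vspace K\<close> is the space of vectors with coordinates in K. It plays the role of V
  (coordinates with respect to a basis) and also of W (coordinates with respect to the dual basis),
  so that the pairing is the standard bilinear form below. The field K of interest is real, so
  the Hermitian pairing involves no conjugation.
\<close>

definition vspace :: "complex set \<Rightarrow> (complex ^ 'n) set" where
  "vspace K = {v. \<forall>i. v $ i \<in> K}"

definition pairing :: "complex ^ 'n \<Rightarrow> complex ^ 'n \<Rightarrow> complex" where
  "pairing v w = (\<Sum>i\<in>UNIV. v $ i * w $ i)"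

definition GL :: "complex set \<Rightarrow> (complex ^ 'n ^ 'n) monoid" where
  "GL K = \<lparr>carrier = {A. (\<forall>i j. A $ i $ j \<in> K) \<and> invertible A}, mult = (**), one = mat 1\<rparr>"

definition contragredient :: "complex set \<Rightarrow> complex ^ 'n ^ 'n \<Rightarrow> complex ^ 'n ^ 'n" where
  "contragredient K g = (THE h. h \<in> carrier (GL K) \<and>
     (\<forall>v\<in>vspace K. \<forall>w\<in>vspace K. pairing (g *v v) (h *v w) = pairing v w))"

definition hyperplane :: "complex set \<Rightarrow> (complex ^ 'n) set \<Rightarrow> bool" where
  "hyperplane K H \<longleftrightarrow> H \<subseteq> vspace K \<and> is_submodule K (*s) H \<and>
     (\<exists>v. v \<in> vspace K - H \<and> module_span K (*s) (insert v H) = vspace K)"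

definition fixed_space :: "complex set \<Rightarrow> complex ^ 'n ^ 'n \<Rightarrow> (complex ^ 'n) set" where
  "fixed_space K s = {x \<in> vspace K. s *v x = x}"

definition is_reflection :: "complex set \<Rightarrow> complex ^ 'n ^ 'n \<Rightarrow> bool" where
  "is_reflection K s \<longleftrightarrow> s \<in> carrier (GL K) \<and>
     (\<exists>m::nat. m > 0 \<and> s [^]\<^bsub>GL K\<^esub> m = \<one>\<^bsub>GL K\<^esub>) \<and> hyperplane K (fixed_space K s)"

definition pointwise_stabilizer ::
    "(complex ^ 'n ^ 'n) set \<Rightarrow> (complex ^ 'n) set \<Rightarrow> (complex ^ 'n ^ 'n) set" where
  "pointwise_stabilizer G H = {g \<in> G. \<forall>x\<in>H. g *v x = x}"

definition distinguished_reflection ::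
    "complex set \<Rightarrow> (complex ^ 'n ^ 'n) set \<Rightarrow> complex ^ 'n ^ 'n \<Rightarrow> bool" where
  "distinguished_reflection K G s \<longleftrightarrow> s \<in> G \<and> is_reflection K s \<and>
     det s = exp (2 * of_real pi * \<i> / of_nat (card (pointwise_stabilizer G (fixed_space K s))))"

section \<open>Roots and root systems\<close>

datatype 'n zroot =
  ZRoot (root_I: "(complex ^ 'n) set") (root_J: "(complex ^ 'n) set") (root_xi: complex)

definition rank_one_lattice :: "complex set \<Rightarrow> (complex ^ 'n) set \<Rightarrow> bool" where
  "rank_one_lattice K I \<longleftrightarrow> I \<subseteq> vspace K \<and> finitely_generated (ring_of_integers K) (*s) I \<and>
     (\<exists>v. v \<noteq> 0 \<and> module_span K (*s) I = module_span K (*s) {v})"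

definition pairing_ideal ::
    "complex set \<Rightarrow> (complex ^ 'n) set \<Rightarrow> (complex ^ 'n) set \<Rightarrow> complex set" where
  "pairing_ideal K I J = module_span (ring_of_integers K) (*) {pairing \<alpha> \<beta> |\<alpha> \<beta>. \<alpha> \<in> I \<and> \<beta> \<in> J}"

definition is_root :: "complex set \<Rightarrow> 'n::finite zroot \<Rightarrow> bool" where
  "is_root K r \<longleftrightarrow> rank_one_lattice K (root_I r) \<and> rank_one_lattice K (root_J r) \<and>
     root_xi r \<in> K \<and> root_xi r \<noteq> 1 \<and> (\<exists>m::nat. m > 0 \<and> root_xi r ^ m = 1) \<and>
     pairing_ideal K (root_I r) (root_J r) = principal_ideal K (1 - root_xi r)"

definition root_reflection :: "complex set \<Rightarrow> 'n::finite zroot \<Rightarrow> complex ^ 'n ^ 'n" where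
  "root_reflection K r = (THE s. s \<in> carrier (GL K) \<and>
     (\<exists>v w. v \<in> module_span K (*s) (root_I r) \<and> w \<in> module_span K (*s) (root_J r) \<and>
            pairing v w = 1 - root_xi r \<and>
            (\<forall>x\<in>vspace K. s *v x = x - pairing x w *s v)))"

definition root_act ::
    "complex set \<Rightarrow> complex ^ 'n ^ 'n \<Rightarrow> 'n::finite zroot \<Rightarrow> 'n zroot" where
  "root_act K g r =
     ZRoot ((\<lambda>x. g *v x) ` root_I r) ((\<lambda>y. contragredient K g *v y) ` root_J r) (root_xi r)"

definition ideal_times ::
    "complex set \<Rightarrow> complex set \<Rightarrow> (complex ^ 'n) set \<Rightarrow> (complex ^ 'n) set" where
  "ideal_times K \<aa> I = module_span (ring_of_integers K) (*s) {a *s x |a x. a \<in> \<aa> \<and> x \<in> I}"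

definition root_twist :: "complex set \<Rightarrow> complex set \<Rightarrow> 'n::finite zroot \<Rightarrow> 'n zroot" where
  "root_twist K \<aa> r =
     ZRoot (ideal_times K \<aa> (root_I r)) (ideal_times K (inverse_ideal K \<aa>) (root_J r)) (root_xi r)"

definition principal_root :: "complex set \<Rightarrow> 'n::finite zroot \<Rightarrow> bool" where
  "principal_root K r \<longleftrightarrow> free_module (ring_of_integers K) (*s) (root_I r)"

definition root_system :: "complex set \<Rightarrow> 'n::finite zroot set \<Rightarrow> bool" where
  "root_system K R \<longleftrightarrow> finite R \<and> (\<forall>r\<in>R. is_root K r) \<and>
     module_span K (*s) (\<Union>r\<in>R. root_I r) = vspace K \<and>
     (\<forall>r\<in>R. root_act K (root_reflection K r) ` R = R) \<and>
     (\<forall>r1\<in>R. \<forall>r2\<in>R. pairing_ideal K (root_I r1) (root_J r2) \<subseteq> ring_of_integers K)"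

definition root_group :: "complex set \<Rightarrow> 'n::finite zroot set \<Rightarrow> (complex ^ 'n ^ 'n) set" where
  "root_group K R = generate (GL K) (root_reflection K ` R)"

definition root_system_for ::
    "complex set \<Rightarrow> (complex ^ 'n ^ 'n) set \<Rightarrow> 'n::finite zroot set \<Rightarrow> bool" where
  "root_system_for K G R \<longleftrightarrow> root_system K R \<and> root_group K R = G"

definition principal_system :: "complex set \<Rightarrow> 'n::finite zroot set \<Rightarrow> bool" where
  "principal_system K R \<longleftrightarrow> (\<forall>r\<in>R. principal_root K r)"

definition reduced_system :: "complex set \<Rightarrow> 'n::finite zroot set \<Rightarrow> bool" where
  "reduced_system K R \<longleftrightarrow> inj_on (root_reflection K) R"

definition complete_system ::
    "complex set \<Rightarrow> (complex ^ 'n ^ 'n) set \<Rightarrow> 'n::finite zroot set \<Rightarrow> bool" where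
  "complete_system K G R \<longleftrightarrow> (\<forall>s\<in>G. is_reflection K s \<longrightarrow> s \<in> root_reflection K ` R)"

definition distinguished_system ::
    "complex set \<Rightarrow> (complex ^ 'n ^ 'n) set \<Rightarrow> 'n::finite zroot set \<Rightarrow> bool" where
  "distinguished_system K G R \<longleftrightarrow>
     reduced_system K R \<and> (\<forall>r\<in>R. distinguished_reflection K G (root_reflection K r))"

text \<open>The last condition says that the sum of the \<open>root_I r\<close> for r in \<open>B\<close> is direct.\<close>

definition root_basis :: "complex set \<Rightarrow> 'n::finite zroot set \<Rightarrow> 'n zroot set \<Rightarrow> bool" where
  "root_basis K R B \<longleftrightarrow> finite B \<and> B \<subseteq> R \<and> root_group K B = root_group K R \<and>
     module_span (ring_of_integers K) (*s) (\<Union>r\<in>R. root_I r) =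
       module_span (ring_of_integers K) (*s) (\<Union>r\<in>B. root_I r) \<and>
     (\<forall>x. (\<forall>r\<in>B. x r \<in> root_I r) \<and> (\<Sum>r\<in>B. x r) = 0 \<longrightarrow> (\<forall>r\<in>B. x r = 0))"

definition same_genus :: "complex set \<Rightarrow> 'n::finite zroot set \<Rightarrow> 'n zroot set \<Rightarrow> bool" where
  "same_genus K R1 R2 \<longleftrightarrow> (\<exists>\<aa>. nonzero_fractional_ideal K \<aa> \<and> R2 = root_twist K \<aa> ` R1)"

definition genus ::
    "complex set \<Rightarrow> (complex ^ 'n ^ 'n) set \<Rightarrow> 'n::finite zroot set \<Rightarrow> 'n zroot set set" where
  "genus K G R = {R'. root_system_for K G R' \<and> same_genus K R R'}"

definition reduced_genera ::
    "complex set \<Rightarrow> (complex ^ 'n ^ 'n) set \<Rightarrow> 'n::finite zroot set set set" where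
  "reduced_genera K G = genus K G ` {R. root_system_for K G R \<and> reduced_system K R}"

section \<open>The dihedral groups\<close>

definition zeta :: "nat \<Rightarrow> complex" where
  "zeta e = exp (2 * of_real pi * \<i> / of_nat e)"

definition dih_field :: "nat \<Rightarrow> complex set" where
  "dih_field e = complex_subfield hull {zeta e + inverse (zeta e)}"

definition dih_lambda :: "nat \<Rightarrow> complex" where
  "dih_lambda e = 2 + zeta e + inverse (zeta e)"

definition dih_s :: "nat \<Rightarrow> complex ^ 2 ^ 2" where
  "dih_s e = vector [vector [- 1, dih_lambda e], vector [0, 1]]"

definition dih_t :: "complex ^ 2 ^ 2" where
  "dih_t = vector [vector [1, 0], vector [1, - 1]]"

definition dih_group :: "nat \<Rightarrow> (complex ^ 2 ^ 2) set" where
  "dih_group e = generate (GL (dih_field e)) {dih_s e, dih_t}"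

definition root_s :: "nat \<Rightarrow> 2 zroot" where
  "root_s e = (let Z = ring_of_integers (dih_field e) in
     ZRoot {c *s vector [1, 0] |c. c \<in> Z} {c *s vector [2, - dih_lambda e] |c. c \<in> Z} (- 1))"

definition root_t :: "nat \<Rightarrow> 2 zroot" where
  "root_t e = (let Z = ring_of_integers (dih_field e) in
     ZRoot {c *s vector [0, 1] |c. c \<in> Z} {c *s vector [- 1, 2] |c. c \<in> Z} (- 1))"

definition st_orbit :: "nat \<Rightarrow> 2 zroot \<Rightarrow> nat \<Rightarrow> 2 zroot set" where
  "st_orbit e r N =
     {root_act (dih_field e) ((dih_s e ** dih_t) [^]\<^bsub>GL (dih_field e)\<^esub> n) r |n::nat. n < N}"

definition dih_roots_s :: "nat \<Rightarrow> 2 zroot set" where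
  "dih_roots_s e = st_orbit e (root_s e) (e div 2)"

definition dih_roots_t :: "nat \<Rightarrow> 2 zroot set" where
  "dih_roots_t e = st_orbit e (root_t e) (e div 2)"

definition dih_roots :: "nat \<Rightarrow> 2 zroot set" where
  "dih_roots e =
     (if odd e then st_orbit e (root_s e) e else dih_roots_s e \<union> dih_roots_t e)"

text \<open>The second root system, of interest only for even e.\<close>

definition dih_roots' :: "nat \<Rightarrow> 2 zroot set" where
  "dih_roots' e =
     root_twist (dih_field e) (principal_ideal (dih_field e) (dih_lambda e)) ` dih_roots_s e
       \<union> dih_roots_t e"

end

theory Submission
  imports Defs "HOL-Number_Theory.Cong"
begin

text \<open>
  Let \<open>\<lambda> = 2 + \<zeta> + \<zeta>\<inverse>\<close>. Every reflection of \<open>G\<close> is conjugate to s or t by a power of \<open>st\<close>, and a set of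
  reflections stable under conjugation can only generate \<open>G\<close> if it contains both s and t. Hence a
  reduced root system is determined by its roots over s and t, whose first components are
  \<open>\<aa> e1\<close> and \<open>\<bb> e2\<close> for invertible ideals \<open>\<aa>\<close> and \<open>\<bb>\<close>. Integrality of the pairings amounts to
  \<open>\<lambda> \<bb> \<subseteq> \<aa> \<subseteq> \<bb>\<close>, and the genus only depends on the ideal \<open>\<aa> \<bb>\<inverse>\<close>, which contains \<open>\<lambda>\<close> and is integral.

  With \<open>\<omega> = - \<zeta>\<close> we have \<open>\<lambda> = (1 - \<omega>) (1 - \<omega>\<inverse>)\<close>. This is a unit unless the order of \<open>\<omega>\<close> is a prime
  power, that is unless \<open>e = 2 p^l\<close>. In that case p is a unit times \<open>\<lambda>^d\<close>, where
  \<open>1, \<lambda>, ..., \<lambda>^(d - 1)\<close> span the field over the rationals, and Eisenstein's argument shows that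
  every integer of the field is congruent to a rational integer modulo \<open>\<lambda>\<close>. So \<open>\<lambda>\<close> generates
  a maximal ideal, and \<open>\<aa> = \<bb>\<close> or \<open>\<aa> = \<lambda> \<bb>\<close>.
\<close>

section \<open>Modules and algebraic integers\<close>

text \<open>Invertibility of the two ideals is built into the root axiom: if I = \<aa> v and J =
  \<bb> w, the condition on the pairing ideal says that \<aa> and a multiple of \<bb> are inverse to
  each other. For odd e the reflections s and t are conjugate, so the roots over them are linked by
  the group. All parities are treated alike by means of the lattice \<aa> e1 + \<bb> e2: it is
  stable under the group and recovers the ideal of a root from its line. The arithmetic obstacle is
  that the integers of k are given only as its algebraic integers, while the factors of \<lambda>
  and the unit relating p to a power of \<lambda> are found in the larger field of \<zeta>. Units
  are therefore constructed together with their inverses as algebraic integers, and membership in k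
  is read off afterwards from a quotient of elements of k. Eisenstein's argument does the work of an
  integral basis. An integer x of k is an integral combination of powers of \<lambda> divided by
  some N, taken minimal. If p divided N, it would divide all coefficients, against minimality; so N
  is invertible modulo \<lambda>, and x is congruent to a rational integer.\<close>

lemma is_submodule_module_span: "is_submodule R act (module_span R act S)"
  unfolding module_span_def by (rule hull_in) (auto simp: is_submodule_def)

lemma module_span_inc: "x \<in> S \<Longrightarrow> x \<in> module_span R act S"
  unfolding module_span_def by (rule hull_inc)

lemma module_span_zero: "0 \<in> module_span R act S"
  and module_span_add:
    "x \<in> module_span R act S \<Longrightarrow> y \<in> module_span R act S \<Longrightarrow> x + y \<in> module_span R act S"
  and module_span_scale:
    "c \<in> R \<Longrightarrow> x \<in> module_span R act S \<Longrightarrow> act c x \<in> module_span R act S"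
  using is_submodule_module_span[of R act S] by (auto simp: is_submodule_def)

lemma module_span_minimal: "S \<subseteq> N \<Longrightarrow> is_submodule R act N \<Longrightarrow> module_span R act S \<subseteq> N"
  unfolding module_span_def by (rule hull_minimal)

lemma module_span_mono: "S \<subseteq> T \<Longrightarrow> module_span R act S \<subseteq> module_span R act T"
  unfolding module_span_def by (rule hull_mono)

lemma module_span_eq: "is_submodule R act N \<Longrightarrow> module_span R act N = N"
  unfolding module_span_def by (rule hull_same)

lemma module_span_induct [consumes 1, case_names base zero add scale]:
  assumes "x \<in> module_span R act S"
    and "\<And>x. x \<in> S \<Longrightarrow> P x" "P 0" "\<And>x y. P x \<Longrightarrow> P y \<Longrightarrow> P (x + y)"
    and "\<And>c x. c \<in> R \<Longrightarrow> P x \<Longrightarrow> P (act c x)"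
  shows "P x"
proof -
  have "module_span R act S \<subseteq> {x. P x}"
    using assms(2-) by (intro module_span_minimal) (auto simp: is_submodule_def)
  thus ?thesis using assms(1) by auto
qed

text \<open>One notion for the coefficient rings below: the integers, the rationals, K, its ring of
  integers, all algebraic integers, and rational spans of powers.\<close>

definition complex_subring :: "complex set \<Rightarrow> bool" where
  "complex_subring R \<longleftrightarrow> 0 \<in> R \<and> 1 \<in> R \<and>
     (\<forall>x\<in>R. \<forall>y\<in>R. x + y \<in> R \<and> x * y \<in> R) \<and> (\<forall>x\<in>R. - x \<in> R)"

lemma complex_subring_Ints: "complex_subring \<int>"
  by (auto simp: complex_subring_def)

lemma complex_subring_Rats: "complex_subring \<rat>"
  by (auto simp: complex_subring_def)

lemma subring_sum: "complex_subring R \<Longrightarrow> (\<And>i. i \<in> I \<Longrightarrow> f i \<in> R) \<Longrightarrow> sum f I \<in> R"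
  by (induction I rule: infinite_finite_induct) (auto simp: complex_subring_def)

lemma subring_power: "complex_subring R \<Longrightarrow> x \<in> R \<Longrightarrow> x ^ n \<in> R"
  by (induction n) (auto simp: complex_subring_def)

lemma is_submodule_sum:
  "is_submodule R act N \<Longrightarrow> (\<And>i. i \<in> I \<Longrightarrow> f i \<in> N) \<Longrightarrow> sum f I \<in> N"
  by (induction I rule: infinite_finite_induct) (auto simp: is_submodule_def)

text \<open>Summing over the index set instead of the image allows repeated generators, such as the
  powers of a root of unity.\<close>

lemma module_span_image:
  assumes R: "complex_subring R" and I: "finite I"
  shows "module_span R (*) (f ` I) = {\<Sum>i\<in>I. c i * f i |c. \<forall>i. c i \<in> R}" (is "?L = ?R")
proof
  show "?L \<subseteq> ?R"
  proof (rule module_span_minimal)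
    show "f ` I \<subseteq> ?R"
    proof
      fix y assume "y \<in> f ` I"
      then obtain i where i: "i \<in> I" "y = f i" by auto
      have "y = (\<Sum>j\<in>I. (if j = i then 1 else 0) * f j)"
        using i I by (simp add: if_distrib[of "\<lambda>x. x * _"] cong: if_cong)
      moreover have "\<forall>j. (if j = i then 1 else 0 :: complex) \<in> R" using R by (auto simp: complex_subring_def)
      ultimately show "y \<in> ?R"
        by (intro CollectI exI[of _ "\<lambda>j. if j = i then 1 else 0"]) auto
    qed
    show "is_submodule R (*) ?R"
      unfolding is_submodule_def
    proof (intro conjI ballI)
      show "0 \<in> ?R" using R by (auto intro!: exI[of _ "\<lambda>_. 0"] simp: complex_subring_def)
    next
      fix x y assume "x \<in> ?R" "y \<in> ?R"
      then obtain a b where "x = (\<Sum>i\<in>I. a i * f i)" "\<forall>i. a i \<in> R"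
        "y = (\<Sum>i\<in>I. b i * f i)" "\<forall>i. b i \<in> R" by auto
      hence "x + y = (\<Sum>i\<in>I. (a i + b i) * f i)" "\<forall>i. a i + b i \<in> R"
        using R by (auto simp: algebra_simps sum.distrib complex_subring_def)
      thus "x + y \<in> ?R" by (intro CollectI exI[of _ "\<lambda>i. a i + b i"]) auto
    next
      fix k x assume "k \<in> R" "x \<in> ?R"
      then obtain a where "x = (\<Sum>i\<in>I. a i * f i)" "\<forall>i. a i \<in> R" by auto
      hence "k * x = (\<Sum>i\<in>I. (k * a i) * f i)" "\<forall>i. k * a i \<in> R"
        using R \<open>k \<in> R\<close> by (auto simp: algebra_simps sum_distrib_left complex_subring_def)
      thus "k * x \<in> ?R" by (intro CollectI exI[of _ "\<lambda>i. k * a i"]) auto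
    qed
  qed
  show "?R \<subseteq> ?L"
    by (auto intro!: is_submodule_sum[OF is_submodule_module_span] module_span_scale
        intro: module_span_inc)
qed

lemma module_span_mult_right:
  assumes "x \<in> module_span R (*) S"
  shows "x * c \<in> module_span R (*) ((\<lambda>s. s * c) ` S)"
  using assms
proof (induction rule: module_span_induct)
  case (scale k x)
  thus ?case using module_span_scale[of k R "x * c" "(*)"] by (simp add: mult.assoc)
qed (auto intro: module_span_inc module_span_zero module_span_add simp: distrib_right)

lemma module_span_insert_subset:
  assumes R: "complex_subring R"
  shows "module_span R (*) (insert b S) \<subseteq> {a * b + y |a y. a \<in> R \<and> y \<in> module_span R (*) S}"
    (is "_ \<subseteq> ?M")
proof (rule module_span_minimal)
  have "b \<in> ?M" using R module_span_zero
    by (intro CollectI exI[of _ 1] exI[of _ 0]) (auto simp: complex_subring_def)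
  moreover have "S \<subseteq> ?M"
  proof
    fix x assume "x \<in> S"
    thus "x \<in> ?M" using R module_span_inc[of x S R "(*)"]
      by (intro CollectI exI[of _ 0] exI[of _ x]) (auto simp: complex_subring_def)
  qed
  ultimately show "insert b S \<subseteq> ?M" by auto
  show "is_submodule R (*) ?M" unfolding is_submodule_def
  proof (intro conjI ballI)
    show "0 \<in> ?M" using R module_span_zero
      by (auto intro!: exI[of _ 0] simp: complex_subring_def)
  next
    fix x y assume "x \<in> ?M" "y \<in> ?M"
    then obtain a u c v where "x = a * b + u" "y = c * b + v" "a \<in> R" "c \<in> R"
      "u \<in> module_span R (*) S" "v \<in> module_span R (*) S" by auto
    thus "x + y \<in> ?M" using R
      by (intro CollectI exI[of _ "a + c"] exI[of _ "u + v"])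
        (auto simp: algebra_simps complex_subring_def intro: module_span_add)
  next
    fix k x assume "k \<in> R" "x \<in> ?M"
    then obtain a u where "x = a * b + u" "a \<in> R" "u \<in> module_span R (*) S" by auto
    thus "k * x \<in> ?M" using R \<open>k \<in> R\<close>
      by (intro CollectI exI[of _ "k * a"] exI[of _ "k * u"])
        (auto simp: algebra_simps complex_subring_def intro: module_span_scale)
  qed
qed

lemma is_submodule_diff:
  assumes "complex_subring R" "is_submodule R (*) N" "x \<in> N" "y \<in> N"
  shows "x - y \<in> N"
proof -
  have "- 1 \<in> R" using assms(1) by (auto simp: complex_subring_def)
  hence "(-1) * y \<in> N" using assms(2,4) unfolding is_submodule_def by blast
  hence "x + (-1) * y \<in> N" using assms unfolding is_submodule_def by blast
  thus ?thesis by simp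
qed

text \<open>Induction on the generators. The coefficients of the new generator \<open>b\<close> in
  elements of \<open>N\<close> form an ideal of the integers. An element of \<open>N\<close> with
  the least positive coefficient, together with generators of the part of \<open>N\<close> in the
  span of the old generators, generates \<open>N\<close>.\<close>

lemma finitely_generated_Ints_submodule:
  assumes "finite B" "is_submodule \<int> (*) N" "N \<subseteq> module_span \<int> (*) B"
  shows "finitely_generated \<int> (*) N"
  using assms
proof (induction B arbitrary: N rule: finite_induct)
  case empty
  have "module_span \<int> (*) {} \<subseteq> {0::complex}"
    by (rule module_span_minimal) (auto simp: is_submodule_def)
  hence "N = {0}" using empty by (auto simp: is_submodule_def)
  moreover have "module_span \<int> (*) {} = {0::complex}"
    using \<open>module_span \<int> (*) {} \<subseteq> {0::complex}\<close> module_span_zero by blast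
  ultimately show ?case unfolding finitely_generated_def by (intro exI[of _ "{}"]) auto
next
  case (insert b B)
  let ?M = "module_span \<int> (*) B"
  have ZM: "is_submodule \<int> (*) ?M" by (rule is_submodule_module_span)
  have M: "?M = module_span \<int> (*) B" ..
  have N: "0 \<in> N" "\<And>x y. x \<in> N \<Longrightarrow> y \<in> N \<Longrightarrow> x + y \<in> N" "\<And>c x. c \<in> \<int> \<Longrightarrow> x \<in> N \<Longrightarrow> c * x \<in> N"
    using insert.prems(1) by (auto simp: is_submodule_def)
  have Nd: "x \<in> N \<Longrightarrow> y \<in> N \<Longrightarrow> x - y \<in> N" for x y
    using is_submodule_diff[OF complex_subring_Ints insert.prems(1)] by blast
  have Md: "x \<in> ?M \<Longrightarrow> y \<in> ?M \<Longrightarrow> x - y \<in> ?M" for x y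
    using is_submodule_diff[OF complex_subring_Ints ZM] by blast
  have "is_submodule \<int> (*) (N \<inter> ?M)"
    using insert.prems(1) ZM by (auto simp: is_submodule_def)
  from insert.IH[OF this] obtain S0 where S0: "finite S0" "N \<inter> ?M = module_span \<int> (*) S0"
    by (auto simp: finitely_generated_def)
  \<comment> \<open>The integers that occur as coefficient of \<open>b\<close> in some element of
    \<open>N\<close>.\<close>
  define P where "P a \<longleftrightarrow> (\<exists>y\<in>?M. y + of_int a * b \<in> N)" for a :: int
  have dec: "\<exists>a y. P a \<and> y \<in> ?M \<and> x = of_int a * b + y" if "x \<in> N" for x
  proof -
    from that insert.prems(2) module_span_insert_subset[OF complex_subring_Ints, of b B]
    obtain c y where "c \<in> \<int>" "y \<in> ?M" "x = c * b + y" by blast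
    moreover from this obtain a where "c = of_int a" by (auto elim: Ints_cases)
    ultimately have "P a" unfolding P_def using that by (auto intro!: bexI[of _ y] simp: add.commute)
    thus ?thesis using \<open>y \<in> ?M\<close> \<open>x = c * b + y\<close> \<open>c = of_int a\<close> by blast
  qed
  show ?case
  proof (cases "\<exists>a>0. P a")
    case False
    have "a = 0" if "P a" for a
    proof -
      from that obtain y where y: "y \<in> ?M" "y + of_int a * b \<in> N" by (auto simp: P_def)
      hence "(-1) * (y + of_int a * b) \<in> N" by (intro N(3)) auto
      hence "(-1) * y + of_int (-a) * b \<in> N" by (simp add: algebra_simps)
      moreover have "(-1) * y \<in> ?M" using y by (intro module_span_scale) auto
      ultimately have "P (-a)" unfolding P_def by blast
      with that False show ?thesis by (metis neg_0_less_iff_less linorder_neqE_linordered_idom)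
    qed
    with dec have "N \<subseteq> ?M" by fastforce
    with S0 show ?thesis unfolding finitely_generated_def by (metis Int_absorb2)
  next
    case True
    define d where "d = (LEAST n. n > 0 \<and> P (int n))"
    have ex: "\<exists>n. n > 0 \<and> P (int n)" using True by (metis zero_less_imp_eq_int of_nat_0_less_iff)
    have d: "d > 0" "P (int d)" and dmin: "\<And>n. n > 0 \<Longrightarrow> P (int n) \<Longrightarrow> d \<le> n"
      using LeastI_ex[OF ex] Least_le[of "\<lambda>n. n > 0 \<and> P (int n)"] unfolding d_def by auto
    from d(2) obtain y0 where y0: "y0 \<in> ?M" "y0 + of_int (int d) * b \<in> N" by (auto simp: P_def)
    let ?n0 = "y0 + of_int (int d) * b"
    have "N = module_span \<int> (*) (insert ?n0 S0)"
    proof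
      show "module_span \<int> (*) (insert ?n0 S0) \<subseteq> N"
        using insert.prems(1) y0 S0 module_span_inc[of _ S0 \<int> "(*)"]
        by (intro module_span_minimal) auto
      show "N \<subseteq> module_span \<int> (*) (insert ?n0 S0)"
      proof
        fix x assume x: "x \<in> N"
        then obtain a y where a: "P a" "y \<in> ?M" "x = of_int a * b + y" using dec by blast
        define q where "q = a div int d"
        define r where "r = a mod int d"
        have ar: "a = q * int d + r" by (simp add: q_def r_def)
        have eq: "x - of_int q * ?n0 = (y - of_int q * y0) + of_int r * b"
          by (simp add: a ar algebra_simps)
        have xN: "x - of_int q * ?n0 \<in> N" using x y0 by (intro Nd N(3)) auto
        have yM: "y - of_int q * y0 \<in> ?M" using a y0 by (intro Md module_span_scale) auto
        have "P r" unfolding P_def using xN yM eq by metis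
        have "r = 0"
        proof (rule ccontr)
          assume "r \<noteq> 0"
          moreover have "0 \<le> r" "r < int d" using d(1) by (auto simp: r_def)
          ultimately show False using dmin[of "nat r"] \<open>P r\<close> by auto
        qed
        hence "x - of_int q * ?n0 \<in> N \<inter> ?M" using xN yM eq by auto
        hence "x - of_int q * ?n0 \<in> module_span \<int> (*) (insert ?n0 S0)"
          using S0 module_span_mono[of S0 "insert ?n0 S0"] by blast
        moreover have "of_int q * ?n0 \<in> module_span \<int> (*) (insert ?n0 S0)"
          by (intro module_span_scale module_span_inc) auto
        ultimately show "x \<in> module_span \<int> (*) (insert ?n0 S0)"
          using module_span_add by fastforce
      qed
    qed
    thus ?thesis unfolding finitely_generated_def using S0(1) by blast
  qed
qed

text \<open>A monic integral relation says that some power of \<open>x\<close> lies in the span of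
  the lower ones. In this form, arguments about finitely generated groups apply.\<close>

lemma algebraic_int_iff_span:
  "algebraic_int (x :: complex) \<longleftrightarrow> (\<exists>n. x ^ n \<in> module_span \<int> (*) ((\<lambda>i. x ^ i) ` {..<n}))"
proof
  assume "algebraic_int x"
  then obtain p where p: "lead_coeff p = 1" "\<forall>i. coeff p i \<in> \<int>" "poly p x = 0"
    by (auto elim: algebraic_int.cases)
  let ?n = "degree p"
  have "0 = (\<Sum>i\<le>?n. coeff p i * x ^ i)" using p by (simp add: poly_altdef)
  also have "\<dots> = (\<Sum>i<?n. coeff p i * x ^ i) + x ^ ?n"
    using p by (simp add: lessThan_Suc_atMost[symmetric])
  finally have "x ^ ?n = (\<Sum>i<?n. (- coeff p i) * x ^ i)"
    by (simp add: sum_negf eq_neg_iff_add_eq_0 add.commute)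
  moreover have "\<forall>i. - coeff p i \<in> \<int>" using p by auto
  ultimately show "\<exists>n. x ^ n \<in> module_span \<int> (*) ((\<lambda>i. x ^ i) ` {..<n})"
    by (intro exI[of _ ?n], subst module_span_image[OF complex_subring_Ints])
      (auto intro!: exI[of _ "\<lambda>i. - coeff p i"])
next
  assume "\<exists>n. x ^ n \<in> module_span \<int> (*) ((\<lambda>i. x ^ i) ` {..<n})"
  then obtain n c where c: "x ^ n = (\<Sum>i<n. c i * x ^ i)" "\<forall>i. c i \<in> \<int>"
    by (subst (asm) module_span_image[OF complex_subring_Ints]) auto
  define p where "p = monom 1 n - (\<Sum>i<n. monom (c i) i)"
  have cp: "coeff p k = (if k = n then 1 else 0) - (if k < n then c k else 0)" for k
    by (auto simp: p_def coeff_sum)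
  have "degree p = n"
    by (rule antisym[OF degree_le le_degree]) (auto simp: cp)
  show "algebraic_int x"
  proof
    show "lead_coeff p = 1" by (simp add: \<open>degree p = n\<close> cp)
    show "\<forall>i. coeff p i \<in> \<int>" using c(2) by (auto simp: cp)
    show "poly p x = 0" by (simp add: p_def poly_sum poly_monom c(1))
  qed
qed

text \<open>An element of a span involves finitely many generators, and these lie in a single member
  of an increasing union.\<close>

lemma module_span_UN_mono:
  assumes "x \<in> module_span R act (\<Union>n::nat. A n)" "mono A"
  shows "\<exists>n. x \<in> module_span R act (A n)"
  using assms(1)
proof (induction rule: module_span_induct)
  case (add x y)
  then obtain m n where "x \<in> module_span R act (A m)" "y \<in> module_span R act (A n)" by auto
  hence "x \<in> module_span R act (A (max m n))" "y \<in> module_span R act (A (max m n))"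
    using module_span_mono[OF monoD[OF assms(2)]] by (meson max.cobounded1 max.cobounded2 subsetD)+
  thus ?case by (blast intro: module_span_add)
qed (blast intro: module_span_inc module_span_zero module_span_scale)+

text \<open>The powers of x generate a subgroup of a finitely generated abelian group. It is itself
  finitely generated, so some power of x is an integral combination of lower ones.\<close>

lemma algebraic_int_if_stabilizes:
  fixes x :: complex
  assumes fin: "finite B" and one: "1 \<in> module_span \<int> (*) B"
    and stab: "\<And>y. y \<in> module_span \<int> (*) B \<Longrightarrow> x * y \<in> module_span \<int> (*) B"
  shows "algebraic_int x"
proof -
  define A where "A n = (\<lambda>i. x ^ i) ` {..<n}" for n :: nat
  have A: "mono A" by (auto simp: A_def intro!: monoI)
  let ?N = "module_span \<int> (*) (\<Union>n. A n)"
  have "x ^ i \<in> module_span \<int> (*) B" for i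
    by (induction i) (auto simp: one stab)
  hence "?N \<subseteq> module_span \<int> (*) B"
    by (intro module_span_minimal is_submodule_module_span) (auto simp: A_def)
  with fin obtain S where S: "finite S" "?N = module_span \<int> (*) S"
    using finitely_generated_Ints_submodule[OF _ is_submodule_module_span]
    unfolding finitely_generated_def by metis
  \<comment> \<open>Finitely many generators involve only finitely many powers of
    \<open>x\<close>.\<close>
  have "\<exists>n. S \<subseteq> module_span \<int> (*) (A n)"
    using S(1) module_span_inc[of _ S \<int> "(*)", folded S(2)]
  proof (induction S rule: finite_induct)
    case (insert s S)
    then obtain n m where "S \<subseteq> module_span \<int> (*) (A n)" "s \<in> module_span \<int> (*) (A m)"
      using module_span_UN_mono[OF _ A] by (metis insertCI)
    hence "insert s S \<subseteq> module_span \<int> (*) (A (max m n))"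
      using module_span_mono[OF monoD[OF A]] by (meson max.cobounded1 max.cobounded2 subset_iff insert_subset)
    thus ?case ..
  qed auto
  then obtain n where "S \<subseteq> module_span \<int> (*) (A n)" ..
  hence "?N \<subseteq> module_span \<int> (*) (A n)"
    unfolding S(2) by (intro module_span_minimal is_submodule_module_span)
  moreover have "x ^ n \<in> ?N" by (rule module_span_inc) (auto simp: A_def intro!: exI[of _ "Suc n"])
  ultimately show ?thesis unfolding algebraic_int_iff_span A_def by blast
qed

text \<open>The products \<open>x ^ i * y ^ j\<close> with \<open>i < n\<close> and
  \<open>j < m\<close> span a group that is stable under multiplication by \<open>x\<close> and by
  \<open>y\<close>: an exponent that becomes too large is reduced by the relation for
  \<open>x ^ n\<close> or \<open>y ^ m\<close>. Hence it is stable under \<open>x + y\<close> and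
  \<open>x * y\<close>.\<close>

lemma algebraic_int_plus_times:
  assumes "algebraic_int (x :: complex)" "algebraic_int y"
  shows "algebraic_int (x + y) \<and> algebraic_int (x * y)"
proof -
  from assms obtain n m where n: "x ^ n \<in> module_span \<int> (*) ((\<lambda>i. x ^ i) ` {..<n})"
    and m: "y ^ m \<in> module_span \<int> (*) ((\<lambda>i. y ^ i) ` {..<m})"
    unfolding algebraic_int_iff_span by auto
  have "module_span \<int> (*) {} \<subseteq> {0::complex}"
    by (rule module_span_minimal) (auto simp: is_submodule_def)
  \<comment> \<open>For \<open>n = 0\<close> the relation would read 1 = 0. With both exponents
    positive, 1 is one of the generators \<open>x ^ i * y ^ j\<close>.\<close>
  hence pos: "n > 0" "m > 0" using n m by (auto intro!: gr0I)
  define B where "B = (\<lambda>(i,j). x ^ i * y ^ j) ` ({..<n} \<times> {..<m})"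
  let ?M = "module_span \<int> (*) B"
  have BI: "x ^ i * y ^ j \<in> ?M" if "i < n" "j < m" for i j
    using that by (intro module_span_inc) (auto simp: B_def)
  have bx: "x * b \<in> ?M" if b: "b \<in> B" for b
  proof -
    from b obtain i j where ij: "b = x ^ i * y ^ j" "i < n" "j < m" by (auto simp: B_def)
    show ?thesis
    proof (cases "Suc i < n")
      case True thus ?thesis using BI[of "Suc i" j] ij by (simp add: mult.assoc)
    next
      case False
      hence "n = Suc i" using ij by auto
      hence "x * b = x ^ n * y ^ j" by (simp add: ij)
      also have "\<dots> \<in> module_span \<int> (*) ((\<lambda>s. s * y ^ j) ` (\<lambda>i. x ^ i) ` {..<n})"
        by (rule module_span_mult_right[OF n])
      also have "\<dots> \<subseteq> ?M" using ij by (intro module_span_mono) (auto simp: B_def)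
      finally show ?thesis .
    qed
  qed
  have by': "y * b \<in> ?M" if b: "b \<in> B" for b
  proof -
    from b obtain i j where ij: "b = x ^ i * y ^ j" "i < n" "j < m" by (auto simp: B_def)
    show ?thesis
    proof (cases "Suc j < m")
      case True thus ?thesis using BI[of i "Suc j"] ij by (simp add: mult_ac)
    next
      case False
      hence "m = Suc j" using ij by auto
      hence "y * b = y ^ m * x ^ i" by (simp add: ij)
      also have "\<dots> \<in> module_span \<int> (*) ((\<lambda>s. s * x ^ i) ` (\<lambda>j. y ^ j) ` {..<m})"
        by (rule module_span_mult_right[OF m])
      also have "\<dots> \<subseteq> ?M" using ij by (intro module_span_mono) (force simp: B_def mult.commute)
      finally show ?thesis .
    qed
  qed
  have stab: "z * w \<in> ?M" if z: "\<And>b. b \<in> B \<Longrightarrow> z * b \<in> ?M" and w: "w \<in> ?M" for z w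
    using w
  proof (induction rule: module_span_induct)
    case (scale c v)
    thus ?case using module_span_scale[of c \<int> "z * v" "(*)"] by (simp add: mult.left_commute)
  qed (auto simp: z distrib_left intro: module_span_zero module_span_add)
  have fin: "finite B" by (auto simp: B_def)
  have one: "1 \<in> ?M" using BI[of 0 0] pos by simp
  have "algebraic_int (x + y)"
    by (rule algebraic_int_if_stabilizes[OF fin one])
      (metis distrib_right module_span_add stab bx by')
  moreover have "algebraic_int (x * y)"
    by (rule algebraic_int_if_stabilizes[OF fin one])
      (metis mult.assoc stab bx by')
  ultimately show ?thesis ..
qed

lemma complex_subring_algebraic_int: "complex_subring {x. algebraic_int x}"
  using algebraic_int_plus_times by (auto simp: complex_subring_def)

text \<open>Write a polynomial with root \<open>y\<close> as a + X p. If a is nonzero, then y p(y) =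
  - a exhibits the inverse; otherwise \<open>y\<close> is already a root of p, and the degree
  drops.\<close>

lemma algebraic_inverse_polynomial:
  assumes "algebraic_int (y :: complex)" "y \<noteq> 0"
  shows "\<exists>r. (\<forall>i. coeff r i \<in> \<rat>) \<and> y * poly r y = 1"
proof -
  have "\<exists>r. (\<forall>i. coeff r i \<in> \<rat>) \<and> y * poly r y = 1"
    if "p \<noteq> 0" "\<forall>i. coeff p i \<in> \<rat>" "poly p y = 0" for p
    using that
  proof (induction p)
    case (pCons a p)
    have rat: "\<forall>i. coeff p i \<in> \<rat>" "a \<in> \<rat>"
      using pCons.prems(2) by (metis coeff_pCons_Suc, metis coeff_pCons_0)
    have root: "a + y * poly p y = 0" using pCons.prems(3) by simp
    show ?case
    proof (cases "a = 0")
      case True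
      hence "p \<noteq> 0" "poly p y = 0" using pCons.prems root assms(2) by auto
      thus ?thesis using pCons.IH rat by blast
    next
      case False
      hence "y * poly (smult (- 1 / a) p) y = 1" using root
        by (simp add: field_simps) (metis add.inverse_unique add.commute add.inverse_inverse)
      thus ?thesis using rat by (intro exI[of _ "smult (- 1 / a) p"]) auto
    qed
  qed simp
  moreover obtain p where "lead_coeff p = 1" "\<forall>i. coeff p i \<in> \<int>" "poly p y = 0"
    using assms by (auto elim: algebraic_int.cases)
  moreover have "\<int> \<subseteq> (\<rat> :: complex set)" by (auto elim!: Ints_cases)
  ultimately show ?thesis by (metis leading_coeff_0_iff subsetD zero_neq_one)
qed

section \<open>Reflections\<close>

no_notation fps_nth (infixl "$" 75)

text \<open>The two actions may differ: this passes between an ideal and the corresponding multiples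
  of a vector.\<close>

lemma module_span_image_hom:
  assumes "f 0 = 0" "\<And>x y. f (x + y) = f x + f y" "\<And>c x. c \<in> R \<Longrightarrow> f (act c x) = act' c (f x)"
  shows "module_span R act' (f ` S) = f ` module_span R act S"
proof
  show "module_span R act' (f ` S) \<subseteq> f ` module_span R act S"
  proof (rule module_span_minimal)
    show "f ` S \<subseteq> f ` module_span R act S" by (auto intro: module_span_inc)
    show "is_submodule R act' (f ` module_span R act S)"
      unfolding is_submodule_def
    proof (intro conjI ballI)
      show "0 \<in> f ` module_span R act S" using assms(1) module_span_zero by (metis image_eqI)
    next
      fix x y assume "x \<in> f ` module_span R act S" "y \<in> f ` module_span R act S"
      thus "x + y \<in> f ` module_span R act S"
        using assms(2) module_span_add by (smt (verit) image_iff)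
    next
      fix c x assume "c \<in> R" "x \<in> f ` module_span R act S"
      thus "act' c x \<in> f ` module_span R act S"
        using assms(3) module_span_scale by (smt (verit) image_iff)
    qed
  qed
  show "f ` module_span R act S \<subseteq> module_span R act' (f ` S)"
  proof clarify
    fix x assume "x \<in> module_span R act S"
    thus "f x \<in> module_span R act' (f ` S)"
      by (induction rule: module_span_induct)
        (auto simp: assms intro: module_span_inc module_span_zero module_span_add module_span_scale)
  qed
qed

text \<open>Every rank one lattice has this shape, with an ideal in place of \<aa>, so statements
  about roots turn into statements about ideals.\<close>

definition line :: "complex set \<Rightarrow> complex ^ 'n \<Rightarrow> (complex ^ 'n) set" where
  "line \<aa> v = (\<lambda>a. a *s v) ` \<aa>"

lemma module_span_line: "module_span R (*s) (line S v) = line (module_span R (*) S) v"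
  unfolding line_def
  by (rule module_span_image_hom) (auto simp: vector_sadd_rdistrib vector_smult_assoc)

definition reflection_matrix :: "complex ^ 'n \<Rightarrow> complex ^ 'n \<Rightarrow> complex ^ 'n ^ 'n" where
  "reflection_matrix v w = (\<chi> i j. (if i = j then 1 else 0) - v $ i * w $ j)"

lemma reflection_matrix_mult_vec: "reflection_matrix v w *v x = x - pairing x w *s v"
proof -
  have "(\<Sum>j\<in>UNIV. ((if i = j then 1 else 0) - v $ i * w $ j) * x $ j) = x $ i - pairing x w * v $ i"
    for i
    by (simp add: pairing_def left_diff_distrib sum_subtractf sum_distrib_right sum_distrib_left
        if_distrib[of "\<lambda>x. x * _"] mult.assoc mult.left_commute mult.commute[of "x $ _"] cong: if_cong)
  thus ?thesis by (simp add: vec_eq_iff reflection_matrix_def matrix_vector_mult_def)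
qed

lemma pairing_simps [simp]:
  "pairing (x + y) z = pairing x z + pairing y z" "pairing z (x + y) = pairing z x + pairing z y"
  "pairing (x - y) z = pairing x z - pairing y z" "pairing z (x - y) = pairing z x - pairing z y"
  "pairing (c *s x) z = c * pairing x z" "pairing z (c *s x) = c * pairing z x"
  "pairing 0 z = 0" "pairing z 0 = 0"
  by (simp_all add: pairing_def algebra_simps sum.distrib sum_subtractf sum_distrib_left)

lemma reflection_matrix_involution:
  assumes "pairing v w = 2"
  shows "reflection_matrix v w ** reflection_matrix v w = mat 1"
proof -
  have "reflection_matrix v w *v (reflection_matrix v w *v x) = x" for x
    unfolding reflection_matrix_mult_vec using assms
    by (simp add: vec_eq_iff algebra_simps)
  thus ?thesis
    by (metis matrix_eq matrix_vector_mul_assoc matrix_vector_mul_lid)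
qed

lemma pairing_transpose: "pairing (A *v x) y = pairing x (transpose A *v y)"
proof -
  have "pairing (A *v x) y = (\<Sum>i\<in>UNIV. \<Sum>j\<in>UNIV. A $ i $ j * x $ j * y $ i)"
    by (simp add: pairing_def matrix_vector_mult_def sum_distrib_right)
  also have "\<dots> = (\<Sum>j\<in>UNIV. \<Sum>i\<in>UNIV. A $ i $ j * x $ j * y $ i)" by (rule sum.swap)
  also have "\<dots> = pairing x (transpose A *v y)"
    by (simp add: pairing_def matrix_vector_mult_def transpose_def sum_distrib_left mult_ac)
  finally show ?thesis .
qed

lemma pairing_axis: "pairing (axis i 1) y = y $ i" "pairing x (axis i 1) = x $ i"
  by (simp_all add: pairing_def axis_def if_distrib[of "\<lambda>x. x * _"] if_distrib[of "\<lambda>x. _ * x"]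
      cong: if_cong)

text \<open>Evaluating both reflections at \<open>v\<close> gives 2 v as a multiple of
  \<open>v'\<close>. The formula for \<mu> belongs to the conclusion because it shows \<mu> \<in> K
  for vectors over K.\<close>

lemma reflection_matrix_eqD:
  assumes eq: "reflection_matrix v w = reflection_matrix v' w'"
    and p: "pairing v w = 2" "pairing v' w' = 2"
  shows "\<exists>\<mu>. \<mu> = pairing v w' / 2 \<and> \<mu> \<noteq> 0 \<and> v = \<mu> *s v' \<and> w = inverse \<mu> *s w'"
proof -
  have E: "pairing x w *s v = pairing x w' *s v'" for x
    using arg_cong[OF eq, of "\<lambda>A. A *v x"] by (simp add: reflection_matrix_mult_vec)
  define \<mu> where "\<mu> = pairing v w' / 2"
  have v: "v = \<mu> *s v'"
    using E[of v] p(1) by (simp add: \<mu>_def vec_eq_iff field_simps)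
  have "v \<noteq> 0" "v' \<noteq> 0" using p by auto
  with v have "\<mu> \<noteq> 0" by auto
  have "w $ i * \<mu> = w' $ i" for i
  proof -
    from \<open>v' \<noteq> 0\<close> obtain j where "v' $ j \<noteq> 0" by (auto simp: vec_eq_iff)
    thus ?thesis using E[of "axis i 1"] v by (simp add: pairing_axis vec_eq_iff) metis
  qed
  hence "w = inverse \<mu> *s w'" using \<open>\<mu> \<noteq> 0\<close> by (simp add: vec_eq_iff field_simps)
  with v \<open>\<mu> \<noteq> 0\<close> \<mu>_def show ?thesis by blast
qed

section \<open>The inverse transpose as contragredient\<close>

abbreviation dual :: "complex ^ 'n ^ 'n \<Rightarrow> complex ^ 'n ^ 'n" where
  "dual g \<equiv> transpose (matrix_inv g)"

lemma matrix_inv_cancel: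
  assumes "invertible (g :: complex ^ 'n ^ 'n)"
  shows "g ** matrix_inv g = mat 1" "matrix_inv g ** g = mat 1"
  using someI_ex[OF assms[unfolded invertible_def]] by (auto simp: matrix_inv_def)

lemma matrix_inv_eqI:
  assumes "(g :: complex ^ 'n ^ 'n) ** h = mat 1"
  shows "matrix_inv g = h" "invertible g"
proof -
  show inv: "invertible g" using assms matrix_left_right_inverse[of g h] by (auto simp: invertible_def)
  have "matrix_inv g = matrix_inv g ** (g ** h)" by (simp add: assms)
  thus "matrix_inv g = h" by (simp only: matrix_mul_assoc matrix_inv_cancel[OF inv] matrix_mul_lid)
qed

lemma matrix_inv_mult:
  assumes "invertible (g :: complex ^ 'n ^ 'n)" "invertible (h :: complex ^ 'n ^ 'n)"
  shows "matrix_inv (g ** h) = matrix_inv h ** matrix_inv g"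
proof (rule matrix_inv_eqI(1))
  have "g ** h ** (matrix_inv h ** matrix_inv g) = g ** (h ** matrix_inv h) ** matrix_inv g"
    by (simp only: matrix_mul_assoc)
  thus "g ** h ** (matrix_inv h ** matrix_inv g) = mat 1" using assms by (simp add: matrix_inv_cancel)
qed

lemma dual_mult:
  "invertible (g :: complex ^ 'n ^ 'n) \<Longrightarrow> invertible (h :: complex ^ 'n ^ 'n) \<Longrightarrow> dual (g ** h) = dual g ** dual h"
  by (simp add: matrix_inv_mult matrix_transpose_mul)

lemma pairing_dual: "invertible g \<Longrightarrow> pairing (g *v x) (dual g *v y) = pairing x y"
  by (simp add: pairing_transpose matrix_vector_mul_assoc matrix_transpose_mul[symmetric] matrix_inv_cancel
      del: transpose_matrix_vector)

lemma reflection_matrix_conj: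
  assumes "invertible g"
  shows "reflection_matrix (g *v v) (dual g *v w) = g ** reflection_matrix v w ** matrix_inv g"
proof -
  have "reflection_matrix (g *v v) (dual g *v w) *v x = (g ** reflection_matrix v w ** matrix_inv g) *v x" for x
  proof -
    have "pairing x (dual g *v w) = pairing (matrix_inv g *v x) w" by (simp add: pairing_transpose)
    moreover have "g *v (matrix_inv g *v x) = x"
      by (simp add: matrix_vector_mul_assoc matrix_inv_cancel assms)
    ultimately show ?thesis
      by (simp add: matrix_vector_mul_assoc[symmetric] reflection_matrix_mult_vec
        matrix_vector_mult_diff_distrib matrix_vector_mult_scaleR vector_scalar_commute)
  qed
  thus ?thesis by (subst matrix_eq) blast
qed

section \<open>Real subfields and their rings of integers\<close>

locale real_subfield =
  fixes K :: "complex set"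
  assumes subfield: "complex_subfield K" and real: "K \<subseteq> \<real>"
begin

abbreviation ints ("\<O>") where "\<O> \<equiv> ring_of_integers K"

lemma K_closed [simp, intro]:
  "0 \<in> K" "1 \<in> K" "x \<in> K \<Longrightarrow> y \<in> K \<Longrightarrow> x + y \<in> K" "x \<in> K \<Longrightarrow> y \<in> K \<Longrightarrow> x * y \<in> K"
  "x \<in> K \<Longrightarrow> - x \<in> K" "x \<in> K \<Longrightarrow> inverse x \<in> K"
  using subfield by (auto simp: complex_subfield_def)

lemma K_diff [simp, intro]: "x \<in> K \<Longrightarrow> y \<in> K \<Longrightarrow> x - y \<in> K"
  and K_divide [simp, intro]: "x \<in> K \<Longrightarrow> y \<in> K \<Longrightarrow> x / y \<in> K"
  using K_closed(3)[of x "- y"] K_closed(4)[of x "inverse y"] by (auto simp: divide_inverse)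

lemma subring_K: "complex_subring K"
  by (auto simp: complex_subring_def)

lemma K_of_int [simp, intro]: "of_int n \<in> K"
proof (induction n rule: int_induct[of _ 0])
  case (step1 i)
  thus ?case using K_closed(3)[of "of_int i" 1] by simp
next
  case (step2 i)
  thus ?case using K_diff[of "of_int i" 1] by simp
qed auto

lemma K_numeral [simp, intro]: "numeral n \<in> K"
  using K_of_int[of "numeral n"] by simp

lemma K_sum [intro]: "(\<And>i. i \<in> I \<Longrightarrow> f i \<in> K) \<Longrightarrow> sum f I \<in> K"
  by (rule subring_sum[OF subring_K])

lemma K_prod [intro]: "(\<And>i. i \<in> I \<Longrightarrow> f i \<in> K) \<Longrightarrow> prod f I \<in> K"
  by (induction I rule: infinite_finite_induct) auto

lemma K_pairing [intro]: "v \<in> vspace K \<Longrightarrow> w \<in> vspace K \<Longrightarrow> pairing v w \<in> K"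
  by (auto simp: pairing_def vspace_def)

lemma subring_ints: "complex_subring \<O>"
  using subring_K complex_subring_algebraic_int
  by (auto simp: complex_subring_def ring_of_integers_def)

lemma ints_closed [simp, intro]:
  "0 \<in> \<O>" "1 \<in> \<O>" "x \<in> \<O> \<Longrightarrow> y \<in> \<O> \<Longrightarrow> x + y \<in> \<O>" "x \<in> \<O> \<Longrightarrow> y \<in> \<O> \<Longrightarrow> x * y \<in> \<O>"
  "x \<in> \<O> \<Longrightarrow> - x \<in> \<O>" "of_int n \<in> \<O>"
  using subring_ints by (auto simp: complex_subring_def ring_of_integers_def)

lemma ints_diff [simp, intro]: "x \<in> \<O> \<Longrightarrow> y \<in> \<O> \<Longrightarrow> x - y \<in> \<O>"
  using ints_closed(3)[of x "- y"] by auto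

lemma ints_numeral [simp, intro]: "numeral n \<in> \<O>"
  using ints_closed(6)[of "numeral n"] by simp

lemma ints_subset: "\<O> \<subseteq> K"
  by (auto simp: ring_of_integers_def)

lemma ints_in_K [simp, intro]: "x \<in> \<O> \<Longrightarrow> x \<in> K"
  using ints_subset by blast

lemma root_of_unity_cases:
  assumes "\<xi> \<in> K" "\<xi> ^ m = 1" "m > 0"
  shows "\<xi> = 1 \<or> \<xi> = -1"
proof -
  from assms(1) real obtain r where r: "\<xi> = of_real r" by (auto elim: Reals_cases)
  have "norm \<xi> = 1" using power_eq_1_iff[OF assms(2)] assms(3) by auto
  thus ?thesis using r by (auto simp: abs_if split: if_splits)
qed

section \<open>Invertible ideals\<close>

definition frac_ideal :: "complex set \<Rightarrow> bool" where
  "frac_ideal \<aa> \<longleftrightarrow> \<aa> \<subseteq> K \<and> is_submodule \<O> (*) \<aa>"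

definition ideal_mult :: "complex set \<Rightarrow> complex set \<Rightarrow> complex set" (infixl "\<cdot>" 70) where
  "\<aa> \<cdot> \<bb> = module_span \<O> (*) {a * b |a b. a \<in> \<aa> \<and> b \<in> \<bb>}"

abbreviation inv_ideal where "inv_ideal \<equiv> inverse_ideal K"
abbreviation prin where "prin \<equiv> principal_ideal K"

definition invertible_ideal :: "complex set \<Rightarrow> bool" where
  "invertible_ideal \<aa> \<longleftrightarrow> nonzero_fractional_ideal K \<aa> \<and> \<aa> \<cdot> inv_ideal \<aa> = \<O>"

lemma frac_ideal_ints: "frac_ideal \<O>"
  by (auto simp: frac_ideal_def is_submodule_def)

lemma nonzero_fractional_imp_frac: "nonzero_fractional_ideal K \<aa> \<Longrightarrow> frac_ideal \<aa>"
  unfolding nonzero_fractional_ideal_def finitely_generated_def frac_ideal_def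
  using is_submodule_module_span by blast

lemma frac_idealD:
  assumes "frac_ideal \<aa>"
  shows "x \<in> \<aa> \<Longrightarrow> x \<in> K" "0 \<in> \<aa>" "x \<in> \<aa> \<Longrightarrow> y \<in> \<aa> \<Longrightarrow> x + y \<in> \<aa>"
    "c \<in> \<O> \<Longrightarrow> x \<in> \<aa> \<Longrightarrow> c * x \<in> \<aa>" "c \<in> \<O> \<Longrightarrow> x \<in> \<aa> \<Longrightarrow> x * c \<in> \<aa>" "x \<in> \<aa> \<Longrightarrow> - x \<in> \<aa>"
    "x \<in> \<aa> \<Longrightarrow> y \<in> \<aa> \<Longrightarrow> x - y \<in> \<aa>"
proof -
  have C: "c \<in> \<O> \<Longrightarrow> x \<in> \<aa> \<Longrightarrow> c * x \<in> \<aa>" for c x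
    using assms by (auto simp: frac_ideal_def is_submodule_def)
  show "x \<in> \<aa> \<Longrightarrow> x \<in> K" "0 \<in> \<aa>" "x \<in> \<aa> \<Longrightarrow> y \<in> \<aa> \<Longrightarrow> x + y \<in> \<aa>"
    "c \<in> \<O> \<Longrightarrow> x \<in> \<aa> \<Longrightarrow> c * x \<in> \<aa>"
    using assms by (auto simp: frac_ideal_def is_submodule_def)
  show "c \<in> \<O> \<Longrightarrow> x \<in> \<aa> \<Longrightarrow> x * c \<in> \<aa>" using C by (metis mult.commute)
  show "x \<in> \<aa> \<Longrightarrow> - x \<in> \<aa>" using C[of "-1" x] by simp
  show "x \<in> \<aa> \<Longrightarrow> y \<in> \<aa> \<Longrightarrow> x - y \<in> \<aa>"
    using assms is_submodule_diff[OF subring_ints] by (auto simp: frac_ideal_def)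
qed

lemma ideal_mult_inc: "a \<in> \<aa> \<Longrightarrow> b \<in> \<bb> \<Longrightarrow> a * b \<in> \<aa> \<cdot> \<bb>"
  unfolding ideal_mult_def by (rule module_span_inc) blast

lemma ideal_mult_subset:
  "(\<And>a b. a \<in> \<aa> \<Longrightarrow> b \<in> \<bb> \<Longrightarrow> a * b \<in> \<cc>) \<Longrightarrow> is_submodule \<O> (*) \<cc> \<Longrightarrow> \<aa> \<cdot> \<bb> \<subseteq> \<cc>"
  unfolding ideal_mult_def by (rule module_span_minimal) auto

lemma ideal_mult_commute: "\<aa> \<cdot> \<bb> = \<bb> \<cdot> \<aa>"
proof -
  have "{a * b |a b. a \<in> \<aa> \<and> b \<in> \<bb>} = {a * b |a b. a \<in> \<bb> \<and> b \<in> \<aa>}"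
    by (metis mult.commute)
  thus ?thesis by (simp add: ideal_mult_def)
qed

lemma is_submodule_K: "is_submodule \<O> (*) K"
  by (auto simp: is_submodule_def)

lemma frac_ideal_mult:
  assumes "frac_ideal \<aa>" "frac_ideal \<bb>"
  shows "frac_ideal (\<aa> \<cdot> \<bb>)"
  unfolding frac_ideal_def
proof
  show "\<aa> \<cdot> \<bb> \<subseteq> K" using assms by (intro ideal_mult_subset is_submodule_K) (auto simp: frac_ideal_def)
  show "is_submodule \<O> (*) (\<aa> \<cdot> \<bb>)" unfolding ideal_mult_def by (rule is_submodule_module_span)
qed

lemma is_submodule_ideal_mult: "is_submodule \<O> (*) (\<aa> \<cdot> \<bb>)"
  unfolding ideal_mult_def by (rule is_submodule_module_span)

lemma is_submodule_preimage: "is_submodule \<O> (*) \<cc> \<Longrightarrow> is_submodule \<O> (*) {x. x * z \<in> \<cc>}"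
  by (auto simp: is_submodule_def distrib_right mult.assoc)

lemma ideal_mult_mult_subset:
  assumes "\<And>a b c. a \<in> \<aa> \<Longrightarrow> b \<in> \<bb> \<Longrightarrow> c \<in> \<cc> \<Longrightarrow> a * b * c \<in> \<dd>" "is_submodule \<O> (*) \<dd>"
  shows "\<aa> \<cdot> \<bb> \<cdot> \<cc> \<subseteq> \<dd>"
proof (rule ideal_mult_subset[OF _ assms(2)])
  fix x c assume "x \<in> \<aa> \<cdot> \<bb>" "c \<in> \<cc>"
  moreover have "\<aa> \<cdot> \<bb> \<subseteq> {x. x * c \<in> \<dd>}"
    using assms \<open>c \<in> \<cc>\<close> by (intro ideal_mult_subset is_submodule_preimage) auto
  ultimately show "x * c \<in> \<dd>" by auto
qed

lemma ideal_mult_assoc: "\<aa> \<cdot> \<bb> \<cdot> \<cc> = \<aa> \<cdot> (\<bb> \<cdot> \<cc>)"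
proof
  have sub: "\<aa> \<cdot> \<bb> \<cdot> \<cc> \<subseteq> \<aa> \<cdot> (\<bb> \<cdot> \<cc>)" for \<aa> \<bb> \<cc>
    by (rule ideal_mult_mult_subset[OF _ is_submodule_ideal_mult])
      (simp add: mult.assoc ideal_mult_inc)
  show "\<aa> \<cdot> \<bb> \<cdot> \<cc> \<subseteq> \<aa> \<cdot> (\<bb> \<cdot> \<cc>)" by (rule sub)
  show "\<aa> \<cdot> (\<bb> \<cdot> \<cc>) \<subseteq> \<aa> \<cdot> \<bb> \<cdot> \<cc>"
    using sub[of \<cc> \<bb> \<aa>] by (simp add: ideal_mult_commute)
qed

lemma ideal_mult_ints:
  assumes "frac_ideal \<aa>"
  shows "\<O> \<cdot> \<aa> = \<aa>" "\<aa> \<cdot> \<O> = \<aa>"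
proof -
  show "\<O> \<cdot> \<aa> = \<aa>"
  proof
    show "\<O> \<cdot> \<aa> \<subseteq> \<aa>" using assms by (intro ideal_mult_subset) (auto simp: frac_ideal_def is_submodule_def)
    show "\<aa> \<subseteq> \<O> \<cdot> \<aa>" using ideal_mult_inc[of 1 \<O> _ \<aa>] by auto
  qed
  thus "\<aa> \<cdot> \<O> = \<aa>" by (simp add: ideal_mult_commute)
qed

lemma ideal_mult_mono: "\<aa> \<subseteq> \<aa>' \<Longrightarrow> \<bb> \<subseteq> \<bb>' \<Longrightarrow> \<aa> \<cdot> \<bb> \<subseteq> \<aa>' \<cdot> \<bb>'"
  unfolding ideal_mult_def by (rule module_span_mono) auto

lemma frac_ideal_inv: "frac_ideal (inv_ideal \<aa>)"
  by (auto simp: frac_ideal_def is_submodule_def inverse_ideal_def distrib_right mult.assoc)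

lemma inv_ideal_mult_subset: "\<aa> \<cdot> inv_ideal \<aa> \<subseteq> \<O>"
  using frac_ideal_ints
  by (intro ideal_mult_subset) (auto simp: inverse_ideal_def frac_ideal_def mult.commute)

lemma subset_inv_ideal:
  assumes "\<bb> \<subseteq> K" "\<aa> \<cdot> \<bb> \<subseteq> \<O>"
  shows "\<bb> \<subseteq> inv_ideal \<aa>"
  using assms ideal_mult_inc[of _ \<bb> _ \<aa>] unfolding ideal_mult_commute[of \<bb>]
  by (auto simp: inverse_ideal_def)

lemma inv_ideal_unique:
  assumes "frac_ideal \<aa>" "frac_ideal \<bb>" "\<aa> \<cdot> \<bb> = \<O>"
  shows "inv_ideal \<aa> = \<bb>"
proof
  show "\<bb> \<subseteq> inv_ideal \<aa>"
    using assms by (intro subset_inv_ideal) (auto simp: frac_ideal_def)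
  have "inv_ideal \<aa> = inv_ideal \<aa> \<cdot> (\<aa> \<cdot> \<bb>)" by (simp add: assms ideal_mult_ints frac_ideal_inv)
  also have "\<dots> = (\<aa> \<cdot> inv_ideal \<aa>) \<cdot> \<bb>" by (metis ideal_mult_assoc ideal_mult_commute)
  also have "\<dots> \<subseteq> \<O> \<cdot> \<bb>" by (intro ideal_mult_mono inv_ideal_mult_subset order.refl)
  finally show "inv_ideal \<aa> \<subseteq> \<bb>" by (simp add: assms ideal_mult_ints)
qed

lemma nonzero_fractional_mult:
  assumes "nonzero_fractional_ideal K \<aa>" "nonzero_fractional_ideal K \<bb>"
  shows "nonzero_fractional_ideal K (\<aa> \<cdot> \<bb>)"
proof -
  from assms obtain S T where S: "finite S" "\<aa> = module_span \<O> (*) S"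
    and T: "finite T" "\<bb> = module_span \<O> (*) T"
    by (auto simp: nonzero_fractional_ideal_def finitely_generated_def)
  have fa: "frac_ideal \<aa>" "frac_ideal \<bb>" using assms nonzero_fractional_imp_frac by auto
  let ?U = "(\<lambda>(s,t). s * t) ` (S \<times> T)"
  have "\<aa> \<cdot> \<bb> = module_span \<O> (*) ?U"
  proof
    show "module_span \<O> (*) ?U \<subseteq> \<aa> \<cdot> \<bb>"
      by (rule module_span_minimal) (auto simp: is_submodule_ideal_mult S T intro!: ideal_mult_inc module_span_inc)
    have sm: "is_submodule \<O> (*) (module_span \<O> (*) ?U)" by (rule is_submodule_module_span)
    show "\<aa> \<cdot> \<bb> \<subseteq> module_span \<O> (*) ?U"
    proof (rule ideal_mult_subset[OF _ sm])
      fix a b assume "a \<in> \<aa>" "b \<in> \<bb>"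
      have "module_span \<O> (*) S \<subseteq> {x. x * t \<in> module_span \<O> (*) ?U}" if "t \<in> T" for t
        using that by (intro module_span_minimal is_submodule_preimage[OF sm]) (auto intro: module_span_inc)
      hence "module_span \<O> (*) T \<subseteq> {x. x * a \<in> module_span \<O> (*) ?U}"
        using \<open>a \<in> \<aa>\<close> S by (intro module_span_minimal is_submodule_preimage[OF sm]) (auto simp: mult.commute)
      thus "a * b \<in> module_span \<O> (*) ?U" using \<open>b \<in> \<bb>\<close> T by (auto simp: mult.commute)
    qed
  qed
  hence "finitely_generated \<O> (*) (\<aa> \<cdot> \<bb>)"
    unfolding finitely_generated_def using S T by (intro exI[of _ ?U]) auto
  moreover have "\<aa> \<cdot> \<bb> \<noteq> {0}"
  proof -
    have "\<exists>x\<in>\<cc>. x \<noteq> 0" if "nonzero_fractional_ideal K \<cc>" for \<cc>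
      using frac_idealD(2)[OF nonzero_fractional_imp_frac[OF that]] that
      by (auto simp: nonzero_fractional_ideal_def)
    with assms obtain a b where "a \<in> \<aa>" "a \<noteq> 0" "b \<in> \<bb>" "b \<noteq> 0" by meson
    thus ?thesis using ideal_mult_inc[of a \<aa> b \<bb>] by (metis mult_eq_0_iff singletonD)
  qed
  moreover have "\<aa> \<cdot> \<bb> \<subseteq> K" using frac_ideal_mult fa by (auto simp: frac_ideal_def)
  ultimately show ?thesis by (simp add: nonzero_fractional_ideal_def)
qed

text \<open>Write 1 as a sum of products a_i b_i with a_i in \<aa> and b_i in \<bb>. Every x in
  \<bb> is the sum of the (a_i x) b_i with integral coefficients a_i x, so the finitely many b_i
  generate \<bb>.\<close>

lemma nonzero_fractional_factor:
  assumes "frac_ideal \<aa>" "frac_ideal \<bb>" "\<aa> \<cdot> \<bb> = \<O>"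
  shows "nonzero_fractional_ideal K \<bb>"
proof -
  have "\<exists>S. finite S \<and> S \<subseteq> \<bb> \<and> x \<in> \<aa> \<cdot> S" if "x \<in> \<aa> \<cdot> \<bb>" for x
    using that unfolding ideal_mult_def
  proof (induction rule: module_span_induct)
    case (base x)
    then obtain a b where "a \<in> \<aa>" "b \<in> \<bb>" "x = a * b" by auto
    thus ?case by (intro exI[of _ "{b}"]) (auto intro: module_span_inc)
  next
    case (add x y)
    then obtain S T where "finite S" "S \<subseteq> \<bb>" "x \<in> \<aa> \<cdot> S" "finite T" "T \<subseteq> \<bb>" "y \<in> \<aa> \<cdot> T"
      by (auto simp: ideal_mult_def)
    moreover have "\<aa> \<cdot> S \<subseteq> \<aa> \<cdot> (S \<union> T)" "\<aa> \<cdot> T \<subseteq> \<aa> \<cdot> (S \<union> T)"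
      by (intro ideal_mult_mono order.refl Un_upper1 Un_upper2)+
    ultimately have "finite (S \<union> T) \<and> S \<union> T \<subseteq> \<bb> \<and> x + y \<in> \<aa> \<cdot> (S \<union> T)"
      using is_submodule_ideal_mult[of \<aa> "S \<union> T"] unfolding is_submodule_def
      by (meson finite_Un le_sup_iff subsetD)
    thus ?case unfolding ideal_mult_def by blast
  next
    case (scale c x)
    thus ?case by (auto intro: module_span_scale)
  qed (auto intro: module_span_zero)
  then obtain S where S: "finite S" "S \<subseteq> \<bb>" "1 \<in> \<aa> \<cdot> S" using assms(3) ints_closed(2) by blast
  have "\<bb> \<subseteq> module_span \<O> (*) S"
  proof
    fix x assume x: "x \<in> \<bb>"
    have "\<aa> \<cdot> S \<subseteq> {y. y * x \<in> module_span \<O> (*) S}"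
    proof (intro ideal_mult_subset is_submodule_preimage is_submodule_module_span CollectI)
      fix a s assume "a \<in> \<aa>" "s \<in> S"
      hence "a * x \<in> \<O>" using ideal_mult_inc[OF _ x] assms(3) by blast
      thus "a * s * x \<in> module_span \<O> (*) S"
        using module_span_scale[of "a * x" \<O> s "(*)" S] \<open>s \<in> S\<close> by (simp add: module_span_inc mult_ac)
    qed
    thus "x \<in> module_span \<O> (*) S" using S(3) by auto
  qed
  moreover have "module_span \<O> (*) S \<subseteq> \<bb>"
    using S(2) assms(2) by (intro module_span_minimal) (auto simp: frac_ideal_def)
  ultimately have "finitely_generated \<O> (*) \<bb>" using S(1) unfolding finitely_generated_def by blast
  moreover have "\<bb> \<noteq> {0}"
  proof
    assume "\<bb> = {0}"
    hence "\<aa> \<cdot> \<bb> \<subseteq> {0}" by (intro ideal_mult_subset) (auto simp: is_submodule_def)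
    thus False using assms(3) ints_closed(2) by force
  qed
  ultimately show ?thesis using assms(2) by (auto simp: nonzero_fractional_ideal_def frac_ideal_def)
qed

lemma invertible_imp_frac: "invertible_ideal \<aa> \<Longrightarrow> frac_ideal \<aa>"
  by (auto simp: invertible_ideal_def nonzero_fractional_imp_frac)

lemma invertible_idealI:
  assumes "frac_ideal \<aa>" "frac_ideal \<bb>" "\<aa> \<cdot> \<bb> = \<O>"
  shows "invertible_ideal \<aa>"
  using nonzero_fractional_factor[of \<bb> \<aa>] inv_ideal_unique[OF assms] assms
  by (simp add: invertible_ideal_def ideal_mult_commute)

lemma invertible_inv:
  assumes "invertible_ideal \<aa>"
  shows "invertible_ideal (inv_ideal \<aa>)" "inv_ideal (inv_ideal \<aa>) = \<aa>"
proof -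
  have e: "inv_ideal \<aa> \<cdot> \<aa> = \<O>" using assms by (simp add: invertible_ideal_def ideal_mult_commute)
  show "invertible_ideal (inv_ideal \<aa>)" "inv_ideal (inv_ideal \<aa>) = \<aa>"
    using invertible_idealI[OF _ _ e] inv_ideal_unique[OF _ _ e] frac_ideal_inv
      invertible_imp_frac[OF assms] by auto
qed

text \<open>Invertibility is asked of one factor only, since the ideals that twist root systems in
  the definition of a genus are merely nonzero fractional.\<close>

lemma inv_ideal_mult:
  assumes "frac_ideal \<cc>" "invertible_ideal \<aa>"
  shows "inv_ideal (\<cc> \<cdot> \<aa>) = inv_ideal \<cc> \<cdot> inv_ideal \<aa>"
proof
  have a: "\<aa> \<cdot> inv_ideal \<aa> = \<O>" "frac_ideal \<aa>"
    using assms(2) invertible_imp_frac by (auto simp: invertible_ideal_def)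
  have "inv_ideal (\<cc> \<cdot> \<aa>) \<cdot> \<aa> \<subseteq> inv_ideal \<cc>"
  proof (rule ideal_mult_subset)
    fix x y assume x: "x \<in> inv_ideal (\<cc> \<cdot> \<aa>)" and y: "y \<in> \<aa>"
    have "x * y * c \<in> \<O>" if "c \<in> \<cc>" for c
      using x ideal_mult_inc[OF that y] by (auto simp: inverse_ideal_def mult_ac)
    moreover have "x * y \<in> K" using x y a by (auto simp: inverse_ideal_def frac_ideal_def)
    ultimately show "x * y \<in> inv_ideal \<cc>" by (auto simp: inverse_ideal_def)
  qed (use frac_ideal_inv in \<open>auto simp: frac_ideal_def\<close>)
  hence "inv_ideal (\<cc> \<cdot> \<aa>) \<cdot> \<aa> \<cdot> inv_ideal \<aa> \<subseteq> inv_ideal \<cc> \<cdot> inv_ideal \<aa>"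
    by (rule ideal_mult_mono) auto
  thus "inv_ideal (\<cc> \<cdot> \<aa>) \<subseteq> inv_ideal \<cc> \<cdot> inv_ideal \<aa>"
    by (simp add: ideal_mult_assoc a ideal_mult_ints frac_ideal_inv)
  have "\<cc> \<cdot> \<aa> \<cdot> (inv_ideal \<cc> \<cdot> inv_ideal \<aa>) = (\<cc> \<cdot> inv_ideal \<cc>) \<cdot> (\<aa> \<cdot> inv_ideal \<aa>)"
    by (metis ideal_mult_assoc ideal_mult_commute)
  also have "\<dots> \<subseteq> \<O>" using inv_ideal_mult_subset[of \<cc>] frac_ideal_mult[of \<cc> "inv_ideal \<cc>"] assms(1) frac_ideal_inv
    by (subst a, subst ideal_mult_ints) (auto simp: frac_ideal_def)
  finally have "\<cc> \<cdot> \<aa> \<cdot> (inv_ideal \<cc> \<cdot> inv_ideal \<aa>) \<subseteq> \<O>" .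
  moreover have "inv_ideal \<cc> \<cdot> inv_ideal \<aa> \<subseteq> K"
    using frac_ideal_mult[of "inv_ideal \<cc>" "inv_ideal \<aa>"] frac_ideal_inv by (auto simp: frac_ideal_def)
  ultimately show "inv_ideal \<cc> \<cdot> inv_ideal \<aa> \<subseteq> inv_ideal (\<cc> \<cdot> \<aa>)"
    by (rule subset_inv_ideal[rotated])
qed

lemma invertible_ideal_mult:
  assumes "invertible_ideal \<aa>" "invertible_ideal \<bb>"
  shows "invertible_ideal (\<aa> \<cdot> \<bb>)"
proof (rule invertible_idealI)
  show "frac_ideal (\<aa> \<cdot> \<bb>)" "frac_ideal (inv_ideal \<aa> \<cdot> inv_ideal \<bb>)"
    using assms[THEN invertible_imp_frac] frac_ideal_inv by (auto intro!: frac_ideal_mult)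
  have "\<aa> \<cdot> \<bb> \<cdot> (inv_ideal \<aa> \<cdot> inv_ideal \<bb>) = (\<aa> \<cdot> inv_ideal \<aa>) \<cdot> (\<bb> \<cdot> inv_ideal \<bb>)"
    by (metis ideal_mult_assoc ideal_mult_commute)
  thus "\<aa> \<cdot> \<bb> \<cdot> (inv_ideal \<aa> \<cdot> inv_ideal \<bb>) = \<O>"
    using assms by (simp add: invertible_ideal_def ideal_mult_ints frac_ideal_ints)
qed

lemma prin_one: "prin 1 = \<O>"
  by (auto simp: principal_ideal_def)

lemma frac_ideal_prin: "\<mu> \<in> K \<Longrightarrow> frac_ideal (prin \<mu>)"
  unfolding frac_ideal_def is_submodule_def principal_ideal_def
proof (intro conjI ballI)
  assume "\<mu> \<in> K"
  show "{\<mu> * x |x. x \<in> \<O>} \<subseteq> K" using \<open>\<mu> \<in> K\<close> by auto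
  show "0 \<in> {\<mu> * x |x. x \<in> \<O>}" by (auto intro!: exI[of _ 0])
  fix x y assume "x \<in> {\<mu> * x |x. x \<in> \<O>}" "y \<in> {\<mu> * x |x. x \<in> \<O>}"
  thus "x + y \<in> {\<mu> * x |x. x \<in> \<O>}" by (auto simp: distrib_left[symmetric])
next
  fix c x assume "c \<in> \<O>" "x \<in> {\<mu> * x |x. x \<in> \<O>}"
  thus "c * x \<in> {\<mu> * x |x. x \<in> \<O>}"
    by (auto simp: mult.left_commute[of c])
qed

lemma prin_mult:
  assumes "frac_ideal \<aa>"
  shows "prin \<mu> \<cdot> \<aa> = (*) \<mu> ` \<aa>"
proof
  show "(*) \<mu> ` \<aa> \<subseteq> prin \<mu> \<cdot> \<aa>"
    using ideal_mult_inc[of \<mu> "prin \<mu>"] by (auto simp: principal_ideal_def intro!: exI[of _ 1])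
  show "prin \<mu> \<cdot> \<aa> \<subseteq> (*) \<mu> ` \<aa>"
  proof (rule ideal_mult_subset)
    show "is_submodule \<O> (*) ((*) \<mu> ` \<aa>)"
      using assms module_span_image_hom[of "(*) \<mu>" \<O> "(*)" "(*)" \<aa>] is_submodule_module_span[of \<O> "(*)" "(*) \<mu> ` \<aa>"]
      by (simp add: module_span_eq frac_ideal_def distrib_left mult.left_commute)
    fix a b assume "a \<in> prin \<mu>" "b \<in> \<aa>"
    thus "a * b \<in> (*) \<mu> ` \<aa>" using frac_idealD(4)[OF assms] by (auto simp: principal_ideal_def mult.assoc)
  qed
qed

lemma prin_prin: "b \<in> K \<Longrightarrow> prin a \<cdot> prin b = prin (a * b)"
  by (subst prin_mult[OF frac_ideal_prin]) (auto simp: principal_ideal_def mult.assoc)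

lemma invertible_prin:
  assumes "\<mu> \<in> K" "\<mu> \<noteq> 0"
  shows "invertible_ideal (prin \<mu>)" "inv_ideal (prin \<mu>) = prin (inverse \<mu>)"
proof -
  have "prin \<mu> \<cdot> prin (inverse \<mu>) = \<O>" using assms by (simp add: prin_prin prin_one)
  from invertible_idealI[OF _ _ this] inv_ideal_unique[OF _ _ this] assms
  show "invertible_ideal (prin \<mu>)" "inv_ideal (prin \<mu>) = prin (inverse \<mu>)"
    by (auto simp: frac_ideal_prin)
qed

lemma invertible_ints: "invertible_ideal \<O>" and inv_ideal_ints: "inv_ideal \<O> = \<O>"
  using invertible_prin[of 1] by (auto simp: prin_one)

end

section \<open>Roots\<close>

lemma GL_simps [simp]:
  "g \<in> carrier (GL K) \<longleftrightarrow> (\<forall>i j. g $ i $ j \<in> K) \<and> invertible g"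
  "g \<otimes>\<^bsub>GL K\<^esub> h = g ** h" "\<one>\<^bsub>GL K\<^esub> = mat 1"
  by (auto simp: GL_def)

lemma line_mult_vec: "(\<lambda>x. g *v x) ` line \<aa> v = line \<aa> (g *v v)"
  by (simp add: line_def image_image vector_scalar_commute)

lemma line_inj: "v \<noteq> 0 \<Longrightarrow> line \<aa> v = line \<bb> v \<Longrightarrow> \<aa> = \<bb>"
  unfolding line_def by (subst (asm) inj_image_eq_iff) (auto intro: injI simp: vector_mul_rcancel)

lemma line_scale: "line ((*) c ` \<aa>) v = line \<aa> (c *s v)"
  by (simp add: line_def image_image vector_smult_assoc mult.commute)

lemma mult_vec_axis: "((A :: complex ^ 'n ^ 'm) *v axis j 1) $ i = A $ i $ j"
  by (simp add: matrix_vector_mult_def axis_def if_distrib[of "\<lambda>x. _ * x"] cong: if_cong)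

lemma vspaceD: "v \<in> vspace K \<Longrightarrow> v $ i \<in> K"
  by (simp add: vspace_def)

context real_subfield begin

lemma vspace_closed [intro]:
  "0 \<in> vspace K" "v \<in> vspace K \<Longrightarrow> w \<in> vspace K \<Longrightarrow> v + w \<in> vspace K"
  "c \<in> K \<Longrightarrow> v \<in> vspace K \<Longrightarrow> c *s v \<in> vspace K"
  "v \<in> vspace K \<Longrightarrow> w \<in> vspace K \<Longrightarrow> v - w \<in> vspace K"
  by (auto simp: vspace_def)

lemma is_submodule_vspace: "is_submodule K (*s) (vspace K)"
  by (auto simp: is_submodule_def)

lemma axis_vspace: "axis i 1 \<in> vspace K"
  by (auto simp: vspace_def axis_def)

lemma mult_vec_vspace: "\<forall>i j. g $ i $ j \<in> K \<Longrightarrow> v \<in> vspace K \<Longrightarrow> g *v v \<in> vspace K"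
  by (auto simp: vspace_def matrix_vector_mult_def intro!: K_sum)

lemma matrix_eqI_vspace:
  assumes "\<And>x. x \<in> vspace K \<Longrightarrow> A *v x = B *v x"
  shows "A = B"
proof -
  have "A $ i $ j = B $ i $ j" for i j
    using assms[OF axis_vspace[of j]] by (metis mult_vec_axis)
  thus ?thesis by (simp add: vec_eq_iff)
qed

section \<open>The general linear group over K\<close>

lemma det_K: "\<forall>i j. A $ i $ j \<in> K \<Longrightarrow> det A \<in> K"
  unfolding det_def by (intro K_sum K_closed(4) K_of_int K_prod) auto

text \<open>The inverse is formed over the complex numbers; Cramer's rule writes its entries as
  quotients of determinants over K.\<close>

lemma matrix_inv_K:
  fixes g :: "complex ^ 'n ^ 'n"
  assumes "\<forall>i j. g $ i $ j \<in> K" "invertible g"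
  shows "matrix_inv g $ i $ j \<in> K"
proof -
  have "g *v (matrix_inv g *v axis j 1) = axis j 1"
    by (simp add: matrix_vector_mul_assoc matrix_inv_cancel assms)
  hence "matrix_inv g *v axis j 1 =
      (\<chi> k. det (\<chi> i l. if l = k then axis j 1 $ i else g $ i $ l) / det g)"
    using assms(2) by (subst (asm) cramer) (auto simp: invertible_det_nz)
  from arg_cong[OF this, of "\<lambda>x. x $ i"]
  have "matrix_inv g $ i $ j = det (\<chi> i' l. if l = i then axis j 1 $ i' else g $ i' $ l) / det g"
    by (simp add: mult_vec_axis)
  also have "\<dots> \<in> K" using assms(1) by (intro K_divide det_K) (auto simp: axis_def)
  finally show ?thesis .
qed

lemma matrix_inv_GL:
  fixes g :: "complex ^ 'n ^ 'n"
  shows "g \<in> carrier (GL K) \<Longrightarrow> matrix_inv g \<in> carrier (GL K)"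
  using matrix_inv_K[of g] matrix_inv_eqI(2)[of "matrix_inv g" g]
  by (auto simp: matrix_inv_cancel)

lemma group_GL: "group (GL K :: (complex ^ 'n ^ 'n) monoid)"
proof (rule groupI)
  fix x :: "complex ^ 'n ^ 'n" assume x: "x \<in> carrier (GL K)"
  thus "\<exists>y\<in>carrier (GL K). y \<otimes>\<^bsub>GL K\<^esub> x = \<one>\<^bsub>GL K\<^esub>"
    using matrix_inv_GL[OF x] by (intro bexI[of _ "matrix_inv x"]) (auto simp: matrix_inv_cancel)
  fix y :: "complex ^ 'n ^ 'n" assume y: "y \<in> carrier (GL K)"
  have "(x ** y) $ i $ j \<in> K" for i j
    using x y by (auto simp: matrix_matrix_mult_def)
  thus "x \<otimes>\<^bsub>GL K\<^esub> y \<in> carrier (GL K)" using x y invertible_mult by auto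
next
  have "invertible (mat 1 :: complex ^ 'n ^ 'n)" by (rule matrix_inv_eqI(2)) simp
  thus "\<one>\<^bsub>GL K\<^esub> \<in> carrier (GL K :: (complex ^ 'n ^ 'n) monoid)" by (auto simp: mat_def)
qed (auto simp: matrix_mul_assoc)

lemma m_inv_GL:
  fixes g :: "complex ^ 'n ^ 'n"
  shows "g \<in> carrier (GL K) \<Longrightarrow> inv\<^bsub>GL K\<^esub> g = matrix_inv g"
  using group.inv_equality[OF group_GL _ _ matrix_inv_GL[of g]] by (auto simp: matrix_inv_cancel)

lemma dual_GL:
  fixes g :: "complex ^ 'n ^ 'n"
  assumes "g \<in> carrier (GL K)"
  shows "dual g \<in> carrier (GL K)"
proof -
  have "dual g $ i $ j = matrix_inv g $ j $ i" for i j by (simp add: transpose_def)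
  thus ?thesis using matrix_inv_GL[OF assms] matrix_inv_eqI(2)[of "dual g" "transpose g"] assms
    by (auto simp: matrix_transpose_mul[symmetric] matrix_inv_cancel transpose_mat simp del: transpose_matrix_vector)
qed

lemma contragredient_eq:
  fixes g :: "complex ^ 'n ^ 'n"
  assumes g: "g \<in> carrier (GL K)"
  shows "contragredient K g = dual g"
  unfolding contragredient_def
proof (rule the_equality, goal_cases)
  case 1
  show ?case using dual_GL[OF g] g pairing_dual[of g] by auto
next
  case (2 h)
  show ?case
  proof (rule matrix_eqI_vspace)
    fix w :: "complex ^ 'n" assume w: "w \<in> vspace K"
    have gi: "matrix_inv g *v v \<in> vspace K" if "v \<in> vspace K" for v
      using matrix_inv_GL[OF g] that by (auto intro: mult_vec_vspace)
    have "pairing v (h *v w) = pairing v (dual g *v w)" if v: "v \<in> vspace K" for v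
    proof -
      have "g *v (matrix_inv g *v v) = v" using g by (simp add: matrix_vector_mul_assoc matrix_inv_cancel)
      thus ?thesis using 2 pairing_dual[of g "matrix_inv g *v v" w] gi[OF v] w g by auto
    qed
    from this[OF axis_vspace] show "h *v w = dual g *v w" by (simp add: pairing_axis vec_eq_iff)
  qed
qed

text \<open>With \<open>pairing v w = 2\<close> and invertible \<open>\<aa>\<close>, these are all the roots over a real field,
  since there \<open>\<xi> = -1\<close> is the only nontrivial root of unity.\<close>

definition mkroot :: "complex set \<Rightarrow> complex ^ 'n \<Rightarrow> complex ^ 'n \<Rightarrow> 'n::finite zroot" where
  "mkroot \<aa> v w = ZRoot (line \<aa> v) (line (inv_ideal \<aa>) w) (- 1)"

lemma module_span_K_ideal:
  assumes "frac_ideal \<aa>" "\<aa> \<noteq> {0}"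
  shows "module_span K (*) \<aa> = K"
proof
  show "module_span K (*) \<aa> \<subseteq> K"
    using assms(1) by (intro module_span_minimal) (auto simp: frac_ideal_def is_submodule_def)
  from assms obtain a where a: "a \<in> \<aa>" "a \<noteq> 0" using frac_idealD(2) by fastforce
  show "K \<subseteq> module_span K (*) \<aa>"
  proof
    fix x assume "x \<in> K"
    hence "(x / a) * a \<in> module_span K (*) \<aa>"
      using a frac_idealD(1)[OF assms(1)] by (intro module_span_scale module_span_inc) auto
    thus "x \<in> module_span K (*) \<aa>" using a by simp
  qed
qed

lemma module_span_K_line:
  "frac_ideal \<aa> \<Longrightarrow> \<aa> \<noteq> {0} \<Longrightarrow> module_span K (*s) (line \<aa> v) = line K v"
  by (simp add: module_span_line module_span_K_ideal)

lemma module_span_singleton: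
  assumes "complex_subring R"
  shows "module_span R (*s) {v} = line R v"
proof -
  have "module_span R (*) {1} = R"
  proof
    show "module_span R (*) {1} \<subseteq> R"
      using assms by (intro module_span_minimal) (auto simp: is_submodule_def complex_subring_def)
    show "R \<subseteq> module_span R (*) {1}" using module_span_scale[of _ R 1 "(*)" "{1}"]
      by (auto intro: module_span_inc)
  qed
  thus ?thesis using module_span_line[of R "{1}" v] by (simp add: line_def)
qed

lemma invertible_nonzero: "invertible_ideal \<aa> \<Longrightarrow> \<aa> \<noteq> {0}"
  by (auto simp: invertible_ideal_def nonzero_fractional_ideal_def)

lemma rank_one_lattice_line:
  assumes "nonzero_fractional_ideal K \<aa>" "v \<in> vspace K" "v \<noteq> 0"
  shows "rank_one_lattice K (line \<aa> v)"
proof -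
  from assms obtain S where S: "finite S" "\<aa> = module_span \<O> (*) S"
    by (auto simp: nonzero_fractional_ideal_def finitely_generated_def)
  have "finitely_generated \<O> (*s) (line \<aa> v)"
    unfolding finitely_generated_def using S
    by (intro exI[of _ "line S v"]) (simp add: module_span_line, simp add: line_def)
  moreover have "module_span K (*s) (line \<aa> v) = module_span K (*s) {v}"
    using assms nonzero_fractional_imp_frac
    by (subst module_span_K_line) (auto simp: nonzero_fractional_ideal_def module_span_singleton subring_K)
  moreover have "line \<aa> v \<subseteq> vspace K"
    using assms by (auto simp: line_def nonzero_fractional_ideal_def)
  ultimately show ?thesis using assms(3) by (auto simp: rank_one_lattice_def)
qed

text \<open>The generators of the lattice are K-multiples of \<open>v\<close>; their coefficients
  generate the ideal.\<close>

lemma rank_one_latticeE: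
  assumes "rank_one_lattice K I"
  obtains \<aa> v where "v \<in> vspace K" "v \<noteq> 0" "nonzero_fractional_ideal K \<aa>" "I = line \<aa> v"
proof -
  from assms obtain S v where S: "finite S" "I = module_span \<O> (*s) S" and v: "v \<noteq> 0"
    and span: "module_span K (*s) I = line K v" and IV: "I \<subseteq> vspace K"
    unfolding rank_one_lattice_def finitely_generated_def
    by (auto simp: module_span_singleton subring_K)
  define A where "A = {a \<in> K. a *s v \<in> S}"
  have "S \<subseteq> line K v" using span S module_span_inc[of _ S \<O> "(*s)"] module_span_inc[of _ I K "(*s)"] by blast
  hence SA: "S = line A v" by (auto simp: A_def line_def)
  hence I: "I = line (module_span \<O> (*) A) v" using S by (simp add: module_span_line)
  have "finite ((\<lambda>a. a *s v) ` A)" using S(1) by (rule finite_subset[rotated]) (auto simp: A_def)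
  hence "finite A" by (rule finite_imageD) (use v in \<open>auto simp: inj_on_def vector_mul_rcancel\<close>)
  \<comment> \<open>The definition only provides a complex vector \<open>v\<close>. It has
    coordinates in K because it lies in the K-span of \<open>I\<close>.\<close>
  have "v \<in> line K v" by (auto simp: line_def intro!: image_eqI[of _ _ 1])
  hence "v \<in> vspace K"
    using span module_span_minimal[OF IV is_submodule_vspace] by auto
  moreover have "module_span \<O> (*) A \<subseteq> K"
    by (intro module_span_minimal is_submodule_K) (auto simp: A_def)
  moreover have "module_span \<O> (*) A \<noteq> {0}"
  proof
    assume "module_span \<O> (*) A = {0}"
    hence "module_span K (*s) I \<subseteq> {0}"
      unfolding I by (intro module_span_minimal) (auto simp: line_def is_submodule_def)
    thus False using span \<open>v \<in> line K v\<close> v by auto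
  qed
  ultimately show ?thesis using that[of v "module_span \<O> (*) A"] v I \<open>finite A\<close>
    by (auto simp: nonzero_fractional_ideal_def finitely_generated_def)
qed

lemma pairing_ideal_line:
  "pairing_ideal K (line \<aa> v) (line \<bb> w) = (*) (pairing v w) ` (\<aa> \<cdot> \<bb>)"
proof -
  have "{pairing \<alpha> \<beta> |\<alpha> \<beta>. \<alpha> \<in> line \<aa> v \<and> \<beta> \<in> line \<bb> w} =
      (*) (pairing v w) ` {a * b |a b. a \<in> \<aa> \<and> b \<in> \<bb>}" (is "?L = ?R")
  proof
    show "?L \<subseteq> ?R"
    proof
      fix x assume "x \<in> ?L"
      then obtain a b where "a \<in> \<aa>" "b \<in> \<bb>" "x = a * (b * pairing v w)" by (auto simp: line_def)
      thus "x \<in> ?R" by (intro image_eqI[of _ _ "a * b"]) (auto simp: mult_ac)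
    qed
    show "?R \<subseteq> ?L"
    proof clarify
      fix a b assume "a \<in> \<aa>" "b \<in> \<bb>"
      thus "\<exists>\<alpha> \<beta>. pairing v w * (a * b) = pairing \<alpha> \<beta> \<and> \<alpha> \<in> line \<aa> v \<and> \<beta> \<in> line \<bb> w"
        by (intro exI[of _ "a *s v"] exI[of _ "b *s w"]) (auto simp: line_def mult_ac)
    qed
  qed
  moreover have "module_span \<O> (*) ((*) c ` S) = (*) c ` module_span \<O> (*) S" for c S
    by (rule module_span_image_hom) (auto simp: distrib_left mult.left_commute)
  ultimately show ?thesis by (simp add: pairing_ideal_def ideal_mult_def)
qed

lemma ideal_times_line: "ideal_times K \<cc> (line \<aa> v) = line (\<cc> \<cdot> \<aa>) v"
proof -
  have "{a *s x |a x. a \<in> \<cc> \<and> x \<in> line \<aa> v} = line {a * b |a b. a \<in> \<cc> \<and> b \<in> \<aa>} v"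
    (is "?L = ?R")
  proof
    show "?L \<subseteq> ?R" by (auto simp: line_def vector_smult_assoc intro!: imageI) blast
    show "?R \<subseteq> ?L"
    proof
      fix y assume "y \<in> ?R"
      then obtain a b where "a \<in> \<cc>" "b \<in> \<aa>" "y = a *s (b *s v)"
        by (auto simp: line_def vector_smult_assoc)
      thus "y \<in> ?L" by (intro CollectI exI[of _ a] exI[of _ "b *s v"]) (auto simp: line_def)
    qed
  qed
  thus ?thesis by (simp add: ideal_times_def module_span_line ideal_mult_def)
qed

lemma is_root_mkroot:
  assumes "invertible_ideal \<aa>" "v \<in> vspace K" "w \<in> vspace K" "pairing v w = 2"
  shows "is_root K (mkroot \<aa> v w)"
proof -
  have "v \<noteq> 0" "w \<noteq> 0" using assms(4) by auto
  moreover have "\<aa> \<cdot> inv_ideal \<aa> = \<O>" "nonzero_fractional_ideal K \<aa>"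
    "nonzero_fractional_ideal K (inv_ideal \<aa>)"
    using assms(1) invertible_inv(1)[OF assms(1)] by (auto simp: invertible_ideal_def)
  moreover have "\<exists>m::nat. m > 0 \<and> (- 1 :: complex) ^ m = 1" by (intro exI[of _ 2]) auto
  ultimately show ?thesis using assms
    by (auto simp: is_root_def mkroot_def pairing_ideal_line principal_ideal_def rank_one_lattice_line
        intro: K_closed(5))
qed

text \<open>Used when genera are compared: there the ideal of a root is at first only known to be
  fractional.\<close>

lemma is_root_mkroot_imp_invertible:
  assumes "is_root K (mkroot \<aa> v w)" "frac_ideal \<aa>" "pairing v w = 2"
  shows "invertible_ideal \<aa>"
proof (rule invertible_idealI[OF assms(2) frac_ideal_inv])
  have "(*) 2 ` (\<aa> \<cdot> inv_ideal \<aa>) = (*) 2 ` \<O>"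
    using assms(1,3) by (auto simp: is_root_def mkroot_def pairing_ideal_line principal_ideal_def)
  thus "\<aa> \<cdot> inv_ideal \<aa> = \<O>" by (subst (asm) inj_image_eq_iff) (auto intro: injI)
qed

text \<open>With p the pairing of \<open>v\<close> and \<open>w\<close>, the root axiom reads p
  \<aa> \<bb> = 2 \<O>. Moving the factor p / 2 from the covector to its ideal makes the two ideals
  inverse to each other and the pairing equal to 2.\<close>

lemma is_rootE:
  assumes "is_root K r"
  obtains \<aa> v w where "invertible_ideal \<aa>" "v \<in> vspace K" "w \<in> vspace K" "pairing v w = 2"
    "r = mkroot \<aa> v w"
proof -
  have xi: "root_xi r = - 1" using assms root_of_unity_cases by (auto simp: is_root_def)
  from assms obtain \<aa> v where a: "v \<in> vspace K" "v \<noteq> 0" "nonzero_fractional_ideal K \<aa>" "root_I r = line \<aa> v"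
    unfolding is_root_def by (metis rank_one_latticeE)
  from assms obtain \<bb> w where b: "w \<in> vspace K" "w \<noteq> 0" "nonzero_fractional_ideal K \<bb>" "root_J r = line \<bb> w"
    unfolding is_root_def by (metis rank_one_latticeE)
  have fa: "frac_ideal \<aa>" and fb: "frac_ideal \<bb>" using a b nonzero_fractional_imp_frac by auto
  define p where "p = pairing v w"
  have pK: "p \<in> K" using a b by (auto simp: p_def)
  have e: "(*) p ` (\<aa> \<cdot> \<bb>) = prin 2"
    using assms by (auto simp: is_root_def a b xi pairing_ideal_line p_def)
  have "p \<noteq> 0"
  proof
    assume "p = 0"
    moreover have "2 \<in> prin 2" by (auto simp: principal_ideal_def intro!: exI[of _ 1])
    ultimately show False using e by (auto simp: image_iff) (metis (lifting) imageE zero_neq_numeral)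
  qed
  define \<bb>' where "\<bb>' = prin (p / 2) \<cdot> \<bb>"
  define w' where "w' = (2 / p) *s w"
  have "\<aa> \<cdot> \<bb>' = prin (1 / 2) \<cdot> (prin p \<cdot> (\<aa> \<cdot> \<bb>))"
  proof -
    have "prin (p / 2) = prin (1 / 2) \<cdot> prin p" using pK by (simp add: prin_prin)
    thus ?thesis unfolding \<bb>'_def by (metis ideal_mult_assoc ideal_mult_commute)
  qed
  also have "prin p \<cdot> (\<aa> \<cdot> \<bb>) = prin 2" using e fa fb by (simp add: prin_mult frac_ideal_mult)
  also have "prin (1 / 2) \<cdot> prin 2 = \<O>" by (simp add: prin_prin prin_one)
  finally have ab: "\<aa> \<cdot> \<bb>' = \<O>" .
  have fb': "frac_ideal \<bb>'" using pK fb by (auto simp: \<bb>'_def intro!: frac_ideal_mult frac_ideal_prin)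
  have "root_J r = line \<bb>' w'"
    unfolding \<bb>'_def prin_mult[OF fb] line_scale w'_def b
    using \<open>p \<noteq> 0\<close> by (simp add: vector_smult_assoc)
  hence "r = mkroot \<aa> v w'"
    using inv_ideal_unique[OF fa fb' ab] a xi by (cases r) (auto simp: mkroot_def)
  moreover have "pairing v w' = 2" using \<open>p \<noteq> 0\<close> by (simp add: w'_def p_def)
  moreover have "w' \<in> vspace K" using b pK by (auto simp: w'_def)
  moreover have "invertible_ideal \<aa>" using invertible_idealI[OF fa fb' ab] .
  ultimately show ?thesis using that a by blast
qed

lemma reflection_matrix_GL:
  assumes "v \<in> vspace K" "w \<in> vspace K" "pairing v w = 2"
  shows "reflection_matrix v w \<in> carrier (GL K)"
  using matrix_inv_eqI(2)[OF reflection_matrix_involution[OF assms(3)]] assms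
  by (auto simp: reflection_matrix_def vspaceD)

text \<open>Any other admissible pair of vectors is \<open>c *s v\<close> and \<open>d *s w\<close>;
  the pairing condition forces c d = 1, and the resulting map is the same.\<close>

lemma root_reflection_mkroot:
  fixes v w :: "complex ^ 'n"
  assumes a: "invertible_ideal \<aa>" and v: "v \<in> vspace K" and w: "w \<in> vspace K" and p: "pairing v w = 2"
  shows "root_reflection K (mkroot \<aa> v w) = reflection_matrix v w"
proof -
  have I: "module_span K (*s) (line \<aa> v) = line K v"
    and J: "module_span K (*s) (line (inv_ideal \<aa>) w) = line K w"
    using a invertible_inv(1)[OF a] by (auto intro!: module_span_K_line invertible_imp_frac invertible_nonzero dest: invertible_nonzero)
  show ?thesis unfolding root_reflection_def mkroot_def zroot.sel I J
  proof (rule the_equality, goal_cases)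
    case 1
    have "v \<in> line K v" "w \<in> line K w" by (auto simp: line_def intro!: image_eqI[of _ _ 1])
    thus ?case using reflection_matrix_GL[OF v w p] p
      by (intro conjI exI[of _ v] exI[of _ w]) (auto simp: reflection_matrix_mult_vec)
  next
    case (2 s)
    then obtain v' w' where v': "v' \<in> line K v" "w' \<in> line K w" "pairing v' w' = 2"
      "\<forall>x\<in>vspace K. s *v x = x - pairing x w' *s v'" by auto
    then obtain c d where "v' = c *s v" "w' = d *s w" by (auto simp: line_def)
    with v' have s: "\<And>x. x \<in> vspace K \<Longrightarrow> s *v x = x - pairing x (d *s w) *s (c *s v)"
      and cd: "pairing (c *s v) (d *s w) = 2" by blast+
    from cd p have "c * d = 1" by (simp add: mult.commute)
    show ?case
    proof (rule matrix_eqI_vspace)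
      fix x :: "complex ^ 'n" assume "x \<in> vspace K"
      hence "s *v x = x - (c * d * pairing x w) *s v" using s by (simp add: vector_smult_assoc mult_ac)
      thus "s *v x = reflection_matrix v w *v x"
        using \<open>c * d = 1\<close> by (simp add: reflection_matrix_mult_vec)
    qed
  qed
qed

lemma root_act_mkroot:
  "g \<in> carrier (GL K) \<Longrightarrow> root_act K g (mkroot \<aa> v w) = mkroot \<aa> (g *v v) (dual g *v w)"
  by (simp add: root_act_def mkroot_def contragredient_eq line_mult_vec del: transpose_matrix_vector)

lemma root_act_mult:
  fixes g h :: "complex ^ 'n ^ 'n"
  assumes "g \<in> carrier (GL K)" "h \<in> carrier (GL K)"
  shows "root_act K (g ** h) r = root_act K g (root_act K h r)"
proof -
  have "g ** h \<in> carrier (GL K)" using monoid.m_closed[OF group.is_monoid[OF group_GL] assms] by simp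
  thus ?thesis using assms
    by (simp add: root_act_def contragredient_eq image_image matrix_vector_mul_assoc dual_mult
        del: transpose_matrix_vector)
qed

lemma matrix_inv_mat_1: "matrix_inv (mat 1 :: complex ^ 'n ^ 'n) = mat 1"
  by (rule matrix_inv_eqI(1)) simp

lemma root_act_one: "root_act K (mat 1 :: complex ^ 'n ^ 'n) r = r"
proof -
  have "(mat 1 :: complex ^ 'n ^ 'n) \<in> carrier (GL K)"
    using monoid.one_closed[OF group.is_monoid[OF group_GL]] by simp
  thus ?thesis
    by (simp add: root_act_def contragredient_eq matrix_inv_mat_1 transpose_mat del: GL_simps(1) transpose_matrix_vector)
qed

lemma root_twist_mkroot:
  assumes "nonzero_fractional_ideal K \<cc>" "invertible_ideal \<aa>"
  shows "root_twist K \<cc> (mkroot \<aa> v w) = mkroot (\<cc> \<cdot> \<aa>) v w"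
  using inv_ideal_mult[OF nonzero_fractional_imp_frac[OF assms(1)] assms(2)]
  by (simp add: root_twist_def mkroot_def ideal_times_line)

text \<open>By \<open>reflection_matrix_eqD\<close>, two presentations over the same reflection
  differ by such a scaling; it can be absorbed into the ideal.\<close>

lemma mkroot_scale:
  assumes "invertible_ideal \<aa>" "\<mu> \<in> K" "\<mu> \<noteq> 0"
  shows "mkroot \<aa> (\<mu> *s v) (inverse \<mu> *s w) = mkroot (prin \<mu> \<cdot> \<aa>) v w"
  using inv_ideal_mult[OF frac_ideal_prin[OF assms(2)] assms(1)] assms invertible_prin[OF assms(2,3)]
  by (simp add: mkroot_def line_scale prin_mult invertible_imp_frac frac_ideal_inv)

lemma mkroot_inj: "mkroot \<aa> v w = mkroot \<bb> v w \<Longrightarrow> v \<noteq> 0 \<Longrightarrow> \<aa> = \<bb>"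
  using line_inj by (auto simp: mkroot_def)

end

section \<open>Dihedral groups\<close>

definition mat2 :: "complex \<Rightarrow> complex \<Rightarrow> complex \<Rightarrow> complex \<Rightarrow> complex ^ 2 ^ 2" where
  "mat2 a b c d = vector [vector [a, b], vector [c, d]]"

abbreviation vec2 :: "complex \<Rightarrow> complex \<Rightarrow> complex ^ 2" where
  "vec2 a b \<equiv> vector [a, b]"

lemma mat2_nth [simp]:
  "mat2 a b c d $ 1 $ 1 = a" "mat2 a b c d $ 1 $ 2 = b" "mat2 a b c d $ 2 $ 1 = c" "mat2 a b c d $ 2 $ 2 = d"
  by (simp_all add: mat2_def)

lemma mat2_eq_iff: "mat2 a b c d = mat2 a' b' c' d' \<longleftrightarrow> a = a' \<and> b = b' \<and> c = c' \<and> d = d'"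
  by (auto simp: vec_eq_iff forall_2)

lemma mat2_mult: "mat2 a b c d ** mat2 a' b' c' d' =
    mat2 (a * a' + b * c') (a * b' + b * d') (c * a' + d * c') (c * b' + d * d')"
  by (simp add: vec_eq_iff forall_2 matrix_matrix_mult_def sum_2)

lemma mat2_mult_vec: "mat2 a b c d *v x = vec2 (a * x $ 1 + b * x $ 2) (c * x $ 1 + d * x $ 2)"
  by (simp add: vec_eq_iff forall_2 matrix_vector_mult_def sum_2)

lemma mat2_one: "mat 1 = mat2 1 0 0 1"
  by (simp add: vec_eq_iff forall_2 mat_def)

lemma det_mat2: "det (mat2 a b c d) = a * d - b * c"
  by (simp add: det_2)

lemma pairing_2: "pairing (x :: complex ^ 2) y = x $ 1 * y $ 1 + x $ 2 * y $ 2"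
  by (simp add: pairing_def sum_2)

lemma algebraic_int_root_of_unity:
  assumes "x ^ n = (1 :: complex)" "n > 0"
  shows "algebraic_int x"
proof
  let ?p = "monom 1 n - 1 :: complex poly"
  have "degree ?p = n" using assms(2)
    by (intro antisym[OF degree_le le_degree]) (auto simp: coeff_1)
  thus "lead_coeff ?p = 1" using assms(2) by (simp add: coeff_1)
  show "\<forall>i. coeff ?p i \<in> \<int>" by (auto simp: coeff_1)
  show "poly ?p x = 0" using assms(1) by (simp add: poly_monom)
qed

text \<open>The expression is det (A - 1) for a matrix A fixing the nonzero vector (x, y). The two
  identities in the proof are the adjugate of A - 1 applied to (A - 1)(x, y).\<close>

lemma vec2_fixed_det:
  fixes a b c d x y :: complex
  assumes "a * x + b * y = x" "c * x + d * y = y" "x \<noteq> 0 \<or> y \<noteq> 0"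
  shows "(a - 1) * (d - 1) - b * c = 0"
proof -
  have "((a - 1) * (d - 1) - b * c) * x = (d - 1) * (a * x + b * y - x) - b * (c * x + d * y - y)"
    "((a - 1) * (d - 1) - b * c) * y = (a - 1) * (c * x + d * y - y) - c * (a * x + b * y - x)"
    by (simp_all add: algebra_simps)
  hence "((a - 1) * (d - 1) - b * c) * x = 0" "((a - 1) * (d - 1) - b * c) * y = 0"
    using assms(1,2) by simp_all
  thus ?thesis using assms(3) by auto
qed

locale dihedral =
  fixes e :: nat
  assumes e3: "e \<ge> 3"
begin

abbreviation zeta_e ("\<zeta>") where "\<zeta> \<equiv> zeta e"
abbreviation lam where "lam \<equiv> dih_lambda e"

lemma zeta_cis: "\<zeta> = cis (2 * pi / e)"
  by (simp add: zeta_def cis_conv_exp mult_ac)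

lemma zeta_nonzero [simp]: "\<zeta> \<noteq> 0"
  by (simp add: zeta_def)

lemma zeta_power_eq_1_iff: "\<zeta> ^ n = 1 \<longleftrightarrow> e dvd n"
proof
  assume "\<zeta> ^ n = 1"
  hence "exp (of_nat n * (2 * of_real pi * \<i> / of_nat e)) = 1"
    by (simp only: zeta_def exp_of_nat_mult)
  then obtain k :: int where "real n * (2 * pi / e) = 2 * of_int k * pi"
    unfolding exp_eq_1 by auto
  hence "real n = of_int k * real e" using e3 by (simp add: field_simps)
  hence "int n = k * int e" by (metis of_int_eq_iff of_int_mult of_int_of_nat_eq)
  hence "int e dvd int n" by simp
  thus "e dvd n" by presburger
next
  assume "e dvd n"
  then obtain k where "n = e * k" by auto
  moreover have "\<zeta> ^ e = 1" using e3 by (simp add: zeta_def exp_of_nat_mult[symmetric])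
  ultimately show "\<zeta> ^ n = 1" by (simp add: power_mult)
qed

lemma zeta_powi_eq_1_iff: "\<zeta> powi n = 1 \<longleftrightarrow> int e dvd n"
proof (cases "n \<ge> 0")
  case True
  then obtain m where "n = int m" by (metis zero_le_imp_eq_int)
  thus ?thesis by (simp add: zeta_power_eq_1_iff)
next
  case False
  then obtain m where "n = - int m" by (metis int_cases2 of_nat_0_le_iff)
  thus ?thesis by (simp add: power_int_minus zeta_power_eq_1_iff)
qed

lemma zeta_sq: "\<zeta> ^ 2 \<noteq> 1"
  using e3 by (auto simp: zeta_power_eq_1_iff dest: dvd_imp_le)

lemma zeta_half:
  assumes "even e"
  shows "\<zeta> ^ (e div 2) = - 1"
proof -
  have "(\<zeta> ^ (e div 2)) ^ 2 = 1" using assms by (simp add: power_mult[symmetric] zeta_power_eq_1_iff)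
  moreover have "\<zeta> ^ (e div 2) \<noteq> 1" using e3 assms by (auto simp: zeta_power_eq_1_iff dest!: dvd_imp_le)
  ultimately show ?thesis by (simp add: power2_eq_1_iff)
qed

section \<open>The trace of \<open>st\<close> and the Chebyshev numbers describing its
  powers\<close>

definition trc :: complex where "trc = \<zeta> + inverse \<zeta>"

lemma lam_trc: "lam = 2 + trc"
  by (simp add: dih_lambda_def trc_def)

lemma real_subfield_dih: "real_subfield (dih_field e)"
proof
  show "complex_subfield (dih_field e)"
    unfolding dih_field_def by (rule hull_in) (auto simp: complex_subfield_def)
  have "inverse \<zeta> = cnj \<zeta>" by (simp add: zeta_cis cis_inverse cis_cnj)
  hence "\<zeta> + inverse \<zeta> \<in> \<real>" by (simp add: complex_add_cnj)
  thus "dih_field e \<subseteq> \<real>"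
    unfolding dih_field_def by (intro hull_minimal) (auto simp: complex_subfield_def)
qed

end

sublocale dihedral \<subseteq> real_subfield "dih_field e"
  by (rule real_subfield_dih)

context dihedral
begin

abbreviation KK ("K") where "K \<equiv> dih_field e"
abbreviation dih_ints ("\<O>") where "\<O> \<equiv> ring_of_integers (dih_field e)"

lemma trc_K [simp]: "trc \<in> K"
  unfolding dih_field_def trc_def by (rule hull_inc) simp

lemma trc_ints [simp]: "trc \<in> \<O>"
proof -
  have z: "\<zeta> ^ e = 1" by (simp add: zeta_power_eq_1_iff)
  hence z': "(inverse \<zeta>) ^ e = 1" by (simp only: power_inverse inverse_1)
  have "0 < e" using e3 by simp
  from algebraic_int_root_of_unity[OF z this] algebraic_int_root_of_unity[OF z' this]
  have "algebraic_int trc" unfolding trc_def using algebraic_int_plus_times by blast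
  thus ?thesis using trc_K unfolding ring_of_integers_def by blast
qed

lemma lam_ints [simp]: "lam \<in> \<O>"
  by (auto simp: lam_trc)

text \<open>This is sin (2 pi n / e) / sin (2 pi / e), for positive n the Chebyshev polynomial of
  the second kind of degree n - 1 at \<open>trc / 2\<close>. Integer indices also cover the inverses
  of powers of \<open>st\<close>.\<close>

definition S :: "int \<Rightarrow> complex" where
  "S n = (\<zeta> powi n - \<zeta> powi (- n)) / (\<zeta> - inverse \<zeta>)"

lemma zeta_diff: "\<zeta> - inverse \<zeta> \<noteq> 0"
  using zeta_sq by (auto simp: field_simps power2_eq_square)

lemma S_0 [simp]: "S 0 = 0" and S_1 [simp]: "S 1 = 1"
  using zeta_diff by (auto simp: S_def power_int_minus)

lemma S_minus: "S (- n) = - S n"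
  unfolding S_def minus_divide_left by simp

lemma S_rec: "S (n + 1) = trc * S n - S (n - 1)"
proof -
  have "trc * (\<zeta> powi n - \<zeta> powi (- n)) =
      (\<zeta> powi (n + 1) - \<zeta> powi (- (n + 1))) + (\<zeta> powi (n - 1) - \<zeta> powi (- (n - 1)))"
    by (simp add: trc_def power_int_add power_int_diff power_int_minus field_simps)
  hence "trc * S n = S (n + 1) + S (n - 1)"
    unfolding S_def times_divide_eq_right add_divide_distrib[symmetric] by (simp only:)
  thus ?thesis by simp
qed

text \<open>As functions of \<open>n\<close> both sides satisfy the recurrence \<open>S_rec\<close>,
  and they agree for n = 0 and n = 1. Carrying two neighbouring values allows induction in both
  directions.\<close>

lemma S_add: "S (m + n) = S m * S (n + 1) - S (m - 1) * S n"
proof -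
  define P where "P n \<longleftrightarrow> (\<forall>m. S (m + n) = S m * S (n + 1) - S (m - 1) * S n)" for n
  have "P n \<and> P (n + 1)"
  proof (induction n rule: int_induct[of _ 0])
    case base
    show ?case using S_rec[of 1] S_rec by (auto simp: P_def)
  next
    case (step1 i)
    have "P (i + 2)" unfolding P_def
    proof
      fix m
      have "S (m + (i + 2)) = trc * S (m + (i + 1)) - S (m + i)"
        using S_rec[of "m + (i + 1)"] by (simp add: algebra_simps)
      also have "\<dots> = trc * (S m * S (i + 2) - S (m - 1) * S (i + 1)) - (S m * S (i + 1) - S (m - 1) * S i)"
        using step1 unfolding P_def by (simp add: add.assoc)
      also have "\<dots> = S m * (trc * S (i + 2) - S (i + 1)) - S (m - 1) * (trc * S (i + 1) - S i)"
        by (simp add: algebra_simps)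
      also have "trc * S (i + 2) - S (i + 1) = S (i + 2 + 1)"
        using S_rec[of "i + 2"] by (simp add: algebra_simps)
      also have "trc * S (i + 1) - S i = S (i + 2)"
        using S_rec[of "i + 1"] by (simp add: algebra_simps)
      finally show "S (m + (i + 2)) = S m * S (i + 2 + 1) - S (m - 1) * S (i + 2)" .
    qed
    thus ?case using step1 by (simp add: add.assoc)
  next
    case (step2 i)
    have "P (i - 1)" unfolding P_def
    proof
      fix m
      have "S (m + (i - 1)) = trc * S (m + i) - S (m + (i + 1))"
        using S_rec[of "m + i"] by (simp add: algebra_simps)
      also have "\<dots> = trc * (S m * S (i + 1) - S (m - 1) * S i) - (S m * S (i + 1 + 1) - S (m - 1) * S (i + 1))"
        using step2 unfolding P_def by (simp add: add.assoc)
      also have "\<dots> = S m * S (i - 1 + 1) - S (m - 1) * S (i - 1)"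
      proof -
        have "S (i + 1 + 1) = trc * S (i + 1) - S i" "S (i + 1) = trc * S i - S (i - 1)" "i - 1 + 1 = i"
          using S_rec[of "i + 1"] S_rec[of i] by simp_all
        thus ?thesis by (simp only: right_diff_distrib) (simp add: algebra_simps)
      qed
      finally show "S (m + (i - 1)) = S m * S (i - 1 + 1) - S (m - 1) * S (i - 1)" .
    qed
    thus ?case using step2 by simp
  qed
  thus ?thesis by (simp add: P_def)
qed

lemma S_ints [simp]: "S n \<in> \<O>"
proof -
  have "S n \<in> \<O> \<and> S (n + 1) \<in> \<O>"
  proof (induction n rule: int_induct[of _ 0])
    case (step1 i)
    have "S (i + 1 + 1) = trc * S (i + 1) - S i" using S_rec[of "i + 1"] by simp
    thus ?case using step1 by simp
  next
    case (step2 i)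
    have "S (i - 1) = trc * S i - S (i + 1)" using S_rec[of i] by simp
    thus ?case using step2 by simp
  qed auto
  thus ?thesis ..
qed

text \<open>The addition formula for the indices \<open>n\<close> and \<open>1 - n\<close>, whose
  sum is 1. It expresses that powers of \<open>st\<close> have determinant 1.\<close>

lemma S_norm: "S n ^ 2 - trc * S n * S (n - 1) + S (n - 1) ^ 2 = 1"
proof -
  have "1 = S (n + (1 - n))" by simp
  also have "\<dots> = S n * S (- (n - 2)) - S (n - 1) * S (- (n - 1))"
    by (subst S_add) (simp add: algebra_simps)
  also have "\<dots> = - S n * S (n - 2) + S (n - 1) ^ 2"
    by (simp only: S_minus) (simp add: power2_eq_square)
  also have "S (n - 2) = trc * S (n - 1) - S n" using S_rec[of "n - 1"] by simp
  finally show ?thesis by (simp add: algebra_simps power2_eq_square)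
qed

text \<open>As \<open>st\<close> has determinant 1 and trace \<open>trc\<close>, its n-th power is \<open>S n * st - S (n - 1)\<close> by
  Cayley-Hamilton. This is \<open>rot n\<close>, and \<open>refl n\<close> is \<open>(st)^n s\<close>; so \<open>s = refl 0\<close> and \<open>t = refl (-1)\<close>.\<close>

definition rot :: "int \<Rightarrow> complex ^ 2 ^ 2" where
  "rot n = mat2 (S n + S (n + 1)) (- lam * S n) (S n) (- S n - S (n - 1))"

definition refl :: "int \<Rightarrow> complex ^ 2 ^ 2" where
  "refl n = mat2 (- S n - S (n + 1)) (lam * S (n + 1)) (- S n) (S n + S (n + 1))"

lemma rot_0 [simp]: "rot 0 = mat 1"
  using S_minus[of 1] by (simp add: rot_def mat2_one)

lemma refl_0: "refl 0 = dih_s e" and refl_minus_1: "refl (- 1) = dih_t"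
  using S_minus[of 1] by (simp_all add: refl_def dih_s_def dih_t_def mat2_def)

lemma rot_rot: "rot m ** rot n = rot (m + n)"
proof -
  have 1: "S (m + n) = S m * (trc * S n - S (n - 1)) - S (m - 1) * S n" using S_add[of m n] S_rec[of n] by simp
  have 2: "S (m + n + 1) = (trc * S m - S (m - 1)) * (trc * S n - S (n - 1)) - S m * S n"
    using S_add[of "m + 1" n] S_rec[of m] S_rec[of n] by (simp add: add_ac)
  have 3: "S (m + n - 1) = S m * S n - S (m - 1) * S (n - 1)"
    using S_add[of m "n - 1"] by (simp add: algebra_simps)
  show ?thesis unfolding rot_def mat2_mult mat2_eq_iff 1 2 3 lam_trc S_rec[of m] S_rec[of n]
    by (simp add: algebra_simps)
qed

lemma dih_s_mat2: "dih_s e = mat2 (- 1) lam 0 1"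
  by (simp add: dih_s_def mat2_def)

lemma rot_s: "rot n ** dih_s e = refl n"
  unfolding rot_def refl_def dih_s_mat2 mat2_mult mat2_eq_iff S_rec[of n] lam_trc
  by (simp add: algebra_simps)

lemma s_rot: "dih_s e ** rot n = refl (- n)"
proof -
  have "S (- n) = - S n" "S (- n + 1) = - S (n - 1)" using S_minus[of n] S_minus[of "n - 1"] by simp_all
  thus ?thesis
    unfolding rot_def refl_def dih_s_mat2 mat2_mult mat2_eq_iff S_rec[of n] lam_trc
    by (simp add: algebra_simps)
qed

lemma s_s: "dih_s e ** dih_s e = mat 1"
  by (simp add: dih_s_mat2 mat2_mult mat2_one)

lemma rot_refl: "rot m ** refl n = refl (m + n)"
  by (metis rot_s rot_rot matrix_mul_assoc)

lemma refl_rot: "refl m ** rot n = refl (m - n)"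
  using rot_refl[of m "- n"] by (simp add: rot_s[symmetric, of m] s_rot[symmetric] matrix_mul_assoc[symmetric])

lemma refl_refl: "refl m ** refl n = rot (m - n)"
proof -
  have "refl m ** refl n = refl m ** rot n ** dih_s e" by (metis rot_s matrix_mul_assoc)
  also have "\<dots> = rot (m - n) ** dih_s e ** dih_s e" by (simp only: refl_rot rot_s)
  also have "\<dots> = rot (m - n) ** (dih_s e ** dih_s e)" by (simp only: matrix_mul_assoc)
  finally show ?thesis by (simp add: s_s)
qed

lemma det_rot: "det (rot n) = 1"
  using S_norm[of n] unfolding rot_def det_mat2 S_rec[of n] lam_trc
  by (simp add: algebra_simps power2_eq_square)

lemma det_refl: "det (refl n) = - 1"
  using det_mul[of "rot n" "dih_s e"] by (simp add: rot_s det_rot) (simp add: dih_s_mat2 det_mat2)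

lemma rot_neq_refl: "rot m \<noteq> refl n"
  using det_rot[of m] det_refl[of n] by (metis one_neq_neg_one)

text \<open>The left side is the trace of \<open>rot n\<close>, the right side the sum of its
  eigenvalues.\<close>

lemma S_powi: "S (n + 1) - S (n - 1) = \<zeta> powi n + \<zeta> powi (- n)"
proof -
  have "S (n + 1) - S (n - 1) = (\<zeta> powi n + \<zeta> powi (- n)) * (\<zeta> - inverse \<zeta>) / (\<zeta> - inverse \<zeta>)"
    unfolding S_def
    by (simp add: power_int_add power_int_diff power_int_minus field_simps diff_divide_distrib[symmetric])
  thus ?thesis using zeta_diff by simp
qed

lemma rot_eq_1_iff: "rot n = mat 1 \<longleftrightarrow> int e dvd n"
proof
  assume "int e dvd n"
  hence z: "\<zeta> powi n = 1" by (simp add: zeta_powi_eq_1_iff)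
  hence "S n = 0" by (simp add: S_def power_int_minus)
  moreover have "S (n + 1) = 1" "S (n - 1) = -1"
    using zeta_diff z by (auto simp: S_def power_int_add power_int_diff power_int_minus divide_simps)
  ultimately show "rot n = mat 1" by (simp add: rot_def mat2_one)
next
  assume "rot n = mat 1"
  hence "S n = 0" "S (n + 1) = 1" "- S (n - 1) = 1"
    by (auto simp: rot_def mat2_one mat2_eq_iff)
  hence "\<zeta> powi n + \<zeta> powi (- n) = 2" unfolding S_powi[symmetric] by (simp only: diff_conv_add_uminus) simp
  hence "(\<zeta> powi n - 1) ^ 2 = 0" by (simp add: power_int_minus field_simps power2_eq_square)
  thus "int e dvd n" by (simp add: zeta_powi_eq_1_iff)
qed

text \<open>Determinant 1 and the eigenvalue 1 force trace 2. Then \<open>\<zeta> powi n\<close>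
  plus its inverse is 2, so \<open>\<zeta> powi n\<close> is 1. This separates rotations from
  reflections.\<close>

lemma rot_fix:
  assumes "rot n *v x = x" "x \<noteq> 0"
  shows "rot n = mat 1"
proof -
  let ?a = "S n + S (n + 1)" and ?b = "- lam * S n" and ?c = "S n" and ?d = "- S n - S (n - 1)"
  have "?a * x $ 1 + ?b * x $ 2 = x $ 1" "?c * x $ 1 + ?d * x $ 2 = x $ 2"
    using assms(1) by (metis rot_def mat2_mult_vec vector_2(1), metis rot_def mat2_mult_vec vector_2(2))
  moreover have "x $ 1 \<noteq> 0 \<or> x $ 2 \<noteq> 0" using assms(2) by (auto simp: vec_eq_iff forall_2)
  ultimately have "(?a - 1) * (?d - 1) - ?b * ?c = 0" by (rule vec2_fixed_det)
  moreover have "?a * ?d - ?b * ?c = 1" using det_rot[of n] by (simp add: rot_def det_mat2)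
  ultimately have "?a + ?d = 2" by (simp add: algebra_simps)
  hence "\<zeta> powi n + \<zeta> powi (- n) = 2" using S_powi[of n] by simp
  hence "(\<zeta> powi n - 1) ^ 2 = 0" by (simp add: power_int_minus field_simps power2_eq_square)
  thus ?thesis by (simp add: rot_eq_1_iff zeta_powi_eq_1_iff)
qed

lemma rot_period: "int e dvd m - n \<Longrightarrow> rot m = rot n"
  using rot_rot[of "m - n" n] rot_eq_1_iff[of "m - n"] by simp

lemma refl_period: "int e dvd m - n \<Longrightarrow> refl m = refl n"
  using rot_period[of m n] by (simp add: rot_s[symmetric])

lemma refl_eqD: "refl m = refl n \<Longrightarrow> int e dvd m - n"
  using refl_refl[of m n] refl_refl[of n n] rot_eq_1_iff[of "m - n"] by simp

text \<open>For even e the power of \<open>st\<close> with exponent e / 2 is minus the identity. It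
  acts trivially on roots, which is why the orbits in \<open>dih_roots_s\<close> and
  \<open>dih_roots_t\<close> stop at e / 2.\<close>

lemma rot_half:
  assumes "even e"
  shows "rot (n + int (e div 2)) = mat2 (- 1) 0 0 (- 1) ** rot n"
proof -
  have "\<zeta> powi (int (e div 2)) = - 1" using zeta_half[OF assms] by simp
  hence "\<zeta> powi (m + int (e div 2)) = - (\<zeta> powi m)" "\<zeta> powi (- (m + int (e div 2))) = - (\<zeta> powi (- m))" for m
    by (simp_all only: power_int_minus power_int_add[OF disjI1[OF zeta_nonzero]] inverse_mult_distrib)
      (simp_all add: inverse_minus_eq)
  hence "S (m + int (e div 2)) = - S m" for m
    unfolding S_def by (simp only:) (simp add: diff_divide_distrib)
  from this[of n] this[of "n + 1"] this[of "n - 1"] show ?thesis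
    by (simp add: rot_def mat2_mult mat2_eq_iff algebra_simps)
qed

section \<open>The elements of the dihedral group\<close>

abbreviation G where "G \<equiv> dih_group e"

lemma invertible_rot: "invertible (rot n)" and matrix_inv_rot: "matrix_inv (rot n) = rot (- n)"
  using matrix_inv_eqI[of "rot n" "rot (- n)"] by (auto simp: rot_rot)

lemma invertible_refl: "invertible (refl n)" and matrix_inv_refl: "matrix_inv (refl n) = refl n"
  using matrix_inv_eqI[of "refl n" "refl n"] by (auto simp: refl_refl)

lemma rot_GL: "rot n \<in> carrier (GL K)" and refl_GL: "refl n \<in> carrier (GL K)"
  by (simp_all add: invertible_rot invertible_refl)
    (simp_all add: rot_def refl_def forall_2 K_diff)

lemma group_eq: "G = range rot \<union> range refl"
proof
  show "G \<subseteq> range rot \<union> range refl"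
  proof
    fix g assume "g \<in> G"
    thus "g \<in> range rot \<union> range refl"
      unfolding dih_group_def
    proof (induction rule: generate.induct)
      case one
      show ?case using rot_0 by (metis GL_simps(3) UnI1 rangeI)
    next
      case (incl h)
      thus ?case using refl_0 refl_minus_1 by (metis UnI2 insertE rangeI singletonD)
    next
      case (inv h)
      then obtain n where "h = refl n" using refl_0 refl_minus_1 by (metis insertE singletonD)
      thus ?case using refl_GL[of n] by (simp add: m_inv_GL matrix_inv_refl del: GL_simps(1))
    next
      case (eng h1 h2)
      thus ?case by (auto simp: rot_rot rot_refl refl_rot refl_refl)
    qed
  qed
  have m: "g \<in> G \<Longrightarrow> h \<in> G \<Longrightarrow> g ** h \<in> G" for g h
    using generate.eng[of g "GL K" _ h] by (simp add: dih_group_def)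
  have s: "refl 0 \<in> G" and t: "refl (- 1) \<in> G"
    by (auto simp: dih_group_def refl_0 refl_minus_1 intro: generate.incl)
  have r1: "rot 1 \<in> G" "rot (- 1) \<in> G" using m[OF s t] m[OF t s] by (simp_all add: refl_refl)
  have "rot n \<in> G" for n
  proof (induction n rule: int_induct[of _ 0])
    case base
    show ?case using m[OF s s] by (simp add: refl_refl)
  next
    case (step1 i)
    show ?case using m[OF step1(2) r1(1)] by (simp add: rot_rot)
  next
    case (step2 i)
    show ?case using m[OF step2(2) r1(2)] by (simp add: rot_rot)
  qed
  moreover from this have "refl n \<in> G" for n using m[OF _ s] by (metis rot_refl add_0_right)
  ultimately show "range rot \<union> range refl \<subseteq> G" by auto
qed

lemma G_cases:
  assumes "g \<in> G" obtains n where "g = rot n" | n where "g = refl n"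
  using assms group_eq by auto

lemma rot_G [simp]: "rot n \<in> G" and refl_G [simp]: "refl n \<in> G"
  by (auto simp: group_eq)

lemma G_GL: "g \<in> G \<Longrightarrow> g \<in> carrier (GL K)"
  by (erule G_cases) (metis rot_GL, metis refl_GL)

lemma G_mult: "g \<in> G \<Longrightarrow> h \<in> G \<Longrightarrow> g ** h \<in> G"
  by (auto elim!: G_cases simp: rot_rot rot_refl refl_rot refl_refl)

lemma G_inv: "g \<in> G \<Longrightarrow> matrix_inv g \<in> G"
  by (auto elim!: G_cases simp: matrix_inv_rot matrix_inv_refl)

lemma G_invertible: "g \<in> G \<Longrightarrow> invertible g"
  using G_GL by auto

lemma G_one: "mat 1 \<in> G"
  using rot_G[of 0] by simp

lemma finite_G: "finite G"
proof -
  have "rot n = rot (n mod int e)" "refl n = refl (n mod int e)" for n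
    by (auto intro!: rot_period refl_period simp: minus_mod_eq_mult_div)
  hence "range rot \<subseteq> rot ` {0..<int e}" "range refl \<subseteq> refl ` {0..<int e}"
    using e3 by (auto intro!: image_eqI[of _ _ "_ mod int e"])
  thus ?thesis unfolding group_eq using finite_subset by blast
qed

text \<open>Conjugation by rotations preserves the parity of the index. As indices only count modulo
  e, the reflections form two classes, of s and of t, for even e and a single class for odd
  e.\<close>

lemma refl_conj: "rot k ** refl n ** matrix_inv (rot k) = refl (n + 2 * k)"
  by (simp add: matrix_inv_rot rot_refl refl_rot algebra_simps)

section \<open>The reflections in G\<close>

lemma s_reflection: "dih_s e = reflection_matrix (vec2 1 0) (vec2 2 (- lam))"
  and t_reflection: "dih_t = reflection_matrix (vec2 0 1) (vec2 (- 1) 2)"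
  by (simp_all add: vec_eq_iff forall_2 dih_s_def dih_t_def reflection_matrix_def)

text \<open>A vector orthogonal to \<open>w\<close> is fixed. If the matrix were a rotation, it
  would be the identity by \<open>rot_fix\<close>, yet it maps \<open>v\<close> to
  \<open>- v\<close>.\<close>

lemma reflection_in_G:
  assumes "reflection_matrix v w \<in> G" "pairing v w = 2"
  shows "\<exists>n. reflection_matrix v w = refl n"
proof (rule ccontr)
  assume "\<not> ?thesis"
  then obtain n where n: "reflection_matrix v w = rot n" using assms(1) by (metis G_cases)
  define x where "x = vec2 (w $ 2) (- w $ 1)"
  have "w \<noteq> 0" "v \<noteq> 0" using assms(2) by auto
  hence "x \<noteq> 0" by (auto simp: x_def vec_eq_iff forall_2)
  have "pairing x w = 0" by (simp add: x_def pairing_2)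
  hence "rot n *v x = x" by (simp add: n[symmetric] reflection_matrix_mult_vec)
  hence "reflection_matrix v w = mat 1" using rot_fix \<open>x \<noteq> 0\<close> n by simp
  hence "v = v - 2 *s v" using reflection_matrix_mult_vec[of v w v] assms(2) by simp
  thus False using \<open>v \<noteq> 0\<close> by (simp add: vec_eq_iff)
qed

text \<open>A rotation other than the identity fixes only 0. If that were its hyperplane, the plane
  would be spanned by one vector.\<close>

lemma is_reflection_in_G:
  assumes "g \<in> G" "is_reflection K g"
  shows "\<exists>n. g = refl n"
proof (rule ccontr)
  assume "\<not> ?thesis"
  then obtain n where n: "g = rot n" using assms(1) by (metis G_cases)
  let ?H = "fixed_space K g"
  from assms(2) obtain v where v: "v \<in> vspace K - ?H" "module_span K (*s) (insert v ?H) = vspace K"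
    by (auto simp: is_reflection_def hyperplane_def)
  have "?H \<subseteq> {0}"
  proof
    fix x assume "x \<in> ?H"
    moreover have "g \<noteq> mat 1" using v(1) by (auto simp: fixed_space_def)
    ultimately show "x \<in> {0}" using rot_fix[of n x] n by (auto simp: fixed_space_def)
  qed
  moreover have "0 \<in> line K v" "v \<in> line K v"
    by (auto simp: line_def intro: image_eqI[of _ _ 1] image_eqI[of _ _ 0])
  ultimately have "insert v ?H \<subseteq> line K v" by auto
  moreover have "is_submodule K (*s) (line K v)"
    using is_submodule_module_span[of K "(*s)" "{v}"] by (simp add: module_span_singleton subring_K)
  ultimately have "vspace K \<subseteq> line K v" using module_span_minimal v(2) by metis
  hence "vec2 1 0 \<in> line K v" "vec2 0 1 \<in> line K v" by (auto simp: vspace_def forall_2)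
  then obtain a b where "vec2 1 0 = a *s v" "vec2 0 1 = b *s v" by (auto simp: line_def)
  hence "1 = a * v $ 1" "0 = a * v $ 2" "0 = b * v $ 1" "1 = b * v $ 2"
    by (metis vector_2(1) vector_smult_component, metis vector_2(2) vector_smult_component,
        metis vector_2(1) vector_smult_component, metis vector_2(2) vector_smult_component)
  thus False by (metis mult_eq_0_iff zero_neq_one)
qed

lemma is_reflection_reflection_matrix:
  fixes v w :: "complex ^ 2"
  assumes v: "v \<in> vspace K" and w: "w \<in> vspace K" and p: "pairing v w = 2"
  shows "is_reflection K (reflection_matrix v w)"
proof -
  let ?s = "reflection_matrix v w"
  let ?H = "fixed_space K ?s"
  have "v \<noteq> 0" using p by auto
  have H: "?H = {x :: complex ^ 2. x \<in> vspace K \<and> pairing x w = 0}"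
    using \<open>v \<noteq> 0\<close> by (auto simp: fixed_space_def reflection_matrix_mult_vec)
  have "\<exists>m::nat. m > 0 \<and> ?s [^]\<^bsub>GL K\<^esub> m = \<one>\<^bsub>GL K\<^esub>"
    using reflection_matrix_involution[OF p]
    by (intro exI[of _ 2]) (simp add: numeral_2_eq_2 monoid.nat_pow_Suc group.is_monoid[OF group_GL] nat_pow_def)
  moreover have "hyperplane K ?H"
    unfolding hyperplane_def
  proof (intro conjI exI[of _ v])
    show "?H \<subseteq> vspace K" "v \<in> vspace K - ?H" using v p by (auto simp: H)
    show "is_submodule K (*s) ?H" by (auto simp: H is_submodule_def)
    show "module_span K (*s) (insert v ?H) = vspace K"
    proof
      show "module_span K (*s) (insert v ?H) \<subseteq> vspace K"
        using v by (intro module_span_minimal is_submodule_vspace) (auto simp: H)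
      show "vspace K \<subseteq> module_span K (*s) (insert v ?H)"
      proof
        fix x :: "complex ^ 2" assume x: "x \<in> vspace K"
        let ?c = "pairing x w / 2"
        have cK: "?c \<in> K" using x w by auto
        have "x - ?c *s v \<in> ?H" using x v w p by (auto simp: H)
        hence "(x - ?c *s v) + ?c *s v \<in> module_span K (*s) (insert v ?H)"
          using cK by (intro module_span_add module_span_scale) (auto intro: module_span_inc)
        thus "x \<in> module_span K (*s) (insert v ?H)" by simp
      qed
    qed
  qed
  ultimately show ?thesis using reflection_matrix_GL[OF v w p] by (simp add: is_reflection_def)
qed

text \<open>Two reflections fixing the same nonzero vector differ by a rotation fixing it, hence are
  equal. The stabilizer therefore has order 2, and exp (pi i) = -1 is the determinant.\<close>

lemma distinguished_reflection_G:
  assumes v: "v \<in> vspace K" and w: "w \<in> vspace K" and p: "pairing v w = 2"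
    and G: "reflection_matrix v w \<in> G"
  shows "distinguished_reflection K G (reflection_matrix v w)"
proof -
  obtain n where n: "reflection_matrix v w = refl n" using reflection_in_G[OF G p] by blast
  define x where "x = vec2 (w $ 2) (- w $ 1)"
  have "w \<noteq> 0" using p by auto
  hence "x \<noteq> 0" by (auto simp: x_def vec_eq_iff forall_2)
  have "pairing x w = 0" by (simp add: x_def pairing_2)
  hence x: "refl n *v x = x" by (simp add: n[symmetric] reflection_matrix_mult_vec)
  have "x \<in> vspace K" using w by (auto simp: x_def vspace_def forall_2)
  have "pointwise_stabilizer G (fixed_space K (refl n)) = {mat 1, refl n}"
  proof
    show "{mat 1, refl n} \<subseteq> pointwise_stabilizer G (fixed_space K (refl n))"
      by (auto simp: pointwise_stabilizer_def fixed_space_def G_one)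
    show "pointwise_stabilizer G (fixed_space K (refl n)) \<subseteq> {mat 1, refl n}"
    proof
      fix g assume "g \<in> pointwise_stabilizer G (fixed_space K (refl n))"
      hence g: "g \<in> G" "g *v x = x" using x \<open>x \<in> vspace K\<close>
        by (auto simp: pointwise_stabilizer_def fixed_space_def)
      from g(1) show "g \<in> {mat 1, refl n}"
      proof (cases rule: G_cases)
        case (1 m) thus ?thesis using rot_fix g \<open>x \<noteq> 0\<close> by auto
      next
        case (2 m)
        have "rot (m - n) *v x = x"
          using g 2 x by (simp add: refl_refl[symmetric] matrix_vector_mul_assoc[symmetric])
        hence "int e dvd m - n" using rot_fix \<open>x \<noteq> 0\<close> rot_eq_1_iff by blast
        thus ?thesis using 2 refl_period by simp
      qed
    qed
  qed
  moreover have "mat 1 \<noteq> refl n" using rot_neq_refl[of 0] by simp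
  ultimately have "card (pointwise_stabilizer G (fixed_space K (refl n))) = 2" by simp
  moreover have "exp (2 * complex_of_real pi * \<i> / of_nat 2) = - 1" by simp
  ultimately show ?thesis using is_reflection_reflection_matrix[OF v w p] G det_refl[of n]
    by (simp add: distinguished_reflection_def n)
qed

end

section \<open>The root systems of a pair of ideals\<close>

context dihedral begin

abbreviation dih_inv ("inv'_ideal") where "inv_ideal \<equiv> inverse_ideal (dih_field e)"
abbreviation dih_prin ("prin") where "prin \<equiv> principal_ideal (dih_field e)"
notation ideal_mult (infixl "\<cdot>" 70)

abbreviation e1 :: "complex ^ 2" where "e1 \<equiv> vec2 1 0"
abbreviation e2 :: "complex ^ 2" where "e2 \<equiv> vec2 0 1"
abbreviation w1 :: "complex ^ 2" where "w1 \<equiv> vec2 2 (- lam)"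
abbreviation w2 :: "complex ^ 2" where "w2 \<equiv> vec2 (- 1) 2"

text \<open>Ideal, vector and covector of the roots over s and t; membership lets later lemmas treat
  both at once.\<close>

definition base :: "complex set \<Rightarrow> complex set \<Rightarrow> (complex set \<times> (complex ^ 2) \<times> (complex ^ 2)) set" where
  "base \<aa> \<bb> = {(\<aa>, e1, w1), (\<bb>, e2, w2)}"

definition system :: "complex set \<Rightarrow> complex set \<Rightarrow> 2 zroot set" where
  "system \<aa> \<bb> = {root_act K g (mkroot \<cc> v w) |g \<cc> v w. g \<in> G \<and> (\<cc>, v, w) \<in> base \<aa> \<bb>}"

text \<open>As \<open>pairing e1 w2\<close> is -1 and \<open>pairing e2 w1\<close> is
  \<open>- lam\<close>, the inclusions express integrality of the two mixed pairings between the
  roots over s and t.\<close>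

definition compatible :: "complex set \<Rightarrow> complex set \<Rightarrow> bool" where
  "compatible \<aa> \<bb> \<longleftrightarrow> invertible_ideal \<aa> \<and> invertible_ideal \<bb> \<and> \<aa> \<subseteq> \<bb> \<and> prin lam \<cdot> \<bb> \<subseteq> \<aa>"

definition lattice :: "complex set \<Rightarrow> complex set \<Rightarrow> (complex ^ 2) set" where
  "lattice \<aa> \<bb> = {x. x $ 1 \<in> \<aa> \<and> x $ 2 \<in> \<bb>}"

lemma lam_K [simp]: "lam \<in> K"
  using lam_ints by blast

lemma compatibleD:
  assumes "compatible \<aa> \<bb>"
  shows "frac_ideal \<aa>" "frac_ideal \<bb>" "x \<in> \<aa> \<Longrightarrow> x \<in> \<bb>" "x \<in> \<bb> \<Longrightarrow> lam * x \<in> \<aa>"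
proof -
  show "frac_ideal \<aa>" "frac_ideal \<bb>" "x \<in> \<aa> \<Longrightarrow> x \<in> \<bb>"
    using assms by (auto simp: compatible_def invertible_imp_frac)
  assume "x \<in> \<bb>"
  moreover have "lam \<in> prin lam" by (auto simp: principal_ideal_def intro!: exI[of _ 1])
  ultimately have "lam * x \<in> prin lam \<cdot> \<bb>" using ideal_mult_inc by blast
  thus "lam * x \<in> \<aa>" using assms by (auto simp: compatible_def)
qed

text \<open>All entries of \<open>rot n\<close> and \<open>refl n\<close> are integers, and the
  upper right one is a multiple of \<open>lam\<close>. The two inclusions in
  \<open>compatible\<close> are what such a matrix needs to preserve \<aa> e1 + \<bb> e2.\<close>

lemma G_lattice:
  assumes c: "compatible \<aa> \<bb>" and g: "g \<in> G" and x: "x \<in> lattice \<aa> \<bb>"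
  shows "g *v x \<in> lattice \<aa> \<bb>"
proof -
  note a = frac_idealD[OF compatibleD(1)[OF c]] and b = frac_idealD[OF compatibleD(2)[OF c]]
  have fst: "s * x $ 1 + (lam * t) * x $ 2 \<in> \<aa>" if "s \<in> \<O>" "t \<in> \<O>" for s t
  proof -
    have "t * x $ 2 \<in> \<bb>" using x that b(4) by (simp add: lattice_def)
    hence "lam * (t * x $ 2) \<in> \<aa>" by (rule compatibleD(4)[OF c])
    thus ?thesis using x that a(3,4) by (simp add: lattice_def mult.assoc)
  qed
  have snd: "s * x $ 1 + t * x $ 2 \<in> \<bb>" if "s \<in> \<O>" "t \<in> \<O>" for s t
    using x that b(3,4) compatibleD(3)[OF c] by (simp add: lattice_def)
  from g show ?thesis
  proof (cases rule: G_cases)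
    case (1 n)
    thus ?thesis using fst[of "S n + S (n + 1)" "- S n"] snd[of "S n" "- S n - S (n - 1)"]
      by (simp add: rot_def mat2_mult_vec lattice_def)
  next
    case (2 n)
    thus ?thesis using fst[of "- S n - S (n + 1)" "S (n + 1)"]
        snd[of "- S n" "S n + S (n + 1)"]
      by (simp add: refl_def mat2_mult_vec lattice_def)
  qed
qed

lemma base_lattice:
  "frac_ideal \<aa> \<Longrightarrow> frac_ideal \<bb> \<Longrightarrow> (\<cc>, v, w) \<in> base \<aa> \<bb> \<Longrightarrow> c *s v \<in> lattice \<aa> \<bb> \<longleftrightarrow> c \<in> \<cc>"
  by (auto simp: base_def lattice_def frac_idealD)

lemma base_invertible:
  "compatible \<aa> \<bb> \<Longrightarrow> (\<cc>, v, w) \<in> base \<aa> \<bb> \<Longrightarrow> invertible_ideal \<cc>"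
  by (auto simp: base_def compatible_def)

lemma base_facts:
  assumes "(\<cc>, v, w) \<in> base \<aa> \<bb>"
  shows "v \<in> vspace K" "w \<in> vspace K" "pairing v w = 2" "v \<noteq> 0"
    "\<exists>n. reflection_matrix v w = refl n \<and> n \<in> {0, - 1}"
proof -
  from assms consider "v = e1" "w = w1" | "v = e2" "w = w2" by (auto simp: base_def)
  hence "v \<in> vspace K \<and> w \<in> vspace K \<and> pairing v w = 2 \<and> v \<noteq> 0 \<and>
      (\<exists>n. reflection_matrix v w = refl n \<and> n \<in> {0, - 1})"
  proof cases
    case 1
    moreover have "reflection_matrix e1 w1 = refl 0" by (simp add: refl_0 s_reflection)
    moreover have "e1 \<noteq> 0" by (simp add: vec_eq_iff forall_2)
    ultimately show ?thesis by (auto simp: vspace_def forall_2 pairing_2)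
  next
    case 2
    moreover have "reflection_matrix e2 w2 = refl (- 1)" by (simp add: refl_minus_1 t_reflection)
    moreover have "e2 \<noteq> 0" by (simp add: vec_eq_iff forall_2)
    ultimately show ?thesis by (auto simp: vspace_def forall_2 pairing_2)
  qed
  thus "v \<in> vspace K" "w \<in> vspace K" "pairing v w = 2" "v \<noteq> 0"
    "\<exists>n. reflection_matrix v w = refl n \<and> n \<in> {0, - 1}" by auto
qed

lemma act_facts:
  assumes "g \<in> G" "(\<cc>, v, w) \<in> base \<aa> \<bb>"
  shows "g *v v \<in> vspace K" "dual g *v w \<in> vspace K" "pairing (g *v v) (dual g *v w) = 2"
    "reflection_matrix (g *v v) (dual g *v w) = g ** reflection_matrix v w ** matrix_inv g"
    "reflection_matrix (g *v v) (dual g *v w) \<in> G"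
    "root_act K g (mkroot \<cc>' v w) = mkroot \<cc>' (g *v v) (dual g *v w)"
proof -
  note b = base_facts[OF assms(2)]
  have g: "g \<in> carrier (GL K)" "invertible g" using G_GL[OF assms(1)] G_invertible[OF assms(1)] .
  show "g *v v \<in> vspace K" using g b by (intro mult_vec_vspace) auto
  show "dual g *v w \<in> vspace K" using dual_GL[OF g(1)] b
    by (intro mult_vec_vspace) (simp_all del: transpose_matrix_vector)
  show "pairing (g *v v) (dual g *v w) = 2" using pairing_dual[OF g(2)] b by simp
  show e: "reflection_matrix (g *v v) (dual g *v w) = g ** reflection_matrix v w ** matrix_inv g"
    using reflection_matrix_conj[OF g(2)] .
  show "reflection_matrix (g *v v) (dual g *v w) \<in> G"
    unfolding e using b(5) assms(1) by (auto intro!: G_mult G_inv)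
  show "root_act K g (mkroot \<cc>' v w) = mkroot \<cc>' (g *v v) (dual g *v w)"
    using root_act_mkroot[OF g(1)] .
qed

lemma act_reflection:
  assumes "invertible_ideal \<cc>'" "g \<in> G" "(\<cc>, v, w) \<in> base \<aa> \<bb>"
  shows "root_reflection K (root_act K g (mkroot \<cc>' v w)) = reflection_matrix (g *v v) (dual g *v w)"
  using act_facts[OF assms(2,3)] assms(1) by (simp add: root_reflection_mkroot del: transpose_matrix_vector)

lemma systemE:
  assumes "r \<in> system \<aa> \<bb>"
  obtains g \<cc> v w where "g \<in> G" "(\<cc>, v, w) \<in> base \<aa> \<bb>" "r = root_act K g (mkroot \<cc> v w)"
  using assms unfolding system_def by blast

lemma systemI: "g \<in> G \<Longrightarrow> (\<cc>, v, w) \<in> base \<aa> \<bb> \<Longrightarrow> root_act K g (mkroot \<cc> v w) \<in> system \<aa> \<bb>"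
  unfolding system_def by blast

lemma base_in_system: "(\<cc>, v, w) \<in> base \<aa> \<bb> \<Longrightarrow> mkroot \<cc> v w \<in> system \<aa> \<bb>"
  using systemI[OF G_one] by (simp add: root_act_one)

text \<open>Both \<open>g\<close> and its inverse preserve the lattice, which meets the lines of \<open>v\<close> and \<open>v'\<close> in
  \<open>\<cc> v\<close> and \<open>\<cc>' v'\<close>. This makes \<open>system \<aa> \<bb>\<close> reduced even when s and t are conjugate.\<close>

lemma base_transfer:
  assumes c: "compatible \<aa> \<bb>" and b: "(\<cc>, v, w) \<in> base \<aa> \<bb>" "(\<cc>', v', w') \<in> base \<aa> \<bb>"
    and g: "g \<in> G" "g *v v = \<mu> *s v'" "\<mu> \<noteq> 0"
  shows "prin \<mu> \<cdot> \<cc> = \<cc>'"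
proof -
  note fr = compatibleD(1,2)[OF c]
  note bl = base_lattice[OF fr b(1)] base_lattice[OF fr b(2)]
  have g': "matrix_inv g *v v' = inverse \<mu> *s v"
  proof -
    have "matrix_inv g *v (g *v v) = v"
      using G_invertible[OF g(1)] by (simp add: matrix_vector_mul_assoc matrix_inv_cancel)
    hence "\<mu> *s (matrix_inv g *v v') = v" by (simp add: g(2) vector_scalar_commute)
    thus ?thesis using g(3) by (auto simp: vector_smult_assoc)
  qed
  have "(*) \<mu> ` \<cc> = \<cc>'"
  proof
    show "(*) \<mu> ` \<cc> \<subseteq> \<cc>'"
    proof clarify
      fix x assume "x \<in> \<cc>"
      hence "g *v (x *s v) \<in> lattice \<aa> \<bb>" using bl(1) G_lattice[OF c g(1)] by blast
      hence "(\<mu> * x) *s v' \<in> lattice \<aa> \<bb>" by (simp add: vector_scalar_commute g(2) vector_smult_assoc mult.commute)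
      thus "\<mu> * x \<in> \<cc>'" using bl(2) by blast
    qed
    show "\<cc>' \<subseteq> (*) \<mu> ` \<cc>"
    proof
      fix x assume "x \<in> \<cc>'"
      hence "matrix_inv g *v (x *s v') \<in> lattice \<aa> \<bb>" using bl(2) G_lattice[OF c G_inv[OF g(1)]] by blast
      hence "(x * inverse \<mu>) *s v \<in> lattice \<aa> \<bb>" by (simp add: vector_scalar_commute g' vector_smult_assoc)
      hence "x * inverse \<mu> \<in> \<cc>" using bl(1) by blast
      thus "x \<in> (*) \<mu> ` \<cc>" using g(3) by (intro image_eqI[of _ _ "x * inverse \<mu>"]) auto
    qed
  qed
  thus ?thesis using prin_mult invertible_imp_frac base_invertible[OF c b(1)] by simp
qed

lemma reduced_system_system:
  assumes c: "compatible \<aa> \<bb>"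
  shows "reduced_system K (system \<aa> \<bb>)"
  unfolding reduced_system_def
proof (rule inj_onI)
  fix r r' assume "r \<in> system \<aa> \<bb>" "r' \<in> system \<aa> \<bb>" and eq: "root_reflection K r = root_reflection K r'"
  then obtain g \<cc> v w h \<cc>' v' w' where r: "g \<in> G" "(\<cc>, v, w) \<in> base \<aa> \<bb>" "r = root_act K g (mkroot \<cc> v w)"
    and r': "h \<in> G" "(\<cc>', v', w') \<in> base \<aa> \<bb>" "r' = root_act K h (mkroot \<cc>' v' w')"
    by (metis systemE)
  note f = act_facts[OF r(1,2)] and f' = act_facts[OF r'(1,2)]
  have inv: "invertible_ideal \<cc>" "invertible_ideal \<cc>'" using base_invertible[OF c] r r' by auto
  have "reflection_matrix (g *v v) (dual g *v w) = reflection_matrix (h *v v') (dual h *v w')"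
    using eq unfolding r(3) r'(3) act_reflection[OF inv(1) r(1,2)] act_reflection[OF inv(2) r'(1,2)] .
  from reflection_matrix_eqD[OF this f(3) f'(3)] obtain \<mu> where \<mu>:
    "\<mu> = pairing (g *v v) (dual h *v w') / 2" "\<mu> \<noteq> 0" "g *v v = \<mu> *s (h *v v')"
    "dual g *v w = inverse \<mu> *s (dual h *v w')" by blast
  have \<mu>K: "\<mu> \<in> K" unfolding \<mu>(1) using f(1) f'(2) by (intro K_divide K_pairing) auto
  \<comment> \<open>Equal reflections give proportional vectors. Undoing \<open>h\<close> turns this
    into an element of G between base lines, where the lattice compares the ideals.\<close>
  have "(matrix_inv h ** g) *v v = \<mu> *s v'"
    using \<mu>(3) G_invertible[OF r'(1)]
    by (simp add: matrix_vector_mul_assoc[symmetric] vector_scalar_commute)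
      (simp add: matrix_vector_mul_assoc matrix_inv_cancel)
  hence "prin \<mu> \<cdot> \<cc> = \<cc>'"
    by (rule base_transfer[OF c r(2) r'(2) G_mult[OF G_inv[OF r'(1)] r(1)] _ \<mu>(2)])
  thus "r = r'"
    unfolding r(3) r'(3) f(6) f'(6) \<mu>(3,4) using mkroot_scale[OF inv(1) \<mu>K \<mu>(2)] by simp
qed

lemma root_act_system:
  assumes "h \<in> G"
  shows "root_act K h ` system \<aa> \<bb> = system \<aa> \<bb>"
proof -
  have sub: "root_act K h ` system \<aa> \<bb> \<subseteq> system \<aa> \<bb>" if "h \<in> G" for h
  proof clarify
    fix r assume "r \<in> system \<aa> \<bb>"
    then obtain g \<cc> v w where r: "g \<in> G" "(\<cc>, v, w) \<in> base \<aa> \<bb>" "r = root_act K g (mkroot \<cc> v w)"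
      by (rule systemE)
    hence "root_act K h r = root_act K (h ** g) (mkroot \<cc> v w)"
      using that by (simp add: root_act_mult[OF G_GL G_GL])
    thus "root_act K h r \<in> system \<aa> \<bb>" using r that by (metis systemI G_mult)
  qed
  have "r \<in> root_act K h ` system \<aa> \<bb>" if "r \<in> system \<aa> \<bb>" for r
  proof -
    have "root_act K (h ** matrix_inv h) r = r"
      using G_invertible[OF assms] by (simp add: matrix_inv_cancel root_act_one)
    hence "root_act K h (root_act K (matrix_inv h) r) = r"
      using root_act_mult[OF G_GL[OF assms] G_GL[OF G_inv[OF assms]]] by simp
    thus ?thesis using sub[OF G_inv[OF assms]] that by (metis image_eqI image_subset_iff)
  qed
  with sub[OF assms] show ?thesis by blast
qed

lemma system_reflection_G:
  assumes "compatible \<aa> \<bb>" "r \<in> system \<aa> \<bb>"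
  shows "root_reflection K r \<in> G"
  using assms(2)
proof (rule systemE)
  fix g \<cc> v w assume "g \<in> G" "(\<cc>, v, w) \<in> base \<aa> \<bb>" "r = root_act K g (mkroot \<cc> v w)"
  thus ?thesis using act_reflection base_invertible[OF assms(1)] act_facts(5) by metis
qed

text \<open>Integrality on the whole lattice, not only on the base vectors: as the lattice is
  G-stable, this yields the integrality condition for every pair of roots.\<close>

lemma pairing_lattice:
  assumes c: "compatible \<aa> \<bb>" and b: "(\<cc>, v, w) \<in> base \<aa> \<bb>"
    and y: "y \<in> lattice \<aa> \<bb>" and d: "d \<in> inv_ideal \<cc>"
  shows "pairing y w * d \<in> \<O>"
proof -
  have y1: "y $ 1 \<in> \<aa>" and y2: "y $ 2 \<in> \<bb>" using y by (auto simp: lattice_def)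
  have d': "d * x \<in> \<O>" if "x \<in> \<cc>" for x using d that by (auto simp: inverse_ideal_def)
  from b consider "\<cc> = \<aa>" "w = w1" | "\<cc> = \<bb>" "w = w2" by (auto simp: base_def)
  thus ?thesis
  proof cases
    case 1
    have "pairing y w * d = 2 * (d * y $ 1) - d * (lam * y $ 2)"
      by (simp add: 1 pairing_2 algebra_simps)
    thus ?thesis using d'[of "y $ 1"] d'[of "lam * y $ 2"] y1 y2 compatibleD(4)[OF c] 1 by auto
  next
    case 2
    have "pairing y w * d = 2 * (d * y $ 2) - d * y $ 1"
      by (simp add: 2 pairing_2 algebra_simps)
    thus ?thesis using d'[of "y $ 1"] d'[of "y $ 2"] y1 y2 compatibleD(3)[OF c] 2 by auto
  qed
qed

lemma system_pairing:
  assumes c: "compatible \<aa> \<bb>" and "r \<in> system \<aa> \<bb>" "r' \<in> system \<aa> \<bb>"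
  shows "pairing_ideal K (root_I r) (root_J r') \<subseteq> \<O>"
proof -
  obtain g \<cc> v w h \<cc>' v' w' where r: "g \<in> G" "(\<cc>, v, w) \<in> base \<aa> \<bb>" "r = root_act K g (mkroot \<cc> v w)"
    and r': "h \<in> G" "(\<cc>', v', w') \<in> base \<aa> \<bb>" "r' = root_act K h (mkroot \<cc>' v' w')"
    using assms(2,3) by (metis systemE)
  note f = act_facts[OF r(1,2)] and f' = act_facts[OF r'(1,2)]
  let ?x = "matrix_inv h ** g"
  have x: "?x \<in> G" using r r' by (intro G_mult G_inv)
  have p: "pairing (g *v v) (dual h *v w') = pairing (?x *v v) w'"
    by (metis matrix_vector_mul_assoc pairing_transpose)
  have "\<cc> \<cdot> inv_ideal \<cc>' \<subseteq> {z. z * pairing (?x *v v) w' \<in> \<O>}"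
  proof (rule ideal_mult_subset)
    show "is_submodule \<O> (*) {z. z * pairing (?x *v v) w' \<in> \<O>}"
      using frac_ideal_ints by (intro is_submodule_preimage) (auto simp: frac_ideal_def)
    fix a b assume ab: "a \<in> \<cc>" "b \<in> inv_ideal \<cc>'"
    have "a *s v \<in> lattice \<aa> \<bb>" using base_lattice[OF compatibleD(1,2)[OF c] r(2)] ab by blast
    hence "?x *v (a *s v) \<in> lattice \<aa> \<bb>" by (rule G_lattice[OF c x])
    from pairing_lattice[OF c r'(2) this ab(2)]
    show "a * b \<in> {z. z * pairing (?x *v v) w' \<in> \<O>}"
      by (simp add: vector_scalar_commute mult_ac)
  qed
  thus ?thesis unfolding r(3) r'(3) f(6) f'(6) unfolding mkroot_def zroot.sel pairing_ideal_line p
    by (auto simp: mult.commute)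
qed

lemma root_group_generators:
  assumes "\<And>s. s \<in> A \<Longrightarrow> s \<in> G" "dih_s e \<in> A" "dih_t \<in> A"
  shows "generate (GL K) A = G"
proof
  show "generate (GL K) A \<subseteq> G"
  proof
    fix g assume "g \<in> generate (GL K) A"
    thus "g \<in> G"
    proof (induction rule: generate.induct)
      case one show ?case using G_one by simp
    next
      case (inv h)
      thus ?case using assms(1) m_inv_GL[OF G_GL] G_inv by simp
    qed (use assms(1) G_mult in auto)
  qed
  show "G \<subseteq> generate (GL K) A"
    unfolding dih_group_def using assms by (intro group.mono_generate[OF group_GL]) auto
qed

lemma root_system_system:
  assumes c: "compatible \<aa> \<bb>"
  shows "root_system_for K G (system \<aa> \<bb>)"
  unfolding root_system_for_def root_system_def
proof (intro conjI ballI)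
  have "system \<aa> \<bb> = (\<lambda>(g, \<cc>, v, w). root_act K g (mkroot \<cc> v w)) ` (G \<times> base \<aa> \<bb>)"
    by (force simp: system_def)
  thus "finite (system \<aa> \<bb>)" using finite_G by (simp add: base_def)
  show rt: "is_root K r" if "r \<in> system \<aa> \<bb>" for r
    using that
  proof (rule systemE)
    fix g \<cc> v w assume r: "g \<in> G" "(\<cc>, v, w) \<in> base \<aa> \<bb>" "r = root_act K g (mkroot \<cc> v w)"
    show ?thesis unfolding r(3) act_facts(6)[OF r(1,2)]
      using base_invertible[OF c r(2)] act_facts[OF r(1,2)] by (intro is_root_mkroot)
  qed
  show "module_span K (*s) (\<Union>r\<in>system \<aa> \<bb>. root_I r) = vspace K" (is "?L = _")
  proof
    show "?L \<subseteq> vspace K"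
      using rt unfolding is_root_def rank_one_lattice_def
      by (intro module_span_minimal is_submodule_vspace) blast
    have v: "c *s v \<in> ?L" if "(\<cc>, v, w) \<in> base \<aa> \<bb>" "c \<in> K" for \<cc> c v w
    proof -
      have "line \<cc> v = root_I (mkroot \<cc> v w)" by (simp add: mkroot_def)
      hence "line \<cc> v \<subseteq> (\<Union>r\<in>system \<aa> \<bb>. root_I r)" using base_in_system[OF that(1)] by blast
      hence "module_span K (*s) (line \<cc> v) \<subseteq> ?L" by (rule module_span_mono)
      moreover have "module_span K (*s) (line \<cc> v) = line K v"
        using base_invertible[OF c that(1)]
        by (intro module_span_K_line invertible_imp_frac invertible_nonzero)
      ultimately show ?thesis using that(2) by (auto simp: line_def)
    qed
    show "vspace K \<subseteq> ?L"
    proof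
      fix x :: "complex ^ 2" assume "x \<in> vspace K"
      hence "x $ 1 *s e1 \<in> ?L" "x $ 2 *s e2 \<in> ?L"
        by (auto simp: base_def vspaceD intro!: v)
      moreover have "x = x $ 1 *s e1 + x $ 2 *s e2" by (simp add: vec_eq_iff forall_2)
      ultimately show "x \<in> ?L" using module_span_add by metis
    qed
  qed
  show "root_act K (root_reflection K r) ` system \<aa> \<bb> = system \<aa> \<bb>" if "r \<in> system \<aa> \<bb>" for r
    using root_act_system system_reflection_G[OF c that] by blast
  show "pairing_ideal K (root_I r) (root_J r') \<subseteq> \<O>" if "r \<in> system \<aa> \<bb>" "r' \<in> system \<aa> \<bb>" for r r'
    using system_pairing[OF c that] .
  show "root_group K (system \<aa> \<bb>) = G"
    unfolding root_group_def
  proof (rule root_group_generators)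
    have b: "(\<aa>, e1, w1) \<in> base \<aa> \<bb>" "(\<bb>, e2, w2) \<in> base \<aa> \<bb>" by (auto simp: base_def)
    have "root_reflection K (mkroot \<aa> e1 w1) = dih_s e" "root_reflection K (mkroot \<bb> e2 w2) = dih_t"
      using base_facts[OF b(1)] base_facts[OF b(2)] base_invertible[OF c] b
      by (simp_all add: root_reflection_mkroot s_reflection t_reflection)
    thus "dih_s e \<in> root_reflection K ` system \<aa> \<bb>" "dih_t \<in> root_reflection K ` system \<aa> \<bb>"
      using base_in_system b by (metis image_eqI)+
  qed (use system_reflection_G[OF c] in auto)
qed

text \<open>Even indices are conjugate to that of s, which is 0, and odd ones to that of t, which is
  -1.\<close>

lemma refl_conj_base: "\<exists>k v w \<cc>. (\<cc>, v, w) \<in> base \<aa> \<bb> \<and> refl n = rot k ** reflection_matrix v w ** matrix_inv (rot k)"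
proof (cases "even n")
  case True
  then obtain k where "n = 2 * k" by auto
  hence "refl n = rot k ** dih_s e ** matrix_inv (rot k)" using refl_conj[of k 0] by (simp add: refl_0)
  thus ?thesis unfolding s_reflection by (auto simp: base_def)
next
  case False
  then obtain k where "n = 2 * k + 1" by (auto elim: oddE)
  hence "refl n = rot (k + 1) ** dih_t ** matrix_inv (rot (k + 1))"
    using refl_conj[of "k + 1" "- 1"] by (simp add: refl_minus_1 add.commute)
  thus ?thesis unfolding t_reflection by (auto simp: base_def)
qed

lemma complete_system_system:
  assumes c: "compatible \<aa> \<bb>"
  shows "complete_system K G (system \<aa> \<bb>)"
  unfolding complete_system_def
proof (intro ballI impI)
  fix s assume "s \<in> G" "is_reflection K s"
  then obtain n where "s = refl n" using is_reflection_in_G by blast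
  with refl_conj_base obtain k v w \<cc> where b: "(\<cc>, v, w) \<in> base \<aa> \<bb>"
    and s: "s = rot k ** reflection_matrix v w ** matrix_inv (rot k)" by blast
  have "root_reflection K (root_act K (rot k) (mkroot \<cc> v w)) = s"
    using act_reflection[OF base_invertible[OF c b] rot_G b] act_facts(4)[OF rot_G b] s by metis
  thus "s \<in> root_reflection K ` system \<aa> \<bb>" using systemI[OF rot_G b] by (metis image_eqI)
qed

lemma distinguished_system_system:
  assumes c: "compatible \<aa> \<bb>"
  shows "distinguished_system K G (system \<aa> \<bb>)"
  unfolding distinguished_system_def
proof (intro conjI ballI reduced_system_system[OF c])
  fix r assume "r \<in> system \<aa> \<bb>"
  thus "distinguished_reflection K G (root_reflection K r)"
  proof (rule systemE)
    fix g \<cc> v w assume r: "g \<in> G" "(\<cc>, v, w) \<in> base \<aa> \<bb>" "r = root_act K g (mkroot \<cc> v w)"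
    note f = act_facts[OF r(1,2)]
    show ?thesis unfolding r(3) act_reflection[OF base_invertible[OF c r(2)] r(1,2)]
      using distinguished_reflection_G[OF f(1,2,3,5)] .
  qed
qed

lemma principal_system_system:
  assumes "\<alpha> \<noteq> 0" "\<beta> \<noteq> 0"
  shows "principal_system K (system (prin \<alpha>) (prin \<beta>))"
  unfolding principal_system_def
proof
  fix r assume "r \<in> system (prin \<alpha>) (prin \<beta>)"
  then obtain g \<cc> v w where r: "g \<in> G" "(\<cc>, v, w) \<in> base (prin \<alpha>) (prin \<beta>)"
    "r = root_act K g (mkroot \<cc> v w)" by (rule systemE)
  then obtain \<gamma> where \<gamma>: "\<cc> = prin \<gamma>" "\<gamma> \<noteq> 0" using assms by (auto simp: base_def)
  define u where "u = \<gamma> *s (g *v v)"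
  have "prin \<gamma> = (*) \<gamma> ` \<O>" by (auto simp: principal_ideal_def)
  hence "root_I r = line \<O> u"
    unfolding r(3) act_facts(6)[OF r(1,2)] by (simp add: mkroot_def \<gamma> u_def line_scale)
  also have "\<dots> = module_span \<O> (*s) {u}" by (simp add: module_span_singleton subring_ints)
  finally have I: "root_I r = module_span \<O> (*s) {u}" .
  have "u \<noteq> 0" using act_facts(3)[OF r(1,2)] \<gamma> by (auto simp: u_def vector_mul_eq_0)
  show "principal_root K r"
    unfolding principal_root_def free_module_def
  proof (intro exI[of _ "{u}"] conjI allI impI I)
    fix F :: "(complex ^ 2) set" and c
    assume F: "finite F \<and> F \<subseteq> {u} \<and> (\<forall>b\<in>F. c b \<in> \<O>) \<and> (\<Sum>b\<in>F. c b *s b) = 0"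
    hence "F = {} \<or> F = {u}" by auto
    thus "\<forall>b\<in>F. c b = 0" using F \<open>u \<noteq> 0\<close> by (auto simp: vector_mul_eq_0)
  qed
qed

end

section \<open>Classification of the reduced root systems\<close>

context real_subfield begin

lemma root_reflection_act:
  fixes g :: "complex ^ 'n ^ 'n"
  assumes r: "is_root K r" and g: "g \<in> carrier (GL K)"
  shows "root_reflection K (root_act K g r) = g ** root_reflection K r ** matrix_inv g"
proof -
  from r obtain \<aa> v w where a: "invertible_ideal \<aa>" "v \<in> vspace K" "w \<in> vspace K" "pairing v w = 2"
    "r = mkroot \<aa> v w" by (rule is_rootE)
  have "g *v v \<in> vspace K" "dual g *v w \<in> vspace K"
    using a g dual_GL[OF g] by (auto intro!: mult_vec_vspace simp del: transpose_matrix_vector)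
  moreover have "pairing (g *v v) (dual g *v w) = 2" using pairing_dual[of g v w] g a by simp
  ultimately show ?thesis using g a reflection_matrix_conj[of g v w]
    by (simp add: root_act_mkroot[OF g] root_reflection_mkroot del: transpose_matrix_vector)
qed

text \<open>With \<open>v\<close> and \<open>w\<close> fixed in advance, a root over their
  reflection is determined by its ideal: the scalar between the two presentations is moved into the
  ideal.\<close>

lemma is_root_normal_form:
  assumes r: "is_root K r" and eq: "root_reflection K r = reflection_matrix v w"
    and v: "v \<in> vspace K" "w \<in> vspace K" "pairing v w = 2"
  shows "\<exists>\<aa>. invertible_ideal \<aa> \<and> r = mkroot \<aa> v w"
proof -
  from r obtain \<aa> v' w' where a: "invertible_ideal \<aa>" "v' \<in> vspace K" "w' \<in> vspace K" "pairing v' w' = 2"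
    "r = mkroot \<aa> v' w'" by (rule is_rootE)
  have "reflection_matrix v' w' = reflection_matrix v w"
    using eq a by (simp add: root_reflection_mkroot)
  from reflection_matrix_eqD[OF this a(4) v(3)] obtain \<mu> where
    \<mu>: "\<mu> = pairing v' w / 2" "\<mu> \<noteq> 0" "v' = \<mu> *s v" "w' = inverse \<mu> *s w" by blast
  have "\<mu> \<in> K" using a v by (auto simp: \<mu>(1))
  hence "r = mkroot (prin \<mu> \<cdot> \<aa>) v w" using mkroot_scale[OF a(1) _ \<mu>(2)] a(5) \<mu>(3,4) by simp
  moreover have "invertible_ideal (prin \<mu> \<cdot> \<aa>)"
    using invertible_ideal_mult invertible_prin(1) a(1) \<mu>(2) \<open>\<mu> \<in> K\<close> by blast
  ultimately show ?thesis by blast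
qed

lemma ideal_mult_inv_cancel:
  assumes "invertible_ideal \<bb>" "frac_ideal \<aa>"
  shows "\<aa> \<cdot> inv_ideal \<bb> \<cdot> \<bb> = \<aa>"
proof -
  have "\<aa> \<cdot> inv_ideal \<bb> \<cdot> \<bb> = \<aa> \<cdot> (\<bb> \<cdot> inv_ideal \<bb>)"
    by (simp only: ideal_mult_assoc) (simp only: ideal_mult_commute)
  thus ?thesis using assms by (simp add: invertible_ideal_def ideal_mult_ints)
qed

end

context dihedral begin

text \<open>As the reflections of \<open>R\<close> generate G, the set \<open>R\<close> is G-stable,
  and the indices of its reflections are closed under adding even numbers and e. Once both parities
  occur, there are roots over s and t. Their mixed pairings give compatibility, and since
  \<open>R\<close> is reduced every root is a G-image of one of them.\<close>

lemma reduced_root_system_classification: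
  assumes R: "root_system_for K G R" and red: "reduced_system K R"
  shows "\<exists>\<aa> \<bb>. compatible \<aa> \<bb> \<and> R = system \<aa> \<bb>"
proof -
  have root: "is_root K r" if "r \<in> R" for r
    using R that by (auto simp: root_system_for_def root_system_def)
  have gen: "generate (GL K) (root_reflection K ` R) = G"
    using R by (simp add: root_system_for_def root_group_def)
  have refl: "\<exists>n. root_reflection K r = refl n" if r: "r \<in> R" for r
  proof -
    have "root_reflection K r \<in> G" using r unfolding gen[symmetric] by (intro generate.incl) auto
    moreover obtain \<aa> v w where "invertible_ideal \<aa>" "v \<in> vspace K" "w \<in> vspace K" "pairing v w = 2"
      "r = mkroot \<aa> v w" using is_rootE[OF root[OF r]] by blast
    ultimately show ?thesis using reflection_in_G[of v w] by (simp add: root_reflection_mkroot)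
  qed
  \<comment> \<open>Membership in G is carried through the induction because
    \<open>root_act_mult\<close> applies to elements of the linear group.\<close>
  have stab: "g \<in> G \<and> root_act K g ` R = R" if "g \<in> G" for g
    using that unfolding gen[symmetric]
  proof (induction rule: generate.induct)
    case one
    show ?case using G_one by (simp add: gen root_act_one)
  next
    case (incl h)
    then obtain r where r: "r \<in> R" "h = root_reflection K r" by auto
    have "h \<in> generate (GL K) (root_reflection K ` R)" using incl by (rule generate.incl)
    thus ?case using R r by (auto simp: root_system_for_def root_system_def)
  next
    case (inv h)
    then obtain r where r: "r \<in> R" "h = root_reflection K r" by auto
    then obtain n where n: "h = refl n" using refl by auto
    have "m_inv (GL K) h = h" by (simp only: n m_inv_GL[OF refl_GL] matrix_inv_refl)
    moreover have "h \<in> generate (GL K) (root_reflection K ` R)" using inv by (rule generate.incl)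
    ultimately show ?case using R r by (auto simp: root_system_for_def root_system_def)
  next
    case (eng h1 h2)
    have "h1 \<in> G" "h2 \<in> G" using eng.IH unfolding gen by auto
    hence "root_act K (h1 ** h2) ` R = root_act K h1 ` root_act K h2 ` R"
      using root_act_mult[OF G_GL G_GL] by (simp add: image_image)
    moreover have "h1 ** h2 \<in> generate (GL K) (root_reflection K ` R)"
      using generate.eng[OF eng.hyps] by simp
    ultimately show ?case using eng.IH by simp
  qed
  have act: "root_act K g r \<in> R" if "g \<in> G" "r \<in> R" for g r using stab[OF that(1)] that(2) by blast
  have act_refl: "root_reflection K (root_act K g r) = g ** root_reflection K r ** matrix_inv g"
    if "g \<in> G" "r \<in> R" for g r
    using root_reflection_act[OF root[OF that(2)] G_GL[OF that(1)]] .
  define N where "N n \<longleftrightarrow> (\<exists>r\<in>R. root_reflection K r = refl n)" for n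
  have shift: "N (n + 2 * k)" if "N n" for n k
  proof -
    from that obtain r where r: "r \<in> R" "root_reflection K r = refl n" by (auto simp: N_def)
    have "root_reflection K (root_act K (rot k) r) = refl (n + 2 * k)"
      using act_refl[OF rot_G r(1)] refl_conj by (simp add: r)
    thus ?thesis using act[OF rot_G r(1)] by (auto simp: N_def)
  qed
  have period: "N (n + int e)" if "N n" for n
    using that refl_period[of "n + int e" n] by (simp add: N_def)
  have "R \<noteq> {}"
  proof
    assume "R = {}"
    hence "module_span K (*s) {} = (vspace K :: (complex ^ 2) set)"
      using R by (simp add: root_system_for_def root_system_def)
    moreover have "module_span K (*s) {} \<subseteq> {0 :: complex ^ 2}"
      by (rule module_span_minimal) (auto simp: is_submodule_def)
    moreover have "e1 \<in> vspace K" by (auto simp: vspace_def forall_2)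
    ultimately have "e1 = 0" by auto
    thus False by (simp add: vec_eq_iff forall_2)
  qed
  then obtain n0 where n0: "N n0" using refl unfolding N_def by blast
  \<comment> \<open>Otherwise the reflections of \<open>R\<close> and the even rotations would form a proper subgroup, so
    \<open>R\<close> has a root for a conjugate of s and a root for a conjugate of t.\<close>
  have parity: "\<exists>n. N n \<and> odd (n - p)" for p
  proof (rule ccontr)
    assume "\<not> ?thesis"
    hence ev: "even (n - p)" if "N n" for n using that by blast
    define X where "X = {rot (2 * k) |k. True} \<union> {refl (2 * k + p) |k. True}"
    have X_refl: "h \<in> X \<and> (\<exists>n. h = refl n)" if "h \<in> root_reflection K ` R" for h
    proof -
      from that obtain n where n: "h = refl n" "N n" using refl unfolding N_def by blast
      then obtain k where "n - p = 2 * k" using ev by blast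
      hence "n = 2 * k + p" by simp
      thus ?thesis using n by (auto simp: X_def)
    qed
    have "g \<in> X" if "g \<in> G" for g
      using that unfolding gen[symmetric]
    proof (induction rule: generate.induct)
      case one
      have "\<one>\<^bsub>GL K\<^esub> = rot (2 * 0)" by simp
      thus ?case unfolding X_def by blast
    next
      case (incl h) thus ?case using X_refl by blast
    next
      case (inv h)
      then obtain n where n: "h = refl n" using X_refl by blast
      have "m_inv (GL K) h = h" by (simp only: n m_inv_GL[OF refl_GL] matrix_inv_refl)
      thus ?case using X_refl[OF inv] by simp
    next
      case (eng h1 h2)
      have "rot (2 * k) ** rot (2 * l) \<in> X" "rot (2 * k) ** refl (2 * l + p) \<in> X"
        "refl (2 * k + p) ** rot (2 * l) \<in> X" "refl (2 * k + p) ** refl (2 * l + p) \<in> X" for k l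
      proof -
        have "rot (2 * m) \<in> X" "refl (2 * m + p) \<in> X" for m by (auto simp: X_def)
        from this(1)[of "k + l"] this(2)[of "k + l"] this(2)[of "k - l"] this(1)[of "k - l"]
        show "rot (2 * k) ** rot (2 * l) \<in> X" "rot (2 * k) ** refl (2 * l + p) \<in> X"
          "refl (2 * k + p) ** rot (2 * l) \<in> X" "refl (2 * k + p) ** refl (2 * l + p) \<in> X"
          by (simp_all add: rot_rot rot_refl refl_rot refl_refl algebra_simps)
      qed
      moreover have "(\<exists>k. h1 = rot (2 * k)) \<or> (\<exists>k. h1 = refl (2 * k + p))"
        "(\<exists>k. h2 = rot (2 * k)) \<or> (\<exists>k. h2 = refl (2 * k + p))" using eng.IH by (auto simp: X_def)
      ultimately show ?case by auto
    qed
    from this[OF refl_G[of "p + 1"]] obtain k where "refl (p + 1) = refl (2 * k + p)"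
      unfolding X_def using rot_neq_refl[symmetric] by blast
    hence "int e dvd 1 - 2 * k" using refl_eqD by fastforce
    \<comment> \<open>For even e, \<open>refl (p + 1)\<close> lies outside \<open>X\<close> by
      parity. For odd e, adding e to an index keeps the reflection but changes the parity.\<close>
    have "odd e"
    proof
      assume "even e"
      hence "2 dvd int e" by simp
      hence "2 dvd 1 - 2 * k" using \<open>int e dvd 1 - 2 * k\<close> by (rule dvd_trans)
      thus False by presburger
    qed
    moreover have "even (n0 - p)" "even (n0 + int e - p)" using ev n0 period by blast+
    ultimately show False by simp
  qed
  obtain n where "N n" "odd (n - 1)" using parity by blast
  moreover from this obtain k where "n = 2 * k" using evenE[of n] by auto
  ultimately have "N 0" using shift[of n "- k"] by simp
  then obtain r1 where r1: "r1 \<in> R" "root_reflection K r1 = reflection_matrix e1 w1"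
    unfolding N_def refl_0 s_reflection by blast
  obtain n where "N n" "odd (n - 0)" using parity by blast
  moreover from this obtain k where "n = 2 * k + 1" by (auto elim: oddE)
  ultimately have "N (- 1)" using shift[of n "- k - 1"] by simp
  then obtain r2 where r2: "r2 \<in> R" "root_reflection K r2 = reflection_matrix e2 w2"
    unfolding N_def refl_minus_1 t_reflection by blast
  have ev: "e1 \<in> vspace K" "w1 \<in> vspace K" "pairing e1 w1 = 2" "e2 \<in> vspace K" "w2 \<in> vspace K" "pairing e2 w2 = 2"
    by (auto simp: vspace_def forall_2 pairing_2)
  obtain \<aa> where a: "invertible_ideal \<aa>" "r1 = mkroot \<aa> e1 w1"
    using is_root_normal_form[OF root[OF r1(1)] r1(2) ev(1-3)] by blast
  obtain \<bb> where b: "invertible_ideal \<bb>" "r2 = mkroot \<bb> e2 w2"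
    using is_root_normal_form[OF root[OF r2(1)] r2(2) ev(4-6)] by blast
  have fa: "frac_ideal \<aa>" and fb: "frac_ideal \<bb>" using a b invertible_imp_frac by auto
  have pr: "pairing_ideal K (root_I r) (root_J r') \<subseteq> \<O>" if "r \<in> R" "r' \<in> R" for r r'
    using R that by (auto simp: root_system_for_def root_system_def)
  have "compatible \<aa> \<bb>"
    unfolding compatible_def
  proof (intro conjI a b)
    have "\<aa> \<cdot> inv_ideal \<bb> \<subseteq> \<O>"
    proof
      fix x assume "x \<in> \<aa> \<cdot> inv_ideal \<bb>"
      hence "(- 1) * x \<in> pairing_ideal K (root_I r1) (root_J r2)"
        unfolding a b mkroot_def zroot.sel pairing_ideal_line by (simp add: pairing_2)
      hence "(- 1) * x \<in> \<O>" using pr[OF r1(1) r2(1)] by blast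
      thus "x \<in> \<O>" using ints_closed(5)[of "- x"] by simp
    qed
    hence "\<aa> \<cdot> inv_ideal \<bb> \<cdot> \<bb> \<subseteq> \<O> \<cdot> \<bb>" by (intro ideal_mult_mono) auto
    thus "\<aa> \<subseteq> \<bb>" by (simp add: ideal_mult_inv_cancel b fa ideal_mult_ints fb)
    have "prin lam \<cdot> (\<bb> \<cdot> inv_ideal \<aa>) \<subseteq> \<O>"
    proof
      fix x assume "x \<in> prin lam \<cdot> (\<bb> \<cdot> inv_ideal \<aa>)"
      then obtain y where y: "y \<in> \<bb> \<cdot> inv_ideal \<aa>" "x = lam * y"
        using prin_mult[OF frac_ideal_mult[OF fb frac_ideal_inv]] by auto
      hence "(- lam) * y \<in> pairing_ideal K (root_I r2) (root_J r1)"
        unfolding a b mkroot_def zroot.sel pairing_ideal_line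
        by (intro image_eqI[of _ _ y]) (simp_all add: pairing_2)
      hence "(- lam) * y \<in> \<O>" using pr[OF r2(1) r1(1)] by blast
      thus "x \<in> \<O>" using ints_closed(5)[of "- x"] y by simp
    qed
    hence "prin lam \<cdot> (\<bb> \<cdot> inv_ideal \<aa>) \<cdot> \<aa> \<subseteq> \<O> \<cdot> \<aa>" by (intro ideal_mult_mono) auto
    thus "prin lam \<cdot> \<bb> \<subseteq> \<aa>"
      by (simp add: ideal_mult_inv_cancel a fb ideal_mult_ints fa ideal_mult_assoc[of "prin lam"])
  qed
  moreover have base_R: "mkroot \<cc> v w \<in> R" if "(\<cc>, v, w) \<in> base \<aa> \<bb>" for \<cc> v w
    using that r1 r2 a b by (auto simp: base_def)
  have "R = system \<aa> \<bb>"
  proof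
    show "system \<aa> \<bb> \<subseteq> R" using act base_R by (auto elim!: systemE)
    show "R \<subseteq> system \<aa> \<bb>"
    proof
      fix r assume r: "r \<in> R"
      then obtain n where n: "root_reflection K r = refl n" using refl by blast
      with refl_conj_base obtain k v w \<cc> where c: "(\<cc>, v, w) \<in> base \<aa> \<bb>"
        and s: "root_reflection K r = rot k ** reflection_matrix v w ** matrix_inv (rot k)" by metis
      have "root_reflection K (mkroot \<cc> v w) = reflection_matrix v w"
        using base_facts[OF c] base_invertible[OF \<open>compatible \<aa> \<bb>\<close> c] by (simp add: root_reflection_mkroot)
      hence "root_reflection K (root_act K (rot k) (mkroot \<cc> v w)) = root_reflection K r"
        using act_refl[OF rot_G base_R[OF c]] s by simp
      hence "root_act K (rot k) (mkroot \<cc> v w) = r"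
        using red act[OF rot_G base_R[OF c]] r unfolding reduced_system_def by (auto dest: inj_onD)
      thus "r \<in> system \<aa> \<bb>" using systemI[OF rot_G c] by blast
    qed
  qed
  ultimately show ?thesis by blast
qed

section \<open>Genera\<close>

lemma twist_system:
  assumes c: "nonzero_fractional_ideal K \<cc>" and a: "invertible_ideal \<aa>" and b: "invertible_ideal \<bb>"
  shows "root_twist K \<cc> ` system \<aa> \<bb> = system (\<cc> \<cdot> \<aa>) (\<cc> \<cdot> \<bb>)"
proof -
  have tw: "root_twist K \<cc> (root_act K g (mkroot \<dd> v w)) = root_act K g (mkroot (\<cc> \<cdot> \<dd>) v w)"
    if "g \<in> G" "invertible_ideal \<dd>" for g \<dd> v w
    using root_twist_mkroot[OF c that(2)] by (simp only: root_act_mkroot[OF G_GL[OF that(1)]])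
  have e: "system \<aa>' \<bb>' = (\<lambda>g. root_act K g (mkroot \<aa>' e1 w1)) ` G \<union> (\<lambda>g. root_act K g (mkroot \<bb>' e2 w2)) ` G"
    for \<aa>' \<bb>' by (auto simp: system_def base_def)
  show ?thesis unfolding e image_Un image_image using tw a b by (auto intro!: arg_cong2[of _ _ _ _ "(\<union>)"] image_cong)
qed

lemma genus_system:
  assumes "compatible \<aa> \<bb>"
  shows "genus K G (system \<aa> \<bb>) = {R. root_system_for K G R \<and>
    (\<exists>\<cc>. nonzero_fractional_ideal K \<cc> \<and> R = system (\<cc> \<cdot> \<aa>) (\<cc> \<cdot> \<bb>))}"
proof -
  have "invertible_ideal \<aa>" "invertible_ideal \<bb>" using assms by (auto simp: compatible_def)
  thus ?thesis unfolding genus_def same_genus_def using twist_system by metis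
qed

lemma nonzero_fractional_ints: "nonzero_fractional_ideal K \<O>"
  using invertible_ints by (simp add: invertible_ideal_def)

lemma system_in_genus:
  assumes c: "compatible \<aa> \<bb>"
  shows "system \<aa> \<bb> \<in> genus K G (system \<aa> \<bb>)"
  unfolding genus_system[OF c]
  using root_system_system[OF c] nonzero_fractional_ints compatibleD(1,2)[OF c]
  by (auto intro!: exI[of _ \<O>] simp: ideal_mult_ints)

lemma compatible_mult:
  assumes "compatible \<aa> \<bb>" "invertible_ideal \<dd>"
  shows "compatible (\<dd> \<cdot> \<aa>) (\<dd> \<cdot> \<bb>)"
proof -
  have "prin lam \<cdot> (\<dd> \<cdot> \<bb>) = \<dd> \<cdot> (prin lam \<cdot> \<bb>)" by (metis ideal_mult_assoc ideal_mult_commute)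
  thus ?thesis using assms ideal_mult_mono[OF order.refl, of _ _ \<dd>]
    by (simp add: compatible_def invertible_ideal_mult)
qed

text \<open>Multiplication by \<dd> permutes the nonzero fractional ideals \<cc>, with
  multiplication by the inverse of \<dd> undoing it, so both genera run through the same
  systems.\<close>

lemma genus_system_mult:
  assumes c: "compatible \<aa> \<bb>" and d: "invertible_ideal \<dd>"
  shows "genus K G (system (\<dd> \<cdot> \<aa>) (\<dd> \<cdot> \<bb>)) = genus K G (system \<aa> \<bb>)"
proof -
  have d': "nonzero_fractional_ideal K \<dd>" "nonzero_fractional_ideal K (inv_ideal \<dd>)" "frac_ideal \<dd>"
    using d invertible_inv(1)[OF d] invertible_imp_frac by (auto simp: invertible_ideal_def)
  have "(\<exists>\<cc>. nonzero_fractional_ideal K \<cc> \<and> R = system (\<cc> \<cdot> (\<dd> \<cdot> \<aa>)) (\<cc> \<cdot> (\<dd> \<cdot> \<bb>))) \<longleftrightarrow>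
      (\<exists>\<cc>. nonzero_fractional_ideal K \<cc> \<and> R = system (\<cc> \<cdot> \<aa>) (\<cc> \<cdot> \<bb>))" (is "?L \<longleftrightarrow> ?R") for R
  proof
    assume ?L
    thus ?R using nonzero_fractional_mult[OF _ d'(1)] by (metis ideal_mult_assoc)
  next
    assume ?R
    then obtain \<cc> where \<cc>: "nonzero_fractional_ideal K \<cc>" "R = system (\<cc> \<cdot> \<aa>) (\<cc> \<cdot> \<bb>)" by blast
    have "\<cc> \<cdot> inv_ideal \<dd> \<cdot> (\<dd> \<cdot> \<xx>) = \<cc> \<cdot> \<xx>" for \<xx>
      using ideal_mult_inv_cancel[OF d nonzero_fractional_imp_frac[OF \<cc>(1)]] by (metis ideal_mult_assoc)
    thus ?L using \<cc> nonzero_fractional_mult[OF \<cc>(1) d'(2)] by metis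
  qed
  thus ?thesis unfolding genus_system[OF c] genus_system[OF compatible_mult[OF c d]] by simp
qed

lemma reduced_genera_eq:
  "reduced_genera K G = {genus K G (system \<aa> \<bb>) |\<aa> \<bb>. compatible \<aa> \<bb>}"
proof -
  have "{R. root_system_for K G R \<and> reduced_system K R} = {system \<aa> \<bb> |\<aa> \<bb>. compatible \<aa> \<bb>}"
    (is "?L = ?R")
  proof
    show "?L \<subseteq> ?R" using reduced_root_system_classification by blast
    show "?R \<subseteq> ?L" using root_system_system reduced_system_system by blast
  qed
  hence "reduced_genera K G = genus K G ` {system \<aa> \<bb> |\<aa> \<bb>. compatible \<aa> \<bb>}"
    by (simp only: reduced_genera_def)
  thus ?thesis by blast
qed

lemma compatible_ints: "compatible \<O> \<O>"
  using invertible_ints prin_mult[OF frac_ideal_ints] lam_ints by (auto simp: compatible_def)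

lemma compatible_lam:
  assumes "lam \<noteq> 0"
  shows "compatible (prin lam) \<O>"
  using invertible_ints invertible_prin(1)[OF lam_K assms] lam_ints
    ideal_mult_ints[OF frac_ideal_prin[OF lam_K]]
  by (auto simp: compatible_def principal_ideal_def)

lemma genus_ideal_ints:
  assumes "invertible_ideal \<bb>"
  shows "genus K G (system \<bb> \<bb>) = genus K G (system \<O> \<O>)"
  using genus_system_mult[OF compatible_ints assms] invertible_imp_frac[OF assms] by (simp add: ideal_mult_ints)

text \<open>For a unit \<open>lam\<close> the ideals \<open>lam\<close> \<bb> and \<bb> coincide,
  which squeezes \<aa> to \<bb>.\<close>

lemma reduced_genera_unit:
  assumes "inverse lam \<in> \<O>" "lam \<noteq> 0"
  shows "reduced_genera K G = {genus K G (system \<O> \<O>)}"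
proof -
  have "\<aa> = \<bb>" if c: "compatible \<aa> \<bb>" for \<aa> \<bb>
  proof
    show "\<aa> \<subseteq> \<bb>" using c by (simp add: compatible_def)
    show "\<bb> \<subseteq> \<aa>"
    proof
      fix x assume "x \<in> \<bb>"
      hence "inverse lam * x \<in> \<bb>" using assms frac_idealD(4)[OF compatibleD(2)[OF c]] by blast
      hence "lam * (inverse lam * x) \<in> \<aa>" by (rule compatibleD(4)[OF c])
      thus "x \<in> \<aa>" using assms(2) by (simp add: mult.assoc[symmetric])
    qed
  qed
  moreover have "invertible_ideal \<bb>" if "compatible \<aa> \<bb>" for \<aa> \<bb> using that by (simp add: compatible_def)
  ultimately show ?thesis unfolding reduced_genera_eq using genus_ideal_ints compatible_ints by blast
qed

text \<open>The hypothesis \<open>max\<close> says that \<open>lam\<close> generates a maximal ideal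
  or the unit ideal. Either \<aa> times the inverse of \<bb> lies in that ideal, and then \<aa> =
  \<open>lam\<close> \<bb>, or it contains an element invertible modulo \<open>lam\<close>, which
  forces \<bb> \<subseteq> \<aa>.\<close>

lemma reduced_genera_maximal:
  assumes max: "\<And>x. x \<in> \<O> \<Longrightarrow> x \<notin> prin lam \<Longrightarrow> \<exists>y\<in>\<O>. 1 - x * y \<in> prin lam" and nz: "lam \<noteq> 0"
  shows "reduced_genera K G = {genus K G (system \<O> \<O>), genus K G (system (prin lam) \<O>)}"
proof -
  have cases: "\<aa> = \<bb> \<or> \<aa> = \<bb> \<cdot> prin lam" if c: "compatible \<aa> \<bb>" for \<aa> \<bb>
  proof (cases "\<aa> \<cdot> inv_ideal \<bb> \<subseteq> prin lam")
    case True
    have "\<aa> \<cdot> inv_ideal \<bb> \<cdot> \<bb> \<subseteq> prin lam \<cdot> \<bb>" using True by (intro ideal_mult_mono) auto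
    moreover have "\<aa> \<cdot> inv_ideal \<bb> \<cdot> \<bb> = \<aa>"
      using c compatibleD(1)[OF c] by (intro ideal_mult_inv_cancel) (auto simp: compatible_def)
    ultimately show ?thesis using c by (simp add: compatible_def ideal_mult_commute)
  next
    case False
    have "\<exists>a\<in>\<aa>. \<exists>b\<in>inv_ideal \<bb>. a * b \<notin> prin lam"
    proof (rule ccontr)
      assume "\<not> ?thesis"
      hence "\<aa> \<cdot> inv_ideal \<bb> \<subseteq> prin lam"
        using frac_ideal_prin[OF lam_K] by (intro ideal_mult_subset) (auto simp: frac_ideal_def)
      with False show False ..
    qed
    then obtain a b where ab: "a \<in> \<aa>" "b \<in> inv_ideal \<bb>" "a * b \<notin> prin lam" by blast
    have bO: "b * x \<in> \<O>" if "x \<in> \<bb>" for x using ab(2) that by (auto simp: inverse_ideal_def)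
    have "a * b \<in> \<O>" using bO compatibleD(3)[OF c ab(1)] by (simp add: mult.commute)
    then obtain y where y: "y \<in> \<O>" "1 - a * b * y \<in> prin lam" using max ab(3) by blast
    then obtain z where z: "z \<in> \<O>" "1 - a * b * y = lam * z" by (auto simp: principal_ideal_def)
    have "\<bb> \<subseteq> \<aa>"
    proof
      fix x assume x: "x \<in> \<bb>"
      \<comment> \<open>The first summand lies in \<aa> because b x is integral, the second because
        \<open>lam\<close> \<bb> \<subseteq> \<aa>.\<close>
      have "x = (a * b * y + lam * z) * x" using z(2) by (simp add: algebra_simps)
      also have "\<dots> = (b * x * y) * a + lam * (z * x)" by (simp add: algebra_simps)
      also have "\<dots> \<in> \<aa>"
      proof (rule frac_idealD(3)[OF compatibleD(1)[OF c]])
        show "b * x * y * a \<in> \<aa>"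
          using bO[OF x] y ab(1) by (intro frac_idealD(4)[OF compatibleD(1)[OF c]]) auto
        show "lam * (z * x) \<in> \<aa>"
          using x z by (intro compatibleD(4)[OF c] frac_idealD(4)[OF compatibleD(2)[OF c]])
      qed
      finally show "x \<in> \<aa>" .
    qed
    thus ?thesis using c by (auto simp: compatible_def)
  qed
  show ?thesis
  proof
    show "reduced_genera K G \<subseteq> {genus K G (system \<O> \<O>), genus K G (system (prin lam) \<O>)}"
    proof
      fix X assume "X \<in> reduced_genera K G"
      then obtain \<aa> \<bb> where c: "compatible \<aa> \<bb>" and X: "X = genus K G (system \<aa> \<bb>)"
        unfolding reduced_genera_eq by blast
      have b: "invertible_ideal \<bb>" "frac_ideal \<bb>" using c compatibleD by (auto simp: compatible_def)
      from cases[OF c] show "X \<in> {genus K G (system \<O> \<O>), genus K G (system (prin lam) \<O>)}"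
        using genus_ideal_ints[OF b(1)] genus_system_mult[OF compatible_lam[OF nz] b(1)] X
        by (auto simp: ideal_mult_ints b(2))
    qed
    show "{genus K G (system \<O> \<O>), genus K G (system (prin lam) \<O>)} \<subseteq> reduced_genera K G"
      unfolding reduced_genera_eq using compatible_ints compatible_lam[OF nz] by blast
  qed
qed

text \<open>If the genera agreed, the system would also be given by a pair of equal ideals \<cc>. A
  reduced system determines the ideals over s and t, so \<open>prin lam\<close> = \<cc> = \<O> and
  \<open>lam\<close> would be a unit.\<close>

lemma genera_distinct:
  assumes nz: "lam \<noteq> 0" and nonunit: "inverse lam \<notin> \<O>"
  shows "genus K G (system (prin lam) \<O>) \<noteq> genus K G (system \<O> \<O>)"
proof
  let ?R = "system (prin lam) \<O>"
  note cl = compatible_lam[OF nz]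
  assume "genus K G ?R = genus K G (system \<O> \<O>)"
  hence "?R \<in> genus K G (system \<O> \<O>)" using system_in_genus[OF cl] by simp
  then obtain \<cc> where c: "nonzero_fractional_ideal K \<cc>" "?R = system (\<cc> \<cdot> \<O>) (\<cc> \<cdot> \<O>)"
    unfolding genus_system[OF compatible_ints] by blast
  have fc: "frac_ideal \<cc>" using nonzero_fractional_imp_frac[OF c(1)] .
  have R: "?R = system \<cc> \<cc>" using c(2) by (simp add: ideal_mult_ints fc)
  have eq: "\<cc> = \<dd>" if d: "(\<dd>, v, w) \<in> base (prin lam) \<O>" "(\<cc>, v, w) \<in> base \<cc> \<cc>" for \<dd> v w
  proof -
    have in1: "mkroot \<dd> v w \<in> ?R" using base_in_system[OF d(1)] .
    have in2: "mkroot \<cc> v w \<in> ?R" using base_in_system[OF d(2)] R by simp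
    note f = base_facts[OF d(1)]
    have "is_root K (mkroot \<cc> v w)"
      using root_system_system[OF cl] in2 by (auto simp: root_system_for_def root_system_def)
    \<comment> \<open>The genus only provides a fractional ideal; invertibility follows from the
      roots it occurs in.\<close>
    hence "invertible_ideal \<cc>" using is_root_mkroot_imp_invertible fc f(3) by blast
    hence "root_reflection K (mkroot \<cc> v w) = root_reflection K (mkroot \<dd> v w)"
      using f base_invertible[OF cl d(1)] by (simp add: root_reflection_mkroot)
    hence "mkroot \<cc> v w = mkroot \<dd> v w"
      using reduced_system_system[OF cl] in1 in2 unfolding reduced_system_def by (auto dest: inj_onD)
    thus ?thesis using mkroot_inj f(4) by blast
  qed
  have "\<cc> = prin lam" by (rule eq[of _ e1 w1]) (auto simp: base_def)
  moreover have "\<cc> = \<O>" by (rule eq[of _ e2 w2]) (auto simp: base_def)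
  ultimately have "1 \<in> prin lam" using ints_closed(2) by blast
  then obtain x where "x \<in> \<O>" "1 = lam * x" by (auto simp: principal_ideal_def)
  hence "inverse lam \<in> \<O>" by (metis inverse_unique)
  with nonunit show False ..
qed

section \<open>The explicit root systems\<close>

lemma root_s_eq: "root_s e = mkroot \<O> e1 w1" and root_t_eq: "root_t e = mkroot \<O> e2 w2"
  by (auto simp: root_s_def root_t_def mkroot_def inv_ideal_ints line_def Let_def)

lemma st_power: "(dih_s e ** dih_t) [^]\<^bsub>GL K\<^esub> (n :: nat) = rot (int n)"
proof (induction n)
  case 0
  show ?case using monoid.nat_pow_0[OF group.is_monoid[OF group_GL]] by simp
next
  case (Suc n)
  have "dih_s e ** dih_t = rot 1" by (simp add: refl_0[symmetric] refl_minus_1[symmetric] refl_refl)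
  with Suc show ?case
    by (simp add: monoid.nat_pow_Suc[OF group.is_monoid[OF group_GL]] rot_rot add.commute)
qed

text \<open>Ideals are stable under sign change. Hence a reflection fixes its own root, and for even
  e the central element -1 fixes every root.\<close>

lemma mkroot_neg:
  assumes "invertible_ideal \<aa>"
  shows "mkroot \<aa> ((- 1) *s v) ((- 1) *s w) = mkroot \<aa> v w"
proof -
  have "x = (- 1) * (- x) \<and> - x \<in> \<O>" if "x \<in> \<O>" for x using that by auto
  moreover have "(- 1) * x \<in> \<O>" if "x \<in> \<O>" for x using that by auto
  ultimately have "prin (- 1) = \<O>" unfolding principal_ideal_def by blast
  hence "prin (- 1) \<cdot> \<aa> = \<aa>" using invertible_imp_frac[OF assms] by (simp add: ideal_mult_ints)
  moreover have "inverse (- 1) = (- 1 :: complex)" by simp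
  ultimately show ?thesis using mkroot_scale[OF assms, of "- 1" v w] K_closed(5)[OF K_closed(2)]
    by (metis neg_equal_0_iff_equal zero_neq_one)
qed

lemma reflection_fixes_root:
  assumes "invertible_ideal \<cc>" "(\<dd>, v, w) \<in> base \<aa> \<bb>"
  shows "root_act K (reflection_matrix v w) (mkroot \<cc> v w) = mkroot \<cc> v w"
proof -
  note f = base_facts[OF assms(2)]
  have "matrix_inv (reflection_matrix v w) = reflection_matrix v w"
    using matrix_inv_eqI(1)[OF reflection_matrix_involution[OF f(3)]] .
  hence "dual (reflection_matrix v w) = reflection_matrix w v"
    by (simp add: reflection_matrix_def transpose_def vec_eq_iff mult.commute)
  moreover have "pairing w v = 2" using f(3) by (simp add: pairing_2 mult.commute)
  moreover have "reflection_matrix x y *v x = (- 1) *s x" if "pairing x y = 2" for x y :: "complex ^ 2"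
    by (simp add: reflection_matrix_mult_vec that vec_eq_iff)
  ultimately have "reflection_matrix v w *v v = (- 1) *s v" "dual (reflection_matrix v w) *v w = (- 1) *s w"
    using f(3) by presburger+
  thus ?thesis using mkroot_neg[OF assms(1)]
    by (simp only: root_act_mkroot[OF reflection_matrix_GL[OF f(1-3)]])
qed

lemma rot_neg_period:
  assumes "even e" and that: "invertible_ideal \<aa>"
  shows "root_act K (rot (n + int (e div 2))) (mkroot \<aa> v w) = root_act K (rot n) (mkroot \<aa> v w)"
proof -
  have neg: "rot (m + int (e div 2)) = - rot m" for m
  proof -
    have "mat2 (- 1) 0 0 (- 1) ** A = - A" for A :: "complex ^ 2 ^ 2"
      by (simp add: vec_eq_iff forall_2 matrix_matrix_mult_def sum_2)
    thus ?thesis using rot_half[OF assms(1)] by simp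
  qed
  have "rot (- (n + int (e div 2))) = - rot (- n)"
    using neg[of "- (n + int (e div 2))"] by (simp add: equation_minus_iff)
  hence d: "dual (rot (n + int (e div 2))) = - dual (rot n)"
    by (simp add: matrix_inv_rot transpose_def vec_eq_iff)
  have m: "(- A) *v x = (- 1) *s (A *v x)" for A :: "complex ^ 2 ^ 2" and x
    by (simp add: vec_eq_iff matrix_vector_mult_def sum_negf)
  show ?thesis unfolding root_act_mkroot[OF rot_GL] unfolding d unfolding neg m using mkroot_neg[OF that] .
qed

text \<open>Every reflection in G is a rotation times the reflection of the given root, which fixes
  that root; so rotations already give the whole orbit. They act with period \<open>N\<close>,
  because for even e the power e / 2 of \<open>st\<close> is -1.\<close>

lemma st_orbit_eq:
  assumes c: "invertible_ideal \<cc>" and b: "(\<dd>, v, w) \<in> base \<aa> \<bb>"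
    and N: "N = (if odd e then e else e div 2)"
  shows "st_orbit e (mkroot \<cc> v w) N = (\<lambda>g. root_act K g (mkroot \<cc> v w)) ` G"
proof -
  let ?r = "mkroot \<cc> v w"
  have per: "root_act K (rot (n + int N)) ?r = root_act K (rot n) ?r" for n
    using rot_neg_period[OF _ c] rot_period[of "n + int e" n] by (auto simp: N)
  have per': "root_act K (rot (n + k * int N)) ?r = root_act K (rot n) ?r" for n k
  proof (induction k rule: int_induct[of _ 0])
    case (step1 k)
    thus ?case using per[of "n + k * int N"] by (simp add: algebra_simps)
  next
    case (step2 k)
    thus ?case using per[of "n + (k - 1) * int N"] by (simp add: algebra_simps)
  qed simp
  have "N > 0" using e3 by (auto simp: N)
  have rot_mem: "root_act K (rot n) ?r \<in> st_orbit e ?r N" for n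
  proof -
    have "root_act K (rot n) ?r = root_act K (rot (int (nat (n mod int N)))) ?r"
      using per'[of "n mod int N" "n div int N"] \<open>N > 0\<close> by simp
    moreover have "nat (n mod int N) < N" using \<open>N > 0\<close> by (simp add: nat_less_iff)
    ultimately show ?thesis unfolding st_orbit_def st_power by blast
  qed
  obtain n0 where n0: "reflection_matrix v w = refl n0" using base_facts(5)[OF b] by blast
  have "root_act K (refl n) ?r = root_act K (rot (n - n0)) ?r" for n
  proof -
    have "refl n = rot (n - n0) ** reflection_matrix v w" by (simp add: n0 rot_refl)
    thus ?thesis using reflection_fixes_root[OF c b] root_act_mult[OF rot_GL refl_GL[of n0, folded n0]] by simp
  qed
  with rot_mem have "(\<lambda>g. root_act K g ?r) ` G \<subseteq> st_orbit e ?r N" by (auto elim!: G_cases)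
  moreover have "st_orbit e ?r N \<subseteq> (\<lambda>g. root_act K g ?r) ` G"
    unfolding st_orbit_def st_power using rot_G by blast
  ultimately show ?thesis by blast
qed

lemma system_eq: "system \<aa> \<bb> =
    (\<lambda>g. root_act K g (mkroot \<aa> e1 w1)) ` G \<union> (\<lambda>g. root_act K g (mkroot \<bb> e2 w2)) ` G"
  by (auto simp: system_def base_def)

lemma base_s: "(\<aa>, e1, w1) \<in> base \<aa> \<bb>" and base_t: "(\<bb>, e2, w2) \<in> base \<aa> \<bb>"
  by (auto simp: base_def)

text \<open>For e = 2 k + 1 the k-th power of \<open>st\<close> conjugates s to t. As the system is
  reduced, the equality of reflections yields that this power maps \<open>root_s e\<close> to
  \<open>root_t e\<close>, so the single orbit contains both.\<close>

lemma dih_roots_eq: "dih_roots e = system \<O> \<O>"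
proof (cases "even e")
  case True
  thus ?thesis unfolding dih_roots_def dih_roots_s_def dih_roots_t_def root_s_eq root_t_eq system_eq
    using st_orbit_eq[OF invertible_ints base_s, of "e div 2"] st_orbit_eq[OF invertible_ints base_t, of "e div 2"]
    by simp
next
  case False
  let ?s = "mkroot \<O> e1 w1" and ?t = "mkroot \<O> e2 w2"
  note b = base_s[of \<O> \<O>] base_t[of \<O> \<O>]
  obtain k where k: "e = 2 * k + 1" using False by (auto elim: oddE)
  let ?r = "root_act K (rot (int k)) ?s"
  have "root_reflection K ?r = refl (int (2 * k))"
    using act_reflection[OF invertible_ints rot_G b(1)] act_facts(4)[OF rot_G b(1)] refl_conj[of "int k" 0]
    by (simp add: s_reflection[symmetric] refl_0[symmetric] del: transpose_matrix_vector)
  also have "\<dots> = refl (- 1)" by (rule refl_period) (simp add: k add.commute)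
  also have "\<dots> = root_reflection K ?t"
    using base_facts[OF b(2)] by (simp add: root_reflection_mkroot invertible_ints refl_minus_1 t_reflection)
  finally have rt: "?r = ?t"
    using reduced_system_system[OF compatible_ints] systemI[OF rot_G b(1)] base_in_system[OF b(2)]
    unfolding reduced_system_def by (auto dest: inj_onD)
  have "(\<lambda>g. root_act K g ?t) ` G \<subseteq> (\<lambda>g. root_act K g ?s) ` G"
  proof clarify
    fix g assume g: "g \<in> G"
    have "root_act K g ?t = root_act K (g ** rot (int k)) ?s"
      using root_act_mult[OF G_GL[OF g] rot_GL] rt by simp
    thus "root_act K g ?t \<in> (\<lambda>g. root_act K g ?s) ` G" using G_mult[OF g rot_G] by blast
  qed
  thus ?thesis unfolding dih_roots_def root_s_eq system_eq
    using False st_orbit_eq[OF invertible_ints b(1), of e] by auto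
qed

lemma dih_roots'_eq:
  assumes "even e" "lam \<noteq> 0"
  shows "dih_roots' e = system (prin lam) \<O>"
proof -
  have c: "nonzero_fractional_ideal K (prin lam)"
    using invertible_prin(1)[OF lam_K assms(2)] by (simp add: invertible_ideal_def)
  have tw: "root_twist K (prin lam) (root_act K g (mkroot \<O> e1 w1)) = root_act K g (mkroot (prin lam) e1 w1)"
    if "g \<in> G" for g
    using root_twist_mkroot[OF c invertible_ints] ideal_mult_ints[OF frac_ideal_prin[OF lam_K]]
    by (simp only: root_act_mkroot[OF G_GL[OF that]])
  show ?thesis unfolding dih_roots'_def dih_roots_s_def dih_roots_t_def root_s_eq root_t_eq system_eq
    using assms st_orbit_eq[OF invertible_ints base_s, of "e div 2"] st_orbit_eq[OF invertible_ints base_t, of "e div 2"]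
    by (simp add: image_image tw cong: image_cong)
qed

text \<open>All the lattices \<open>root_I r\<close> lie in the G-stable lattice \<O> e1 + \<O> e2,
  which is the direct sum of those of the two basis roots.\<close>

lemma root_basis_dih: "root_basis K (system \<O> \<O>) {root_s e, root_t e}"
  unfolding root_basis_def
proof (intro conjI allI impI)
  let ?B = "{root_s e, root_t e}" and ?R = "system \<O> \<O>"
  note b = base_s[of \<O> \<O>] base_t[of \<O> \<O>]
  have I: "root_I (root_s e) = line \<O> e1" "root_I (root_t e) = line \<O> e2"
    by (simp_all add: root_s_eq root_t_eq mkroot_def)
  show "finite ?B" by simp
  show BR: "?B \<subseteq> ?R" using base_in_system b by (auto simp: root_s_eq root_t_eq)
  have s: "root_reflection K (root_s e) = dih_s e" "root_reflection K (root_t e) = dih_t"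
    using base_facts[OF b(1)] base_facts[OF b(2)]
    by (simp_all add: root_s_eq root_t_eq root_reflection_mkroot invertible_ints s_reflection t_reflection)
  have "root_group K ?R = G" using root_system_system[OF compatible_ints] by (simp add: root_system_for_def)
  thus "root_group K ?B = root_group K ?R" by (simp add: root_group_def s dih_group_def)
  show "module_span \<O> (*s) (\<Union>r\<in>?R. root_I r) = module_span \<O> (*s) (\<Union>r\<in>?B. root_I r)" (is "?L = ?M")
  proof
    show "?M \<subseteq> ?L" using BR by (intro module_span_mono) auto
    show "?L \<subseteq> ?M"
    proof (intro module_span_minimal is_submodule_module_span subsetI)
      fix x assume "x \<in> (\<Union>r\<in>?R. root_I r)"
      then obtain r where r: "r \<in> ?R" "x \<in> root_I r" by blast
      then obtain g \<cc> v w where g: "g \<in> G" "(\<cc>, v, w) \<in> base \<O> \<O>" "r = root_act K g (mkroot \<cc> v w)"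
        by (metis systemE)
      have "root_I r = (\<lambda>x. g *v x) ` line \<cc> v" by (simp add: g(3) root_act_def mkroot_def)
      then obtain a where a: "a \<in> \<cc>" "x = g *v (a *s v)" using r by (auto simp: line_def)
      hence "x \<in> lattice \<O> \<O>"
        using base_lattice[OF frac_ideal_ints frac_ideal_ints g(2)] G_lattice[OF compatible_ints g(1)] by blast
      hence "x $ 1 *s e1 \<in> line \<O> e1" "x $ 2 *s e2 \<in> line \<O> e2" by (auto simp: lattice_def line_def)
      hence "x $ 1 *s e1 \<in> ?M" "x $ 2 *s e2 \<in> ?M" by (auto simp: I intro!: module_span_inc)
      moreover have "x = x $ 1 *s e1 + x $ 2 *s e2" by (simp add: vec_eq_iff forall_2)
      ultimately show "x \<in> ?M" using module_span_add by metis
    qed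
  qed
  fix x assume x: "(\<forall>r\<in>?B. x r \<in> root_I r) \<and> (\<Sum>r\<in>?B. x r) = 0"
  \<comment> \<open>Distinctness ensures that the sum over the set of the two roots really has two
    terms.\<close>
  have "root_s e \<noteq> root_t e"
  proof
    assume "root_s e = root_t e"
    hence "line \<O> e1 = line \<O> e2" using I by simp
    moreover have "e1 \<in> line \<O> e1" by (auto simp: line_def intro!: image_eqI[of _ _ 1])
    ultimately show False by (auto simp: line_def vec_eq_iff forall_2)
  qed
  hence "x (root_s e) + x (root_t e) = 0" using x by simp
  moreover obtain a c where "x (root_s e) = a *s e1" "x (root_t e) = c *s e2"
    using x I by (auto simp: line_def)
  ultimately have "x (root_s e) = 0" "x (root_t e) = 0" by (auto simp: vec_eq_iff forall_2)
  thus "\<forall>r\<in>?B. x r = 0" by simp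
qed

end

section \<open>Arithmetic of cyclotomic units\<close>

lemma algebraic_int_closed:
  "algebraic_int (x :: complex) \<Longrightarrow> algebraic_int y \<Longrightarrow> algebraic_int (x + y)"
  "algebraic_int (x :: complex) \<Longrightarrow> algebraic_int y \<Longrightarrow> algebraic_int (x * y)"
  "algebraic_int (x :: complex) \<Longrightarrow> algebraic_int (x ^ n)"
  "(\<And>i. i \<in> I \<Longrightarrow> algebraic_int (f i :: complex)) \<Longrightarrow> algebraic_int (sum f I)"
  "(\<And>i. i \<in> I \<Longrightarrow> algebraic_int (f i :: complex)) \<Longrightarrow> algebraic_int (prod f I)"
proof -
  show m: "algebraic_int (x :: complex) \<Longrightarrow> algebraic_int y \<Longrightarrow> algebraic_int (x * y)" for x y
    using algebraic_int_plus_times by blast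
  show "algebraic_int (x :: complex) \<Longrightarrow> algebraic_int y \<Longrightarrow> algebraic_int (x + y)"
    using algebraic_int_plus_times by blast
  show "algebraic_int (x :: complex) \<Longrightarrow> algebraic_int (x ^ n)"
    using subring_power[OF complex_subring_algebraic_int] by auto
  show "(\<And>i. i \<in> I \<Longrightarrow> algebraic_int (f i :: complex)) \<Longrightarrow> algebraic_int (sum f I)"
    using subring_sum[OF complex_subring_algebraic_int] by auto
  show "(\<And>i. i \<in> I \<Longrightarrow> algebraic_int (f i :: complex)) \<Longrightarrow> algebraic_int (prod f I)"
    by (induction I rule: infinite_finite_induct) (auto intro: m int_imp_algebraic_int)
qed

lemma algebraic_int_of_int [simp, intro]: "algebraic_int (of_int n :: complex)"
  and algebraic_int_1 [simp, intro]: "algebraic_int (1 :: complex)"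
  by (auto intro: int_imp_algebraic_int)

lemma one_minus_power_factor:
  assumes "algebraic_int (x :: complex)"
  shows "\<exists>g. algebraic_int g \<and> 1 - x ^ n = (1 - x) * g"
  using assms by (intro exI[of _ "\<Sum>i<n. x ^ i"])
    (auto simp: one_diff_power_eq intro!: algebraic_int_closed)

lemma geometric_sum_zero:
  assumes "(\<eta> :: complex) ^ b = 1" "\<eta> \<noteq> 1"
  shows "(\<Sum>i<b. \<eta> ^ i) = 0"
  using one_diff_power_eq[of \<eta> b] assms by simp

text \<open>The powers of \<eta> below b sum to zero, so b is the sum of the numbers
  \<open>1 - \<eta> ^ i\<close>, all divisible by \<open>1 - \<eta>\<close>.\<close>

lemma one_minus_divides_order:
  assumes "algebraic_int (\<eta> :: complex)" "\<eta> ^ b = 1" "\<eta> \<noteq> 1"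
  shows "\<exists>z. algebraic_int z \<and> of_nat b = (1 - \<eta>) * z"
proof -
  obtain g where g: "\<And>i. algebraic_int (g i) \<and> 1 - \<eta> ^ i = (1 - \<eta>) * g i"
    using one_minus_power_factor[OF assms(1)] by metis
  have "(1 - \<eta>) * (\<Sum>i<b. g i) = (\<Sum>i<b. 1 - \<eta> ^ i)" using g by (simp add: sum_distrib_left)
  also have "\<dots> = of_nat b" using geometric_sum_zero[OF assms(2,3)] by (simp add: sum_subtractf)
  finally show ?thesis using g by (intro exI[of _ "\<Sum>i<b. g i"]) (auto intro!: algebraic_int_closed)
qed

text \<open>The number \<open>1 - \<omega>\<close> divides \<open>1 - \<omega> ^ a\<close>, which divides b; by symmetry it also divides a.\<close>

lemma one_minus_unit:
  assumes "algebraic_int (\<omega> :: complex)" "coprime a b" "\<omega> ^ (a * b) = 1" "\<omega> ^ a \<noteq> 1" "\<omega> ^ b \<noteq> 1"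
  shows "\<exists>z. algebraic_int z \<and> (1 - \<omega>) * z = 1"
proof -
  have div: "\<exists>z. algebraic_int z \<and> of_nat y = (1 - \<omega>) * z" if h: "(\<omega> ^ x) ^ y = 1" "\<omega> ^ x \<noteq> 1" for x y
  proof -
    obtain z where z: "algebraic_int z" "(of_nat y :: complex) = (1 - \<omega> ^ x) * z"
      using one_minus_divides_order[OF algebraic_int_closed(3)[OF assms(1)] h] by metis
    moreover obtain g where "algebraic_int g" "1 - \<omega> ^ x = (1 - \<omega>) * g"
      using one_minus_power_factor[OF assms(1)] by blast
    ultimately have "algebraic_int (g * z) \<and> of_nat y = (1 - \<omega>) * (g * z)"
      by (simp add: mult.assoc algebraic_int_closed(2))
    thus ?thesis ..
  qed
  obtain z where z: "algebraic_int z" "of_nat b = (1 - \<omega>) * z"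
    using div[of a b] assms by (auto simp: power_mult)
  obtain y where y: "algebraic_int y" "of_nat a = (1 - \<omega>) * y"
    using div[of b a] assms by (auto simp: power_mult[symmetric] mult.commute)
  have "coprime (int a) (int b)" using assms(2) by simp
  then obtain u v where "u * int a + v * int b = 1" using bezout_int[of "int a" "int b"] by auto
  hence "1 = of_int u * (of_nat a :: complex) + of_int v * of_nat b"
    by (metis of_int_1 of_int_add of_int_mult of_int_of_nat_eq)
  also have "\<dots> = (1 - \<omega>) * (of_int u * y + of_int v * z)" by (simp add: y z algebra_simps)
  finally show ?thesis using y z by (intro exI[of _ "of_int u * y + of_int v * z"])
      (auto intro!: algebraic_int_closed)
qed

lemma not_algebraic_int_inverse_prime:
  assumes "prime (p :: nat)"
  shows "\<not> algebraic_int (inverse (of_nat p) :: complex)"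
proof
  assume "algebraic_int (inverse (of_nat p) :: complex)"
  moreover have "inverse (of_nat p :: complex) \<in> \<rat>" by simp
  ultimately have "inverse (of_nat p :: complex) \<in> \<int>" using rational_algebraic_int_is_int by blast
  then obtain k where "inverse (of_nat p :: complex) = of_int k" by (auto elim: Ints_cases)
  hence "of_int (k * int p) = (1 :: complex)" using assms prime_gt_0_nat[of p] by (simp add: field_simps)
  hence "k * int p = 1" by (metis of_int_eq_1_iff)
  hence "int p dvd 1" by (metis dvd_triv_right)
  thus False using assms prime_gt_1_nat[of p] by auto
qed

text \<open>The product is the value at 1 of the n-th cyclotomic polynomial, 1 + X^q + ... +
  X^((p-1)q), which has p terms. It equals the product of linear factors because both have the same
  coefficient in degree (p - 1) q, no higher terms, and the same (p - 1) q distinct roots.\<close>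

lemma prime_power_product:
  fixes \<omega> :: complex
  assumes p: "prime (p :: nat)" and n: "n = p * q" and k: "q = p ^ k" and ord: "\<And>j. \<omega> ^ j = 1 \<longleftrightarrow> n dvd j"
  shows "(\<Prod>j\<in>{j \<in> {..<n}. \<not> p dvd j}. 1 - \<omega> ^ j) = of_nat p" "card {j \<in> {..<n}. \<not> p dvd j} = (p - 1) * q"
proof -
  let ?U = "{j \<in> {..<n}. \<not> p dvd j}"
  have p0: "p > 0" and q0: "q > 0" using p prime_gt_0_nat[of p] k by auto
  have "?U = {..<n} - (\<lambda>i. p * i) ` {..<q}" using n p0 by (auto elim!: dvdE)
  moreover have "card ((\<lambda>i. p * i) ` {..<q}) = q" using p0 by (subst card_image) (auto simp: inj_on_def)
  moreover have "(\<lambda>i. p * i) ` {..<q} \<subseteq> {..<n}" using n p0 by auto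
  ultimately have "card ?U = n - q" by (simp add: card_Diff_subset)
  thus cU: "card ?U = (p - 1) * q" by (simp add: n diff_mult_distrib)
  let ?P = "\<Sum>i<p. monom 1 (i * q) :: complex poly"
  let ?Q = "\<Prod>j\<in>?U. [:- (\<omega> ^ j), 1:]"
  have "\<omega> \<noteq> 0" using ord[of n] p0 q0 n by (auto simp: power_0_left)
  have inj: "inj_on (\<lambda>j. \<omega> ^ j) ?U"
  proof (rule inj_onI)
    fix i j assume ij: "i \<in> ?U" "j \<in> ?U" "\<omega> ^ i = \<omega> ^ j"
    have *: "i = j" if "i \<le> j" "j < n" "\<omega> ^ i = \<omega> ^ j" for i j
    proof -
      have "\<omega> ^ j = \<omega> ^ i * \<omega> ^ (j - i)" using that(1) by (simp add: power_add[symmetric])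
      hence "\<omega> ^ (j - i) = 1" using that(3) \<open>\<omega> \<noteq> 0\<close> by simp
      hence "n dvd j - i" using ord by simp
      moreover have "j - i < n" using that by simp
      ultimately show ?thesis using that(1) by (auto dest: dvd_imp_le)
    qed
    have "i < n" "j < n" using ij by auto
    thus "i = j" using *[OF _ _ ij(3)] *[OF _ _ ij(3)[symmetric]] by (metis nat_le_linear)
  qed
  have "?P = ?Q"
  proof (rule poly_eqI_degree_lead_coeff[where n = "(p - 1) * q" and A = "(\<lambda>j. \<omega> ^ j) ` ?U"])
    have cf: "coeff ?P m = (\<Sum>i<p. if i * q = m then 1 else 0)" for m by (simp add: coeff_sum)
    have "coeff ?P ((p - 1) * q) = (\<Sum>i<p. if i = p - 1 then 1 else 0)"
      unfolding cf using q0 by (intro sum.cong) auto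
    also have "\<dots> = 1" using p0 by simp
    finally have c1: "coeff ?P ((p - 1) * q) = 1" .
    have dQ: "degree ?Q = (p - 1) * q" using cU by (simp add: degree_prod_eq_sum_degree)
    moreover have "lead_coeff ?Q = 1" by (simp add: lead_coeff_prod)
    ultimately show "coeff ?P ((p - 1) * q) = coeff ?Q ((p - 1) * q)" using c1 by simp
    show "degree ?Q \<le> (p - 1) * q" using dQ by simp
    show "degree ?P \<le> (p - 1) * q"
      by (intro degree_sum_le order.trans[OF degree_monom_le]) auto
    show "(p - 1) * q \<le> card ((\<lambda>j. \<omega> ^ j) ` ?U)" using cU card_image[OF inj] by simp
    fix z assume "z \<in> (\<lambda>j. \<omega> ^ j) ` ?U"
    then obtain j where j: "j \<in> ?U" "z = \<omega> ^ j" by auto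
    have "poly ?Q z = 0" using j by (auto simp: poly_prod intro!: prod_zero)
    moreover have "poly ?P z = 0"
    proof -
      have "poly ?P z = (\<Sum>i<p. (\<omega> ^ (j * q)) ^ i)"
        by (simp add: poly_sum poly_monom j power_mult[symmetric] mult_ac)
      also have "\<dots> = 0"
      proof (rule geometric_sum_zero)
        show "(\<omega> ^ (j * q)) ^ p = 1" using ord[of "j * q * p"] by (simp add: n power_mult[symmetric] mult_ac)
        show "\<omega> ^ (j * q) \<noteq> 1" using j q0 by (simp add: ord n)
      qed
      finally show ?thesis .
    qed
    ultimately show "poly ?P z = poly ?Q z" by simp
  qed
  hence "poly ?P 1 = poly ?Q 1" by simp
  thus "(\<Prod>j\<in>?U. 1 - \<omega> ^ j) = of_nat p" by (simp add: poly_sum poly_monom poly_prod)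
qed

text \<open>For j prime to p, \<omega> is in turn a power of \<open>\<omega> ^ j\<close>, so
  \<open>1 - \<omega>\<close> and \<open>1 - \<omega> ^ j\<close> divide each other. Thus every
  factor of the product for p is a unit times \<open>1 - \<omega>\<close>.\<close>

lemma prime_power_ramified:
  fixes \<omega> :: complex
  assumes p: "prime (p :: nat)" and n: "n = p * q" and k: "q = p ^ k" and ord: "\<And>j. \<omega> ^ j = 1 \<longleftrightarrow> n dvd j"
  shows "\<exists>u v. algebraic_int u \<and> algebraic_int v \<and> u * v = 1 \<and> of_nat p = u * (1 - \<omega>) ^ ((p - 1) * q)"
proof -
  let ?U = "{j \<in> {..<n}. \<not> p dvd j}"
  have p1: "p > 1" using p prime_gt_1_nat by auto
  have "p * 1 \<le> p * q" using p1 k by (intro mult_le_mono2) simp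
  hence "n > 1" using p1 n by linarith
  have ai: "algebraic_int \<omega>" using ord[of n] \<open>n > 1\<close> by (intro algebraic_int_root_of_unity[of _ n]) auto
  have "\<omega> \<noteq> 1" using ord[of 1] \<open>n > 1\<close> by auto
  have "\<exists>g h. algebraic_int g \<and> algebraic_int h \<and> g * h = 1 \<and> 1 - \<omega> ^ j = (1 - \<omega>) * g" if j: "j \<in> ?U" for j
  proof -
    obtain g where g: "algebraic_int g" "1 - \<omega> ^ j = (1 - \<omega>) * g" using one_minus_power_factor[OF ai] by blast
    have "coprime p j" using p j by (simp add: prime_imp_coprime)
    hence "coprime j n" by (simp add: n k coprime_commute)
    then obtain i where i: "[j * i = 1] (mod n)" using cong_solve_coprime_nat[of j n] by auto
    have "(\<omega> ^ j) ^ i = \<omega>"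
    proof -
      have m: "\<omega> ^ x = \<omega> ^ (x mod n)" for x
      proof -
        have "\<omega> ^ x = \<omega> ^ (n * (x div n)) * \<omega> ^ (x mod n)" by (simp add: power_add[symmetric])
        moreover have "\<omega> ^ (n * (x div n)) = 1" by (simp add: ord)
        ultimately show ?thesis by simp
      qed
      have "(\<omega> ^ j) ^ i = \<omega> ^ (j * i mod n)" using m[of "j * i"] by (simp add: power_mult)
      also have "j * i mod n = 1" using i \<open>n > 1\<close> by (simp add: cong_def)
      finally show ?thesis by simp
    qed
    moreover obtain h where h: "algebraic_int h" "1 - (\<omega> ^ j) ^ i = (1 - \<omega> ^ j) * h"
      using one_minus_power_factor[OF algebraic_int_closed(3)[OF ai]] by blast
    ultimately have "(1 - \<omega>) * (g * h) = (1 - \<omega>) * 1" using g by simp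
    hence "g * h = 1" using \<open>\<omega> \<noteq> 1\<close> by simp
    with g h show ?thesis by blast
  qed
  then obtain g h where gh: "\<And>j. j \<in> ?U \<Longrightarrow> algebraic_int (g j) \<and> algebraic_int (h j) \<and> g j * h j = 1 \<and>
      1 - \<omega> ^ j = (1 - \<omega>) * g j" by metis
  have "of_nat p = (\<Prod>j\<in>?U. 1 - \<omega> ^ j)" using prime_power_product(1)[OF p n k ord] by simp
  also have "\<dots> = (\<Prod>j\<in>?U. (1 - \<omega>) * g j)" using gh by (intro prod.cong) auto
  also have "\<dots> = prod g ?U * (1 - \<omega>) ^ ((p - 1) * q)"
    unfolding prod.distrib prod_constant prime_power_product(2)[OF p n k ord] by (rule mult.commute)
  finally have "of_nat p = prod g ?U * (1 - \<omega>) ^ ((p - 1) * q)" .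
  moreover have "prod g ?U * prod h ?U = 1" using gh by (simp add: prod.distrib[symmetric])
  moreover have "algebraic_int (prod g ?U)" "algebraic_int (prod h ?U)" using gh by (auto intro!: algebraic_int_closed)
  ultimately show ?thesis by blast
qed

section \<open>Rational spans of powers of an algebraic integer\<close>

lemma module_span_Rats_denominator:
  "y \<in> module_span \<rat> (*) S \<Longrightarrow> \<exists>N::nat. N > 0 \<and> of_nat N * y \<in> module_span \<int> (*) S"
proof (induction rule: module_span_induct)
  case (base x)
  thus ?case by (intro exI[of _ 1]) (auto intro: module_span_inc)
next
  case (add x y)
  then obtain M N :: nat where M: "M > 0" "of_nat M * x \<in> module_span \<int> (*) S"
    and N: "N > 0" "of_nat N * y \<in> module_span \<int> (*) S" by blast
  have "of_nat N * (of_nat M * x) + of_nat M * (of_nat N * y) \<in> module_span \<int> (*) S"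
    using module_span_scale[OF _ M(2)] module_span_scale[OF _ N(2)] by (intro module_span_add) auto
  hence "of_nat (M * N) * (x + y) \<in> module_span \<int> (*) S" by (simp add: algebra_simps)
  thus ?case using M N by (intro exI[of _ "M * N"]) auto
next
  case (scale c x)
  then obtain N :: nat where N: "N > 0" "of_nat N * x \<in> module_span \<int> (*) S" by blast
  from scale(1) obtain a b where ab: "b > 0" "c = of_int a / of_int b"
    using Rats_cases' by metis
  hence c: "of_int b * c = of_int a" by simp
  have "of_int a * (of_nat N * x) \<in> module_span \<int> (*) S" by (rule module_span_scale[OF _ N(2)]) simp
  hence "of_nat (nat b * N) * (c * x) \<in> module_span \<int> (*) S"
    using ab(1) by (simp add: c[symmetric] mult_ac)
  thus ?case using N ab(1) by (intro exI[of _ "nat b * N"]) auto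
qed (auto intro: module_span_zero)

lemma powers_span_subring:
  assumes d: "d > 0" and xd: "x ^ d \<in> module_span \<rat> (*) ((\<lambda>i. x ^ i) ` {..<d})"
  shows "complex_subring (module_span \<rat> (*) ((\<lambda>i. x ^ i) ` {..<d}))" (is "complex_subring ?L")
    and "\<rat> \<subseteq> module_span \<rat> (*) ((\<lambda>i. x ^ i) ` {..<d})"
    and "x \<in> module_span \<rat> (*) ((\<lambda>i. x ^ i) ` {..<d})"
proof -
  have pw: "x ^ i \<in> ?L" if "i \<le> d" for i
    using that xd by (cases "i = d") (auto intro!: module_span_inc)
  have x: "x * y \<in> ?L" if "y \<in> ?L" for y
    using that
  proof (induction rule: module_span_induct)
    case (base y)
    then obtain i where "i < d" "y = x ^ i" by auto
    thus ?case using pw[of "Suc i"] by simp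
  next
    case (scale c y)
    thus ?case using module_span_scale[of c \<rat> "x * y" "(*)"] by (simp add: mult.left_commute)
  qed (auto simp: distrib_left intro: module_span_zero module_span_add)
  have xi: "x ^ i * y \<in> ?L" if "y \<in> ?L" for i y
    using that by (induction i) (auto simp: mult.assoc intro: x)
  have mult: "z * y \<in> ?L" if z: "z \<in> ?L" and y: "y \<in> ?L" for z y
    using z
  proof (induction rule: module_span_induct)
    case (scale c z)
    thus ?case using module_span_scale[of c \<rat> "z * y" "(*)"] by (simp add: mult.assoc)
  qed (auto simp: xi y distrib_right intro: module_span_zero module_span_add)
  have one: "1 \<in> ?L" using pw[of 0] by simp
  show "\<rat> \<subseteq> ?L" using module_span_scale[OF _ one] by auto
  show "x \<in> ?L" using x[OF one] by simp
  have "- y \<in> ?L" if "y \<in> ?L" for y using module_span_scale[of "- 1" \<rat> y "(*)"] that by simp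
  with mult one show "complex_subring ?L"
    by (auto simp: complex_subring_def intro: module_span_zero module_span_add)
qed

text \<open>A suitable multiple N y is an algebraic integer, so its inverse is a rational polynomial
  in N y and stays in the span.\<close>

lemma powers_span_subfield:
  assumes ai: "algebraic_int x" and d: "d > 0" and xd: "x ^ d \<in> module_span \<rat> (*) ((\<lambda>i. x ^ i) ` {..<d})"
  shows "complex_subfield (module_span \<rat> (*) ((\<lambda>i. x ^ i) ` {..<d}))" (is "complex_subfield ?L")
proof -
  note L = powers_span_subring[OF d xd]
  have "inverse y \<in> ?L" if y: "y \<in> ?L" "y \<noteq> 0" for y
  proof -
    obtain N :: nat where N: "N > 0" "of_nat N * y \<in> module_span \<int> (*) ((\<lambda>i. x ^ i) ` {..<d})"
      using module_span_Rats_denominator[OF y(1)] by blast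
    have "module_span \<int> (*) ((\<lambda>i. x ^ i) ` {..<d}) \<subseteq> {z. algebraic_int z}"
      using ai by (intro module_span_minimal)
        (auto simp: is_submodule_def intro: algebraic_int_closed int_imp_algebraic_int)
    with N y obtain r where r: "\<forall>i. coeff r i \<in> \<rat>" "of_nat N * y * poly r (of_nat N * y) = 1"
      using algebraic_inverse_polynomial[of "of_nat N * y"] by auto
    have Ny: "of_nat N * y \<in> ?L" using y(1) by (intro module_span_scale) auto
    have "poly r (of_nat N * y) \<in> ?L"
      unfolding poly_altdef
    proof (intro subring_sum[OF L(1)])
      fix i
      show "coeff r i * (of_nat N * y) ^ i \<in> ?L"
        using r(1) subring_power[OF L(1) Ny] by (intro module_span_scale) auto
    qed
    hence "of_nat N * poly r (of_nat N * y) \<in> ?L" by (intro module_span_scale) auto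
    moreover have "inverse y = of_nat N * poly r (of_nat N * y)"
      using r(2) by (intro inverse_unique) (simp add: mult_ac)
    ultimately show ?thesis by simp
  qed
  moreover have "inverse 0 \<in> ?L" by (simp add: module_span_zero)
  ultimately have "inverse y \<in> ?L" if "y \<in> ?L" for y using that by (cases "y = 0") auto
  with L(1) show ?thesis by (auto simp: complex_subring_def complex_subfield_def)
qed

context dihedral begin

section \<open>Factorization of \<open>lam\<close> and the case where it is a unit\<close>

lemma ints_algebraic: "x \<in> \<O> \<Longrightarrow> algebraic_int x"
  unfolding ring_of_integers_def by blast

abbreviation omega ("\<omega>") where "\<omega> \<equiv> - \<zeta>"

lemma algebraic_int_omega: "algebraic_int \<omega>" "algebraic_int (inverse \<omega>)"
proof -
  have z: "\<zeta> ^ e = 1" by (simp add: zeta_power_eq_1_iff)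
  hence z': "(inverse \<zeta>) ^ e = 1" by (simp only: power_inverse inverse_1)
  have "0 < e" using e3 by simp
  from algebraic_int_root_of_unity[OF z this] algebraic_int_root_of_unity[OF z' this]
  show "algebraic_int \<omega>" "algebraic_int (inverse \<omega>)" by (simp_all add: inverse_minus_eq)
qed

text \<open>The first form makes \<open>lam\<close> a unit as soon as both factors are. The second
  makes \<open>lam ^ d\<close> a root of unity times
  \<open>(1 - \<omega>) ^ (2 * d)\<close>.\<close>

lemma lam_factor: "lam = (1 - \<omega>) * (1 - inverse \<omega>)" and lam_square: "lam = - inverse \<omega> * (1 - \<omega>) ^ 2"
proof -
  have "\<zeta> * inverse \<zeta> = 1" by simp
  moreover have e: "inverse \<omega> = - inverse \<zeta>" by (rule inverse_minus_eq)
  ultimately show "lam = (1 - \<omega>) * (1 - inverse \<omega>)" "lam = - inverse \<omega> * (1 - \<omega>) ^ 2"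
    unfolding dih_lambda_def e by (simp_all add: algebra_simps power2_eq_square)
qed

lemma omega_neq_1: "\<omega> \<noteq> 1"
proof
  assume "\<omega> = 1"
  hence "\<zeta> ^ 2 = 1" by (metis power2_minus power_one)
  thus False using zeta_sq by blast
qed

lemma lam_nonzero: "lam \<noteq> 0"
proof -
  have "1 - \<omega> \<noteq> 0" "- inverse \<omega> \<noteq> 0" using omega_neq_1 by (simp_all only: right_minus_eq) auto
  thus ?thesis unfolding lam_square by (metis mult_eq_0_iff power_eq_0_iff)
qed

lemma lam_unit_if:
  assumes "coprime a b" "\<omega> ^ (a * b) = 1" "\<omega> ^ a \<noteq> 1" "\<omega> ^ b \<noteq> 1"
  shows "inverse lam \<in> \<O>"
proof -
  obtain z where z: "algebraic_int z" "(1 - \<omega>) * z = 1"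
    using one_minus_unit[OF algebraic_int_omega(1) assms] by blast
  have "inverse \<omega> ^ (a * b) = 1" "inverse \<omega> ^ a \<noteq> 1" "inverse \<omega> ^ b \<noteq> 1"
    using assms(2-) by (simp_all only: power_inverse inverse_eq_1_iff not_False_eq_True)
  then obtain y where y: "algebraic_int y" "(1 - inverse \<omega>) * y = 1"
    using one_minus_unit[OF algebraic_int_omega(2) assms(1)] by blast
  have "lam * (z * y) = ((1 - \<omega>) * z) * ((1 - inverse \<omega>) * y)" unfolding lam_factor by (simp only: mult_ac)
  hence "lam * (z * y) = 1" unfolding z(2) y(2) by simp
  hence "inverse lam = z * y" by (rule inverse_unique)
  moreover have "inverse lam \<in> K" using lam_ints by (intro K_closed(6) ints_in_K)
  ultimately show ?thesis using algebraic_int_closed(2)[OF z(1) y(1)] unfolding ring_of_integers_def by simp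
qed

lemma omega_power: "\<omega> ^ n = 1 \<Longrightarrow> e dvd 2 * n"
  by (metis mult.commute power2_minus power_mult power_one zeta_power_eq_1_iff)

lemma omega_power_odd: "odd n \<Longrightarrow> \<omega> ^ n = - (\<zeta> ^ n)"
  by simp

text \<open>An exponent annihilating \<omega> is split into coprime factors that do not: 2 and e for
  odd e; for e = 2 m, a prime power and the cofactor c, whose product is m for odd m and e for even
  m. The excluded values of e are those with c = 1.\<close>

lemma lam_unit:
  assumes not_pp: "\<not> (\<exists>p l :: nat. prime p \<and> l \<ge> 1 \<and> e = 2 * p ^ l)"
  shows "inverse lam \<in> \<O>"
proof (cases "even e")
  case False
  have "\<zeta> ^ e = 1" by (simp add: zeta_power_eq_1_iff)
  hence "\<omega> ^ e = - 1" using omega_power_odd[OF False] by simp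
  thus ?thesis using zeta_sq False by (intro lam_unit_if[of 2 e]) (auto simp: power_mult mult.commute[of 2] power2_eq_square)
next
  case True
  then obtain m where m: "e = 2 * m" by auto
  have zm: "\<zeta> ^ m = - 1" using zeta_half[OF True] m by simp
  have m2: "m \<ge> 2" using e3 m by auto
  have ndvd: "\<not> e dvd j" if "0 < j" "j < e" for j using that by (auto dest: dvd_imp_le)
  show ?thesis
  proof (cases "even m")
    case False
    obtain p where p: "prime p" "p dvd m" using m2 prime_factor_nat[of m] by auto
    obtain k c where c: "\<not> p dvd c" "m = c * p ^ k" using prime_power_canonical[of p m] p m2 by auto
    have k: "k \<ge> 1" using c p by (cases k) auto
    have "c \<noteq> 1" using not_pp p(1) k m c(2) by (metis mult_1)
    moreover have "c > 0" using c by (auto intro: gr0I)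
    ultimately have c2: "c \<ge> 2" by simp
    have "p ^ 1 \<le> p ^ k" using k p prime_gt_0_nat by (intro power_increasing) (auto simp: Suc_leI)
    hence pk: "p ^ k \<ge> 2" using prime_ge_2_nat[OF p(1)] by simp
    have lt: "p ^ k < m" "c < m" using c c2 pk prime_gt_0_nat[OF p(1)] by auto
    \<comment> \<open>From \<omega> ^ j = 1 only the divisibility of 2 j by e is known, which is
      still impossible for 0 < j < m.\<close>
    have nd: "\<not> e dvd 2 * j" if "0 < j" "j < m" for j using ndvd[of "2 * j"] that m by auto
    show ?thesis
    proof (rule lam_unit_if[of "p ^ k" c])
      show "coprime (p ^ k) c" using c(1) p(1) by (simp add: prime_imp_coprime)
      have "\<omega> ^ m = 1" using omega_power_odd[OF False] zm by simp
      thus "\<omega> ^ (p ^ k * c) = 1" using c(2) by (simp only: mult.commute)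
      have "0 < p ^ k" "0 < c" using pk c2 by linarith+
      thus "\<omega> ^ p ^ k \<noteq> 1" "\<omega> ^ c \<noteq> 1"
        using nd lt omega_power[of "p ^ k"] omega_power[of c] by metis+
    qed
  next
    case True
    obtain k c where c: "\<not> 2 dvd c" "m = c * 2 ^ k" using prime_power_canonical[of 2 m] m2 by auto
    have k: "k \<ge> 1" using c True by (cases k) auto
    have "c \<noteq> 1" using not_pp k m c two_is_prime_nat by (metis mult_1)
    moreover have "c > 0" using c by (auto intro: gr0I)
    ultimately have c2: "c \<ge> 2" by simp
    have e: "e = 2 ^ Suc k * c" using m c by simp
    show ?thesis
    proof (rule lam_unit_if[of "2 ^ Suc k" c])
      show "coprime (2 ^ Suc k) c" using c(1) by simp
      have "\<omega> ^ e = 1" using \<open>even e\<close> by (simp add: zeta_power_eq_1_iff)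
      thus "\<omega> ^ (2 ^ Suc k * c) = 1" unfolding e[symmetric] .
      have "(2::nat) ^ Suc k * 1 < 2 ^ Suc k * c" using c2 by (intro mult_strict_left_mono) auto
      hence "2 ^ Suc k < e" unfolding e[symmetric] by simp
      hence "\<zeta> ^ 2 ^ Suc k \<noteq> 1" using ndvd zeta_power_eq_1_iff by (metis zero_less_numeral zero_less_power)
      thus "\<omega> ^ 2 ^ Suc k \<noteq> 1" by simp
      show "\<omega> ^ c \<noteq> 1"
      proof
        assume "\<omega> ^ c = 1"
        hence "m dvd c" using omega_power[of c] m by simp
        thus False using True c(1) by (meson dvd_trans)
      qed
    qed
  qed
qed

text \<open>For odd p the sign halves the order of \<zeta> to p^l. For p = 2, \<omega> is an odd
  power of \<zeta> and keeps the order 2^(l+1). Evenness of (p - 1) q provides the exponent d = (p -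
  1) q / 2 used for \<open>lam\<close>.\<close>

lemma omega_order:
  assumes p: "prime (p :: nat)" and l: "l \<ge> 1" and e: "e = 2 * p ^ l"
  shows "\<exists>q k. q = p ^ k \<and> even ((p - 1) * q) \<and> (\<forall>j. \<omega> ^ j = 1 \<longleftrightarrow> p * q dvd j)"
proof (cases "p = 2")
  case False
  hence "odd p" using p primes_dvd_imp_eq two_is_prime_nat by blast
  obtain k where k: "l = Suc k" using l by (cases l) auto
  have m: "e div 2 = p ^ l" "even e" using e by auto
  have "\<zeta> ^ (p ^ l) = - 1" using zeta_half m by simp
  moreover have "odd (p ^ l)" using \<open>odd p\<close> by simp
  ultimately have w: "\<omega> ^ (p ^ l) = 1" using omega_power_odd by simp
  have "\<omega> ^ j = 1 \<longleftrightarrow> p ^ l dvd j" for j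
  proof
    assume "\<omega> ^ j = 1"
    thus "p ^ l dvd j" using omega_power[of j] e by simp
  next
    assume "p ^ l dvd j"
    then obtain i where "j = p ^ l * i" by auto
    thus "\<omega> ^ j = 1" using w by (simp only: power_mult power_one)
  qed
  thus ?thesis using \<open>odd p\<close> k by (intro exI[of _ "p ^ k"] exI[of _ k]) auto
next
  case True
  have zm: "\<zeta> ^ (2 ^ l) = - 1" using zeta_half e True by simp
  have "\<omega> ^ j = 1 \<longleftrightarrow> 2 * 2 ^ l dvd j" for j
  proof -
    have "\<omega> = \<zeta> ^ (2 ^ l + 1)" using zm by (simp add: power_add)
    hence "\<omega> ^ j = \<zeta> ^ ((2 ^ l + 1) * j)" by (simp only: power_mult)
    hence "\<omega> ^ j = 1 \<longleftrightarrow> e dvd (2 ^ l + 1) * j" by (simp only: zeta_power_eq_1_iff)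
    hence "\<omega> ^ j = 1 \<longleftrightarrow> 2 ^ Suc l dvd (2 ^ l + 1) * j" unfolding e True power_Suc .
    also have "\<dots> \<longleftrightarrow> 2 ^ Suc l dvd j"
    proof (rule coprime_dvd_mult_right_iff)
      have "odd ((2::nat) ^ l + 1)" using l by simp
      thus "coprime (2 ^ Suc l) ((2::nat) ^ l + 1)" by simp
    qed
    finally show ?thesis by simp
  qed
  thus ?thesis using True l by (intro exI[of _ "2 ^ l"] exI[of _ l]) auto
qed

section \<open>Traces of powers of \<open>\<omega>\<close> as polynomials in
  \<open>lam\<close>\<close>

definition T :: "nat \<Rightarrow> complex" where
  "T j = \<omega> ^ j + inverse \<omega> ^ j"

abbreviation V :: "nat \<Rightarrow> complex set" where
  "V j \<equiv> module_span \<rat> (*) ((\<lambda>i. lam ^ i) ` {..<j})"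

lemma V_mono: "i \<le> j \<Longrightarrow> V i \<subseteq> V j"
  by (intro module_span_mono) auto

lemma V_diff: "x \<in> V j \<Longrightarrow> y \<in> V j \<Longrightarrow> x - y \<in> V j"
  by (rule is_submodule_diff[OF complex_subring_Rats is_submodule_module_span])

lemma V_lam: "x \<in> V j \<Longrightarrow> lam * x \<in> V (Suc j)"
proof -
  assume "x \<in> V j"
  hence "x * lam \<in> module_span \<rat> (*) ((\<lambda>s. s * lam) ` (\<lambda>i. lam ^ i) ` {..<j})"
    by (rule module_span_mult_right)
  also have "\<dots> \<subseteq> V (Suc j)"
  proof (rule module_span_mono, clarify)
    fix i assume "i < j"
    thus "lam ^ i * lam \<in> (\<lambda>i. lam ^ i) ` {..<Suc j}" by (intro image_eqI[of _ _ "Suc i"]) auto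
  qed
  finally show ?thesis by (simp add: mult.commute)
qed

lemma V_power: "i < j \<Longrightarrow> c \<in> \<rat> \<Longrightarrow> c * lam ^ i \<in> V j"
  by (intro module_span_scale module_span_inc) auto

text \<open>A Chebyshev recurrence: \<open>2 - lam\<close> is the sum of \<omega> and its inverse,
  whose product is 1. It makes \<open>T j\<close> a polynomial in \<open>lam\<close> of degree
  j.\<close>

lemma T_rec: "T (Suc (Suc j)) = (2 - lam) * T (Suc j) - T j"
proof -
  have w: "\<omega> * inverse \<omega> = 1" by simp
  have l: "2 - lam = \<omega> + inverse \<omega>" by (simp add: dih_lambda_def)
  have "x ^ Suc (Suc j) + y ^ Suc (Suc j) = (x + y) * (x ^ Suc j + y ^ Suc j) - (x ^ j + y ^ j)"
    if "x * y = 1" for x y :: complex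
  proof -
    have "(x + y) * (x ^ Suc j + y ^ Suc j) = x ^ Suc (Suc j) + y ^ Suc (Suc j) + (x * y) * (x ^ j + y ^ j)"
      by (simp add: algebra_simps)
    thus ?thesis using that by simp
  qed
  from this[OF w] show ?thesis unfolding T_def l .
qed

lemma T_span: "T j \<in> V (Suc j) \<and> T (Suc j) - (- lam) ^ Suc j \<in> V (Suc j)"
proof (induction j)
  case 0
  have "2 * lam ^ 0 \<in> V (Suc 0)" by (rule V_power) auto
  moreover have "T (Suc 0) - (- lam) ^ Suc 0 = 2" "T 0 = 2" by (simp_all add: T_def dih_lambda_def)
  ultimately show ?case by simp
next
  case (Suc j)
  let ?t = "T (Suc j) - (- lam) ^ Suc j"
  have t: "?t \<in> V (Suc (Suc j))" using Suc V_mono[of "Suc j" "Suc (Suc j)"] by auto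
  have "(- 1) ^ Suc j * lam ^ Suc j \<in> V (Suc (Suc j))" by (rule V_power) auto
  hence pw: "(- lam) ^ Suc j \<in> V (Suc (Suc j))" by (simp only: power_minus[symmetric])
  have T1: "T (Suc j) \<in> V (Suc (Suc j))" using module_span_add[OF t pw] by simp
  have Tj: "T j \<in> V (Suc (Suc j))" using Suc V_mono[of "Suc j" "Suc (Suc j)"] by auto
  \<comment> \<open>The leading term of \<open>lam * T (Suc j)\<close> cancels against
    \<open>(- lam) ^ Suc (Suc j)\<close>, so \<open>?t\<close> appears in place of
    \<open>T (Suc j)\<close> in that product.\<close>
  have "T (Suc (Suc j)) - (- lam) ^ Suc (Suc j) = (T (Suc j) + T (Suc j)) - lam * ?t - T j"
    unfolding T_rec by (simp add: algebra_simps)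
  also have "\<dots> \<in> V (Suc (Suc j))"
    using T1 Tj V_lam Suc by (intro V_diff module_span_add) auto
  finally show ?case using T1 by simp
qed

text \<open>Shifting \<open>\<Sum>i<p. \<omega> ^ (i * q) = 0\<close> by \<open>\<omega> ^ (-d)\<close> and adding its image under \<open>\<omega> \<mapsto> \<omega>\<inverse>\<close> gives
  a relation between the numbers \<open>T \<bar>i * q - d\<bar>\<close>, in which \<open>T d\<close> occurs exactly twice.\<close>

lemma lam_power_span:
  assumes p: "prime p" and q: "q = p ^ k" and d: "2 * d = (p - 1) * q"
    and ord: "\<And>j. \<omega> ^ j = 1 \<longleftrightarrow> p * q dvd j"
  shows "lam ^ d \<in> V d"
proof -
  have p2: "p \<ge> 2" and q0: "q > 0" using p q prime_ge_2_nat[OF p] by auto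
  have d0: "d > 0" using d p2 q0 by (cases d) auto
  define t where "t i = nat \<bar>int (i * q) - int d\<bar>" for i
  have pow: "x ^ m * y ^ n = x ^ (m - n)" if "x * y = 1" "n \<le> m" for x y :: complex and m n
  proof -
    have "x ^ m = x ^ (m - n) * x ^ n" using that(2) by (simp flip: power_add)
    hence "x ^ m * y ^ n = x ^ (m - n) * (x * y) ^ n" by (simp only: power_mult_distrib mult.assoc)
    thus ?thesis by (simp add: that(1))
  qed
  have w: "\<omega> * inverse \<omega> = 1" "inverse \<omega> * \<omega> = 1" by simp_all
  have "T (t i) = \<omega> ^ (i * q) * inverse \<omega> ^ d + inverse \<omega> ^ (i * q) * \<omega> ^ d" for i
  proof (cases "d \<le> i * q")
    case True
    hence "t i = i * q - d" unfolding t_def by linarith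
    thus ?thesis unfolding T_def pow[OF w(1) True] pow[OF w(2) True] by simp
  next
    case False
    hence le: "i * q \<le> d" and "t i = d - i * q" unfolding t_def by linarith+
    thus ?thesis unfolding T_def mult.commute[of "_ ^ (i * q)"] pow[OF w(1) le] pow[OF w(2) le] by simp
  qed
  hence "(\<Sum>i<p. T (t i)) = (\<Sum>i<p. (\<omega> ^ q) ^ i) * inverse \<omega> ^ d + (\<Sum>i<p. (inverse \<omega> ^ q) ^ i) * \<omega> ^ d"
    by (simp add: sum.distrib sum_distrib_right power_mult[symmetric] mult.commute[of q])
  moreover have "(\<Sum>i<p. (\<omega> ^ q) ^ i) = 0"
  proof (rule geometric_sum_zero)
    show "(\<omega> ^ q) ^ p = 1" unfolding power_mult[symmetric] ord by (simp add: mult.commute)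
    show "\<omega> ^ q \<noteq> 1" unfolding ord using p2 q0 by (auto dest: dvd_imp_le)
  qed
  moreover have "(\<Sum>i<p. (inverse \<omega> ^ q) ^ i) = 0"
  proof (rule geometric_sum_zero)
    show "(inverse \<omega> ^ q) ^ p = 1" unfolding power_mult[symmetric] power_inverse inverse_eq_1_iff ord by (simp add: mult.commute)
    show "inverse \<omega> ^ q \<noteq> 1" unfolding power_inverse inverse_eq_1_iff ord using p2 q0 by (auto dest: dvd_imp_le)
  qed
  ultimately have "(\<Sum>i<p. T (t i)) = 0" by simp
  \<comment> \<open>Since 2 d = (p - 1) q, both ends i = 0 and i = p - 1 give the index d. Strictly
    between them i q is at least q away from 0 and 2 d, so the index is smaller than d. For p = 2
    nothing lies between, and \<open>T d\<close> vanishes.\<close>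
  moreover have "{..<p} = insert 0 (insert (p - 1) {1..<p - 1})" using p2 by auto
  hence "(\<Sum>i<p. T (t i)) = T (t 0) + (T (t (p - 1)) + (\<Sum>i\<in>{1..<p - 1}. T (t i)))"
    using p2 by simp
  moreover have "t 0 = d" by (simp add: t_def)
  moreover have "t (p - 1) = d" unfolding t_def d[symmetric] by simp
  ultimately have 2: "2 * T d = - (\<Sum>i\<in>{1..<p - 1}. T (t i))" by (simp add: eq_neg_iff_add_eq_0 add.assoc)
  have "T d = (1 / 2) * (2 * T d)" by simp
  hence Td: "T d = (- 1 / 2) * (\<Sum>i\<in>{1..<p - 1}. T (t i))" unfolding 2 by simp
  have "T (t i) \<in> V d" if "i \<in> {1..<p - 1}" for i
  proof -
    have "q \<le> i * q" using that by simp
    moreover have "i * q + q \<le> (p - 1) * q"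
    proof -
      have "Suc i * q \<le> (p - 1) * q" using that by (intro mult_le_mono1) auto
      thus ?thesis by simp
    qed
    ultimately have "t i < d" using d q0 unfolding t_def by linarith
    thus ?thesis using T_span[of "t i"] V_mono[of "Suc (t i)" d] by auto
  qed
  hence "T d \<in> V d" unfolding Td
    by (intro module_span_scale is_submodule_sum[OF is_submodule_module_span]) auto
  moreover have "T d - (- lam) ^ d \<in> V d" using T_span[of "d - 1"] d0 by simp
  ultimately have "T d - (T d - (- lam) ^ d) \<in> V d" by (rule V_diff)
  hence "(- 1) ^ d * (- lam) ^ d \<in> V d" by (intro module_span_scale) auto
  thus ?thesis by (simp flip: power_mult_distrib)
qed

section \<open>The prime power case: \<open>lam\<close> and the prime p\<close>

lemma K_subset_span:
  assumes "d > 0" "lam ^ d \<in> V d"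
  shows "K \<subseteq> V d"
proof -
  have "algebraic_int lam" using lam_ints by (rule ints_algebraic)
  from powers_span_subfield[OF this assms] have "complex_subfield (V d)" .
  moreover have "\<zeta> + inverse \<zeta> \<in> V d"
  proof -
    have "2 \<in> V d" using powers_span_subring(2)[OF assms] by (meson Rats_number_of subsetD)
    hence "lam - 2 \<in> V d" using powers_span_subring(3)[OF assms] by (intro V_diff)
    thus ?thesis by (simp add: dih_lambda_def)
  qed
  ultimately show ?thesis unfolding dih_field_def by (intro hull_minimal) auto
qed

text \<open>The unit \<open>u\<close> from the ramification of p is corrected by a power of
  \<open>- \<omega>\<close> when \<open>(1 - \<omega>) ^ (2 * d)\<close> is replaced by
  \<open>lam ^ d\<close>. Although \<open>u\<close> is found among all algebraic integers,
  \<open>w\<close> lies in K, being the quotient of p by \<open>lam ^ d\<close>.\<close>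

lemma prime_power_case:
  assumes p: "prime (p :: nat)" and l: "l \<ge> 1" and e: "e = 2 * p ^ l"
  obtains d w w' where "d > 0" "w \<in> \<O>" "w' \<in> \<O>" "w * w' = 1" "of_nat p = w * lam ^ d" "lam ^ d \<in> V d"
proof -
  obtain q k where q: "q = p ^ k" "even ((p - 1) * q)" and ord: "\<And>j. \<omega> ^ j = 1 \<longleftrightarrow> p * q dvd j"
    using omega_order[OF p l e] by blast
  obtain d where d: "2 * d = (p - 1) * q" using q(2) by (metis evenE)
  have "(p - 1) * q > 0" using q(1) prime_gt_1_nat[OF p] by simp
  hence d0: "d > 0" using d by (cases d) auto
  obtain u v where u: "algebraic_int u" "algebraic_int v" "u * v = 1" "of_nat p = u * (1 - \<omega>) ^ (2 * d)"
    using prime_power_ramified[OF p refl q(1) ord] d by metis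
  define w where "w = u * (- \<omega>) ^ d"
  define w' where "w' = v * (- inverse \<omega>) ^ d"
  have o: "(- \<omega>) ^ d * (- inverse \<omega>) ^ d = 1" by (simp flip: power_mult_distrib)
  have "lam ^ d = (- inverse \<omega>) ^ d * (1 - \<omega>) ^ (2 * d)"
    unfolding lam_square by (simp only: power_mult_distrib power_mult)
  hence "w * lam ^ d = u * ((- \<omega>) ^ d * (- inverse \<omega>) ^ d) * (1 - \<omega>) ^ (2 * d)"
    unfolding w_def by (simp only: mult_ac)
  hence pw: "of_nat p = w * lam ^ d" unfolding o u(4) by simp
  have "w * w' = (u * v) * ((- \<omega>) ^ d * (- inverse \<omega>) ^ d)" unfolding w_def w'_def by (simp only: mult_ac)
  hence ww: "w * w' = 1" unfolding o u(3) by simp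
  have "w = of_nat p / lam ^ d" using pw lam_nonzero by simp
  moreover have "of_nat p / lam ^ d \<in> K"
    using K_of_int[of "int p"] subring_power[OF subring_K ints_in_K[OF lam_ints]] by (intro K_divide) auto
  ultimately have wK: "w \<in> K" by simp
  have "w' = inverse w" using ww by (metis inverse_unique)
  hence wK': "w' \<in> K" using wK by (simp only: K_closed(6))
  have am: "algebraic_int (- \<omega>)" "algebraic_int (- inverse \<omega>)" using algebraic_int_omega by blast+
  have "algebraic_int w" "algebraic_int w'"
    unfolding w_def w'_def using u am by (auto intro!: algebraic_int_closed(2,3))
  with wK wK' have "w \<in> \<O>" "w' \<in> \<O>" unfolding ring_of_integers_def by blast+
  with that d0 ww pw lam_power_span[OF p q(1) d ord] show ?thesis by blast
qed

text \<open>If \<open>lam\<close> were a unit, then so would p be, as a unit times a power of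
  \<open>lam\<close>; but 1 / p is not an algebraic integer.\<close>

lemma lam_nonunit:
  assumes p: "prime (p :: nat)" and l: "l \<ge> 1" and e: "e = 2 * p ^ l"
  shows "inverse lam \<notin> \<O>"
proof
  assume i: "inverse lam \<in> \<O>"
  obtain d w w' where w: "w \<in> \<O>" "w' \<in> \<O>" "w * w' = 1" "of_nat p = w * lam ^ d"
    using prime_power_case[OF assms] by metis
  have "of_nat p * (w' * inverse lam ^ d) = (w * w') * (lam * inverse lam) ^ d"
    unfolding w(4) power_mult_distrib by (simp only: mult_ac)
  hence "inverse (of_nat p) = w' * inverse lam ^ d"
    using w(3) lam_nonzero by (intro inverse_unique) simp
  moreover have "w' * inverse lam ^ d \<in> \<O>" using w i subring_power[OF subring_ints i] by (intro ints_closed(4))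
  ultimately have "algebraic_int (inverse (of_nat p) :: complex)" using ints_algebraic by simp
  thus False using not_algebraic_int_inverse_prime[OF p] by blast
qed

text \<open>If a were prime to p, a Bezout relation would write 1 as a combination of a and p, both
  multiples of \<open>lam\<close>, and make \<open>lam\<close> a unit.\<close>

lemma lam_prime_dvd:
  assumes p: "prime (p :: nat)" and l: "l \<ge> 1" and e: "e = 2 * p ^ l"
    and a: "of_int a = lam * y" "y \<in> \<O>"
  shows "int p dvd a"
proof (rule ccontr)
  assume "\<not> int p dvd a"
  hence "coprime (int p) a" using p by (intro prime_imp_coprime) auto
  then obtain u v where "u * int p + v * a = 1" using bezout_int[of "int p" a] by auto
  hence 1: "of_int u * of_nat p + of_int v * of_int a = (1 :: complex)"
    by (metis of_int_1 of_int_add of_int_mult of_int_of_nat_eq)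
  obtain d w w' where w: "d > 0" "w \<in> \<O>" "of_nat p = w * lam ^ d"
    using prime_power_case[OF p l e] by metis
  have "lam ^ d = lam * lam ^ (d - 1)" using w(1) by (cases d) auto
  hence "lam * (of_int u * w * lam ^ (d - 1) + of_int v * y) = 1"
    using 1 unfolding w(3) a(1) by (simp add: algebra_simps)
  hence "inverse lam = of_int u * w * lam ^ (d - 1) + of_int v * y" by (rule inverse_unique)
  also have "\<dots> \<in> \<O>" using w a subring_power[OF subring_ints lam_ints] by (intro ints_closed(3,4,6))
  finally show False using lam_nonunit[OF p l e] by blast
qed

text \<open>As p is a multiple of \<open>lam ^ d\<close>, dividing the relation by \<open>lam ^ j\<close> leaves \<open>a j\<close> as a multiple of \<open>lam\<close>,
  once the lower coefficients are known to be multiples of p.\<close>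

lemma eisenstein_divides:
  assumes p: "prime (p :: nat)" and l: "l \<ge> 1" and e: "e = 2 * p ^ l"
    and w: "w \<in> \<O>" "of_nat p = w * lam ^ d"
    and sum: "(\<Sum>i<d. of_int (a i) * lam ^ i) = of_nat p * y" "y \<in> \<O>"
  shows "j < d \<Longrightarrow> int p dvd a j"
proof (induction j rule: less_induct)
  case (less j)
  define b where "b i = a i div int p" for i
  have ab: "a i = int p * b i" if "i < j" for i using less.IH[OF that] less.prems that by (simp add: b_def)
  \<comment> \<open>Moving the terms below j, already multiples of p, to the right side leaves
    \<open>of_nat p * y'\<close> there, while \<open>lam * r\<close> collects the terms above j
    after division by \<open>lam ^ j\<close>.\<close>
  define y' where "y' = y - (\<Sum>i<j. of_int (b i) * lam ^ i)"
  define r where "r = (\<Sum>i\<in>{Suc j..<d}. of_int (a i) * lam ^ (i - Suc j))"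
  note lp = subring_power[OF subring_ints lam_ints]
  have "y' \<in> \<O>" unfolding y'_def using sum(2) lp by (intro ints_diff subring_sum[OF subring_ints] ints_closed(4,6))
  have "r \<in> \<O>" unfolding r_def using lp by (intro subring_sum[OF subring_ints] ints_closed(4,6))
  have split: "{..<d} = {..<j} \<union> insert j {Suc j..<d}" using less.prems by auto
  have "(\<Sum>i<d. of_int (a i) * lam ^ i) = (\<Sum>i<j. of_int (a i) * lam ^ i) +
      (of_int (a j) * lam ^ j + (\<Sum>i\<in>{Suc j..<d}. of_int (a i) * lam ^ i))"
    unfolding split by (subst sum.union_disjoint) auto
  moreover have "(\<Sum>i<j. of_int (a i) * lam ^ i) = of_nat p * (\<Sum>i<j. of_int (b i) * lam ^ i)"
    using ab by (simp add: sum_distrib_left mult.assoc)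
  moreover have "(\<Sum>i\<in>{Suc j..<d}. of_int (a i) * lam ^ i) = lam ^ j * (lam * r)"
    unfolding r_def sum_distrib_left
  proof (rule sum.cong[OF refl])
    fix i assume "i \<in> {Suc j..<d}"
    hence "lam ^ i = lam ^ j * (lam * lam ^ (i - Suc j))"
      by (simp flip: power_Suc power_add)
    thus "of_int (a i) * lam ^ i = lam ^ j * (lam * (of_int (a i) * lam ^ (i - Suc j)))"
      by (simp only: mult_ac)
  qed
  \<comment> \<open>As j < d, a factor \<open>lam\<close> of p survives the division by
    \<open>lam ^ j\<close>.\<close>
  moreover have "of_nat p = lam ^ j * (lam * (w * lam ^ (d - Suc j)))"
  proof -
    have "lam ^ d = lam ^ j * (lam * lam ^ (d - Suc j))"
      using less.prems by (simp flip: power_Suc power_add)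
    thus ?thesis unfolding w(2) by (simp only: mult_ac)
  qed
  ultimately have "lam ^ j * (of_int (a j) + lam * r) = lam ^ j * (lam * (w * lam ^ (d - Suc j)) * y')"
    using sum(1) unfolding y'_def by (simp add: algebra_simps)
  hence "of_int (a j) + lam * r = lam * (w * lam ^ (d - Suc j)) * y'"
    using lam_nonzero by simp
  hence "of_int (a j) = lam * (w * lam ^ (d - Suc j) * y' - r)" by (simp add: algebra_simps)
  moreover have "w * lam ^ (d - Suc j) * y' - r \<in> \<O>"
    using w \<open>y' \<in> \<O>\<close> \<open>r \<in> \<O>\<close> lp by (intro ints_diff ints_closed(4))
  ultimately show ?case using lam_prime_dvd[OF p l e] by blast
qed

text \<open>For minimal N the combination representing N x is congruent to \<open>a 0\<close> modulo
  \<open>lam\<close>. Since N is prime to p and p is a multiple of \<open>lam\<close>, an inverse v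
  of N modulo p gives x congruent to \<open>v * a 0\<close>.\<close>

lemma ints_mod_lam:
  assumes p: "prime (p :: nat)" and l: "l \<ge> 1" and e: "e = 2 * p ^ l" and x: "x \<in> \<O>"
  shows "\<exists>n y. y \<in> \<O> \<and> x = of_int n + lam * y"
proof -
  obtain d w w' where w: "d > 0" "w \<in> \<O>" "of_nat p = w * lam ^ d" "lam ^ d \<in> V d"
    using prime_power_case[OF p l e] by metis
  define P where "P N \<longleftrightarrow> N > 0 \<and> of_nat N * x \<in> module_span \<int> (*) ((\<lambda>i. lam ^ i) ` {..<d})" for N
  have "x \<in> V d" using K_subset_span[OF w(1,4)] x by auto
  hence ex: "\<exists>N. P N" unfolding P_def by (rule module_span_Rats_denominator)
  define N where "N = (LEAST N. P N)"
  have PN: "P N" and min: "\<And>M. P M \<Longrightarrow> N \<le> M"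
    unfolding N_def using LeastI_ex[OF ex] Least_le by blast+
  have span: "module_span \<int> (*) ((\<lambda>i. lam ^ i) ` {..<d}) = {\<Sum>i<d. c i * lam ^ i |c. \<forall>i. c i \<in> \<int>}"
    by (rule module_span_image[OF complex_subring_Ints]) simp
  obtain c where c: "of_nat N * x = (\<Sum>i<d. c i * lam ^ i)" "\<forall>i. c i \<in> \<int>" using PN unfolding P_def span by blast
  have "\<exists>b. c i = of_int b" for i using c(2)[rule_format, of i] by (auto elim: Ints_cases)
  then obtain a where "\<And>i. c i = of_int (a i)" by metis
  hence a: "of_nat N * x = (\<Sum>i<d. of_int (a i) * lam ^ i)" using c(1) by simp
  have p0: "p > 0" "p > 1" using prime_gt_1_nat[OF p] by auto
  \<comment> \<open>If p divided N, then by the preceding lemma \<open>N / p\<close> would do as well.\<close>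
  have "\<not> p dvd N"
  proof
    assume "p dvd N"
    then obtain M where M: "N = p * M" by auto
    have "of_nat M * x \<in> \<O>" using x ints_closed(6)[of "int M"] by (intro ints_closed(4)) auto
    moreover have "(\<Sum>i<d. of_int (a i) * lam ^ i) = of_nat p * (of_nat M * x)" using a M by (simp add: mult.assoc)
    ultimately have "int p dvd a j" if "j < d" for j using eisenstein_divides[OF p l e w(2,3)] that by blast
    hence ab: "a j = int p * (a j div int p)" if "j < d" for j using that by simp
    have "of_nat p * (of_nat M * x) = of_nat p * (\<Sum>i<d. of_int (a i div int p) * lam ^ i)"
    proof -
      have "of_nat p * (\<Sum>i<d. of_int (a i div int p) * lam ^ i) = (\<Sum>i<d. of_int (int p * (a i div int p)) * lam ^ i)"
        by (simp add: sum_distrib_left mult.assoc)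
      also have "\<dots> = (\<Sum>i<d. of_int (a i) * lam ^ i)" using ab by (intro sum.cong) auto
      finally show ?thesis using a M by (simp add: mult.assoc)
    qed
    hence "of_nat M * x = (\<Sum>i<d. of_int (a i div int p) * lam ^ i)" using p0 by simp
    moreover have "M > 0" using PN M by (auto simp: P_def intro: gr0I)
    ultimately have "P M" unfolding P_def span
      by (auto intro!: exI[of _ "\<lambda>i. of_int (a i div int p)"])
    hence "N \<le> M" by (rule min)
    thus False using M p0 \<open>M > 0\<close> by simp
  qed
  hence "coprime (int p) (int N)" using p by (simp add: prime_imp_coprime)
  then obtain u v where "u * int p + v * int N = 1" using bezout_int[of "int p" "int N"] by auto
  hence 1: "of_int u * of_nat p + of_int v * of_nat N = (1 :: complex)"
    by (metis of_int_1 of_int_add of_int_mult of_int_of_nat_eq)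
  note lp = subring_power[OF subring_ints lam_ints]
  define r where "r = (\<Sum>i\<in>{1..<d}. of_int (a i) * lam ^ (i - 1))"
  have "r \<in> \<O>" unfolding r_def using lp by (intro subring_sum[OF subring_ints] ints_closed(4,6))
  have "{..<d} = insert 0 {1..<d}" using w(1) by auto
  hence "of_nat N * x = of_int (a 0) + (\<Sum>i\<in>{1..<d}. of_int (a i) * lam ^ i)" unfolding a by simp
  also have "(\<Sum>i\<in>{1..<d}. of_int (a i) * lam ^ i) = lam * r"
    unfolding r_def sum_distrib_left
  proof (rule sum.cong[OF refl])
    fix i assume "i \<in> {1..<d}"
    hence "lam ^ i = lam * lam ^ (i - 1)" by (simp flip: power_Suc)
    thus "of_int (a i) * lam ^ i = lam * (of_int (a i) * lam ^ (i - 1))" by simp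
  qed
  finally have Nx: "of_nat N * x = of_int (a 0) + lam * r" .
  have pl: "of_nat p = lam * (w * lam ^ (d - 1))"
    unfolding w(3) using w(1) by (cases d) (auto simp: mult_ac)
  have "x = (of_int u * of_nat p + of_int v * of_nat N) * x" unfolding 1 by simp
  also have "\<dots> = of_int u * of_nat p * x + of_int v * (of_nat N * x)" by (simp add: algebra_simps)
  also have "\<dots> = of_int (v * a 0) + lam * (of_int u * (w * lam ^ (d - 1)) * x + of_int v * r)"
    unfolding Nx pl by (simp add: algebra_simps)
  finally have "x = of_int (v * a 0) + lam * (of_int u * (w * lam ^ (d - 1)) * x + of_int v * r)" .
  moreover have "of_int u * (w * lam ^ (d - 1)) * x + of_int v * r \<in> \<O>"
    using w(2) lp x \<open>r \<in> \<O>\<close> by (intro ints_closed(3,4,6))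
  ultimately show ?thesis by blast
qed

text \<open>The element is congruent to a rational integer n that p does not divide, so the Bezout
  coefficient of n serves as its inverse modulo \<open>lam\<close>.\<close>

lemma lam_maximal:
  assumes p: "prime (p :: nat)" and l: "l \<ge> 1" and e: "e = 2 * p ^ l"
    and x: "x \<in> \<O>" "x \<notin> principal_ideal K lam"
  shows "\<exists>y\<in>\<O>. 1 - x * y \<in> principal_ideal K lam"
proof -
  obtain n z where n: "z \<in> \<O>" "x = of_int n + lam * z" using ints_mod_lam[OF p l e x(1)] by blast
  obtain d w w' where w: "d > 0" "w \<in> \<O>" "of_nat p = w * lam ^ d"
    using prime_power_case[OF p l e] by metis
  note lp = subring_power[OF subring_ints lam_ints]
  have pl: "of_nat p = lam * (w * lam ^ (d - 1))"
    unfolding w(3) using w(1) by (cases d) (auto simp: mult_ac)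
  have "\<not> int p dvd n"
  proof
    assume "int p dvd n"
    then obtain m where "n = int p * m" by auto
    hence "x = of_nat p * of_int m + lam * z" using n by simp
    hence "x = lam * (w * lam ^ (d - 1) * of_int m + z)" unfolding pl by (simp add: algebra_simps)
    moreover have "w * lam ^ (d - 1) * of_int m + z \<in> \<O>" using w(2) lp n by (intro ints_closed(3,4,6))
    ultimately show False using x(2) unfolding principal_ideal_def by blast
  qed
  hence "coprime (int p) n" using p by (simp add: prime_imp_coprime)
  then obtain u v where "u * int p + v * n = 1" using bezout_int[of "int p" n] by auto
  hence 1: "of_int u * of_nat p + of_int v * of_int n = (1 :: complex)"
    by (metis of_int_1 of_int_add of_int_mult of_int_of_nat_eq)
  have "1 - x * of_int v = lam * (of_int u * (w * lam ^ (d - 1)) - z * of_int v)"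
    unfolding 1[symmetric] n(2) pl by (simp add: algebra_simps)
  moreover have "of_int u * (w * lam ^ (d - 1)) - z * of_int v \<in> \<O>"
    using w(2) lp n(1) by (intro ints_diff ints_closed(4,6))
  ultimately show ?thesis unfolding principal_ideal_def by blast
qed

end

theorem proposition5p12:
  fixes e :: nat
  assumes "e \<ge> 3"
  shows
    "(root_system_for (dih_field e) (dih_group e) (dih_roots e) \<and>
      complete_system (dih_field e) (dih_group e) (dih_roots e) \<and>
      reduced_system (dih_field e) (dih_roots e) \<and>
      distinguished_system (dih_field e) (dih_group e) (dih_roots e) \<and>
      principal_system (dih_field e) (dih_roots e) \<and>
      root_basis (dih_field e) (dih_roots e) {root_s e, root_t e}) \<and>
     (\<not> (\<exists>p l :: nat. prime p \<and> l \<ge> 1 \<and> e = 2 * p ^ l) \<longrightarrow>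
      reduced_genera (dih_field e) (dih_group e) =
        {genus (dih_field e) (dih_group e) (dih_roots e)}) \<and>
     ((\<exists>p l :: nat. prime p \<and> l \<ge> 1 \<and> e = 2 * p ^ l) \<longrightarrow>
      root_system_for (dih_field e) (dih_group e) (dih_roots' e) \<and>
      reduced_system (dih_field e) (dih_roots' e) \<and>
      principal_system (dih_field e) (dih_roots' e) \<and>
      genus (dih_field e) (dih_group e) (dih_roots' e) \<noteq>
        genus (dih_field e) (dih_group e) (dih_roots e) \<and>
      reduced_genera (dih_field e) (dih_group e) =
        {genus (dih_field e) (dih_group e) (dih_roots e),
         genus (dih_field e) (dih_group e) (dih_roots' e)})"
proof -
  interpret dihedral e by unfold_locales (rule assms)
  \<comment> \<open>Principality was shown for ideals given by a generator, so \<O> is presented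
    with generator 1.\<close>
  have ints: "system (principal_ideal (dih_field e) 1) (principal_ideal (dih_field e) 1) = dih_roots e"
    by (simp add: prin_one dih_roots_eq)
  have 1: "root_system_for (dih_field e) (dih_group e) (dih_roots e) \<and>
      complete_system (dih_field e) (dih_group e) (dih_roots e) \<and>
      reduced_system (dih_field e) (dih_roots e) \<and>
      distinguished_system (dih_field e) (dih_group e) (dih_roots e) \<and>
      principal_system (dih_field e) (dih_roots e) \<and>
      root_basis (dih_field e) (dih_roots e) {root_s e, root_t e}"
    using principal_system_system[of 1 1] root_system_system[OF compatible_ints]
      complete_system_system[OF compatible_ints] reduced_system_system[OF compatible_ints]
      distinguished_system_system[OF compatible_ints] root_basis_dih
    by (simp add: ints dih_roots_eq)
  have 2: "reduced_genera (dih_field e) (dih_group e) = {genus (dih_field e) (dih_group e) (dih_roots e)}"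
    if "\<not> (\<exists>p l :: nat. prime p \<and> l \<ge> 1 \<and> e = 2 * p ^ l)"
    unfolding dih_roots_eq using reduced_genera_unit[OF lam_unit[OF that] lam_nonzero] .
  have 3: "root_system_for (dih_field e) (dih_group e) (dih_roots' e) \<and>
      reduced_system (dih_field e) (dih_roots' e) \<and>
      principal_system (dih_field e) (dih_roots' e) \<and>
      genus (dih_field e) (dih_group e) (dih_roots' e) \<noteq>
        genus (dih_field e) (dih_group e) (dih_roots e) \<and>
      reduced_genera (dih_field e) (dih_group e) =
        {genus (dih_field e) (dih_group e) (dih_roots e),
         genus (dih_field e) (dih_group e) (dih_roots' e)}"
    if pl: "\<exists>p l :: nat. prime p \<and> l \<ge> 1 \<and> e = 2 * p ^ l"
  proof -
    obtain p l :: nat where p: "prime p" "l \<ge> 1" "e = 2 * p ^ l" using pl by blast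
    have "even e" using p(3) by simp
    note eq = dih_roots'_eq[OF this lam_nonzero]
    note c = compatible_lam[OF lam_nonzero]
    show ?thesis
      unfolding eq dih_roots_eq
      using root_system_system[OF c] reduced_system_system[OF c]
        principal_system_system[OF lam_nonzero one_neq_zero] genera_distinct[OF lam_nonzero lam_nonunit[OF p]]
        reduced_genera_maximal[OF lam_maximal[OF p] lam_nonzero]
      by (simp add: prin_one)
  qed
  show ?thesis using 1 2 3 by blast
qed

end
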